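(* Let $\ell\in\mathbb{Z}_{>0}$, $d\in\mathbb{Z}_{\geq 0}$, $\boldsymbol{\lambda}\in\Lambda(\ell,d)$, $\mathbf{p}\in\mathbf{T}_{\boldsymbol{\lambda}}$, and let $f:\underline{d}\to\underline{\ell}$ be an object of $\mathcal{G}_{(\ell,d)}$ of type $\boldsymbol{\lambda}$. Let $G^f\subseteq S(\ell,d)$ be the generalized Young subgroup attached to $f$, and let $\overline{\Phi}(\mathrm{L}_{\mathbf{p}})$ be the $S(\ell,d)$-module corresponding to $\mathrm{L}_{\mathbf{p}}$ (all as in the context). (i) The space $\mathrm{L}_{\mathbf{p}}(f)$ inherits, by restriction of the action on $\overline{\Phi}(\mathrm{L}_{\mathbf{p}})$, the structure of a simple $G^f$-module. (ii) The $S(\ell,d)$-modules $\overline{\Phi}(\mathrm{L}_{\mathbf{p}})$ and $\mathrm{Ind}_{G^f}^{S(\ell,d)}\mathrm{L}_{\mathbf{p}}(f)$ are isomorphic.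
   Context: Write $\underline{n}=\{1,\dots,n\}$. $\mathbf{C}_\ell$ is the group of complex $\ell$-th roots of unity with fixed generator $\xi_\ell$. $S(\ell,d)=\mathbf{C}_\ell\wr S_d$ is the group of complex $d\times d$ matrices with exactly one non-zero entry in each row and column, all non-zero entries in $\mathbf{C}_\ell$; $S_d$ is its subgroup of permutation matrices ($\sigma$ sends $\epsilon_j$ to $\epsilon_{\sigma(j)}$). For $j\in\underline{d}$, $s_0^{(j)}$ is the diagonal matrix with $(j,j)$-entry $\xi_\ell$ and other diagonal entries $1$; $s_0=s_0^{(1)}$. The groupoid $\mathcal{G}_{(\ell,d)}$: objects are all maps $f:\underline{d}\to\underline{\ell}$; morphisms from $f$ to $g$ are all bijections $\sigma:\underline{d}\to\underline{d}$ with $g\circ\sigma=f$; composition is composition of maps; $e_f$ is the identity of $f$. $A_{(\ell,d)}$ is the algebra with basis all morphisms, product being composition if defined and $0$ otherwise. There is an algebra isomorphism $\Phi:\mathbb{C}[S(\ell,d)]\to A_{(\ell,d)}$ determined by $\Phi(\sigma)=\sum_{f,g}\sigma_{(f,g)}$ for $\sigma\in S_d$ (where $\sigma_{(f,g)}$ is $\sigma$ viewed as a morphism $f\to g$ if $g\circ\sigma=f$, and $0$ otherwise) and $\Phi(s_0)=\sum_f\xi_\ell^{f(1)}e_f$. $\Lambda(\ell,d)$ is the set of $(\lambda_1,\dots,\lambda_\ell)\in\mathbb{Z}_{\geq 0}^\ell$ with sum $d$; the type of $f$ is $(|f^{-1}(1)|,\dots,|f^{-1}(\ell)|)$. $\mathbf{T}_{\boldsymbol{\lambda}}$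 is the set of tuples of partitions $\mathbf{p}=(p_1,\dots,p_\ell)$ with $p_i\vdash\lambda_i$, and $\mathscr{S}_{\mathbf{p}}=\mathscr{S}_{p_1}\otimes\dots\otimes\mathscr{S}_{p_\ell}$ is the external tensor product of Specht modules, a module over $S_{\boldsymbol{\lambda}}=S_{\lambda_1}\times\dots\times S_{\lambda_\ell}$. For $f,g$ of the same type, $\sigma_{f,g}:f\to g$ is the unique morphism such that $i<j$, $f(i)=f(j)$ imply $\sigma_{f,g}(i)<\sigma_{f,g}(j)$. $f_{\boldsymbol{\lambda}}$ is the unique weakly increasing object of type $\boldsymbol{\lambda}$; its endomorphism group is identified with $S_{\boldsymbol{\lambda}}$. $\mathrm{L}_{\mathbf{p}}$ is the $\mathbb{C}$-linear functor from the linearization of $\mathcal{G}_{(\ell,d)}$ to vector spaces with $\mathrm{L}_{\mathbf{p}}(f)=\mathscr{S}_{\mathbf{p}}$ if $f$ has type $\boldsymbol{\lambda}$ and $0$ otherwise, and $\mathrm{L}_{\mathbf{p}}(\pi)v=(\sigma_{g,f_{\boldsymbol{\lambda}}}\pi\sigma_{f_{\boldsymbol{\lambda}},f})(v)$ for $\pi:f\to g$ with $f,g$ of type $\boldsymbol{\lambda}$. The corresponding $A_{(\ell,d)}$-module is $\bigoplus_f\mathrm{L}_{\mathbf{p}}(f)$, and $\overline{\Phi}(\mathrm{L}_{\mathbf{p}})$ is this space viewed as an $S(\ell,d)$-module via $\Phi$. For $f$ as in the claim put $X_i^f=\{j\in\underline{d}\mid f(j)=i\}$, let $G_i^f$ be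 the subgroup of $S(\ell,d)$ generated by all $s_0^{(j)}$, $j\in X_i^f$, and all permutations of $X_i^f$ fixing all points outside $X_i^f$, and let $G^f=G_1^f\times\dots\times G_\ell^f\subseteq S(\ell,d)$. *)

theory Defs
  imports
    "HOL-Algebra.Sym_Groups"
    "HOL-Algebra.Product_Groups"
    "HOL-Algebra.Module"
    "HOL-Algebra.QuotRing"
    "HOL-Combinatorics.Permutations"
    "Jordan_Normal_Form.Matrix"
begin

section \<open>Complex vector spaces and representations\<close>

definition complex_field :: "complex ring" where
  "complex_field = \<lparr>carrier = UNIV, mult = (*), one = 1, zero = 0, add = (+)\<rparr>"

text \<open>
  The record type of modules extends the one of rings; for the vector spaces below the
  multiplicative components are irrelevant and left \<open>undefined\<close>.
\<close>

definition fun_space :: "('x \<Rightarrow> complex) set \<Rightarrow> (complex, 'x \<Rightarrow> complex) module" where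
  "fun_space V = \<lparr>carrier = V, mult = undefined, one = undefined,
     zero = (\<lambda>_. 0), add = (\<lambda>u v x. u x + v x), module.smult = (\<lambda>c u x. c * u x)\<rparr>"

definition lin_span :: "(complex, 'v, 'n) module_scheme \<Rightarrow> 'v set \<Rightarrow> 'v set" where
  "lin_span V B = \<Inter>{W. submodule W complex_field V \<and> B \<subseteq> W}"

text \<open>Direct sums are only taken over finite index sets, hence agree with direct products.\<close>

definition direct_sum :: "'i set \<Rightarrow> ('i \<Rightarrow> (complex, 'v) module) \<Rightarrow> (complex, 'i \<Rightarrow> 'v) module" where
  "direct_sum I V = \<lparr>carrier = (\<Pi>\<^sub>E i\<in>I. carrier (V i)), mult = undefined, one = undefined,
     zero = (\<lambda>i\<in>I. \<zero>\<^bsub>V i\<^esub>), add = (\<lambda>u v. \<lambda>i\<in>I. u i \<oplus>\<^bsub>V i\<^esub> v i),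
     module.smult = (\<lambda>c u. \<lambda>i\<in>I. c \<odot>\<^bsub>V i\<^esub> u i)\<rparr>"

definition quotient_space ::
    "(complex, 'v, 'n) module_scheme \<Rightarrow> 'v set \<Rightarrow> (complex, 'v set) module" where
  "quotient_space V N = \<lparr>carrier = a_rcosets\<^bsub>V\<^esub> N, mult = undefined, one = undefined,
     zero = N, add = (\<lambda>A B. A <+>\<^bsub>V\<^esub> B),
     module.smult = (\<lambda>c A. \<Union>u\<in>A. N +>\<^bsub>V\<^esub> (c \<odot>\<^bsub>V\<^esub> u))\<rparr>"

definition linear_maps ::
    "(complex, 'v, 'm) module_scheme \<Rightarrow> (complex, 'w, 'n) module_scheme \<Rightarrow> ('v \<Rightarrow> 'w) set" where
  "linear_maps V W = {T \<in> carrier V \<rightarrow> carrier W.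
     (\<forall>u\<in>carrier V. \<forall>v\<in>carrier V. T (u \<oplus>\<^bsub>V\<^esub> v) = T u \<oplus>\<^bsub>W\<^esub> T v) \<and>
     (\<forall>c. \<forall>v\<in>carrier V. T (c \<odot>\<^bsub>V\<^esub> v) = c \<odot>\<^bsub>W\<^esub> T v)}"

definition representation ::
    "('g, 'm) monoid_scheme \<Rightarrow> (complex, 'v, 'n) module_scheme \<Rightarrow> ('g \<Rightarrow> 'v \<Rightarrow> 'v) \<Rightarrow> bool" where
  "representation G V \<rho> \<longleftrightarrow> group G \<and> module complex_field V \<and>
     (\<forall>g\<in>carrier G. \<rho> g \<in> linear_maps V V) \<and>
     (\<forall>v\<in>carrier V. \<rho> \<one>\<^bsub>G\<^esub> v = v) \<and>
     (\<forall>g\<in>carrier G. \<forall>h\<in>carrier G. \<forall>v\<in>carrier V. \<rho> (g \<otimes>\<^bsub>G\<^esub> h) v = \<rho> g (\<rho> h v))"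

definition simple_representation ::
    "('g, 'm) monoid_scheme \<Rightarrow> (complex, 'v, 'n) module_scheme \<Rightarrow> ('g \<Rightarrow> 'v \<Rightarrow> 'v) \<Rightarrow> bool" where
  "simple_representation G V \<rho> \<longleftrightarrow> representation G V \<rho> \<and> carrier V \<noteq> {\<zero>\<^bsub>V\<^esub>} \<and>
     (\<forall>W. submodule W complex_field V \<and> (\<forall>g\<in>carrier G. \<forall>w\<in>W. \<rho> g w \<in> W) \<longrightarrow>
        W = {\<zero>\<^bsub>V\<^esub>} \<or> W = carrier V)"

definition isomorphic_representations ::
    "('g, 'k) monoid_scheme \<Rightarrow> (complex, 'v, 'm) module_scheme \<Rightarrow> ('g \<Rightarrow> 'v \<Rightarrow> 'v) \<Rightarrow>
     (complex, 'w, 'n) module_scheme \<Rightarrow> ('g \<Rightarrow> 'w \<Rightarrow> 'w) \<Rightarrow> bool" where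
  "isomorphic_representations G V \<rho> W \<tau> \<longleftrightarrow> representation G V \<rho> \<and> representation G W \<tau> \<and>
     (\<exists>T \<in> linear_maps V W. bij_betw T (carrier V) (carrier W) \<and>
        (\<forall>g\<in>carrier G. \<forall>v\<in>carrier V. T (\<rho> g v) = \<tau> g (T v)))"

text \<open>
  For a finite group \<open>G\<close>, a subgroup \<open>H\<close> and a representation \<open>\<rho>\<close> of \<open>H\<close> on \<open>W\<close>, the induced
  representation is $\mathbb{C}[G] \otimes_{\mathbb{C}[H]} W$, i.e. the quotient of
  $\mathbb{C}[G] \otimes_{\mathbb{C}} W = \bigoplus_{g \in G} g \otimes W$ by the span of all
  $gh \otimes w - g \otimes \rho(h) w$, on which \<open>x \<in> G\<close> acts by
  $g \otimes w \mapsto xg \otimes w$.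
\<close>

definition group_tensor ::
    "('g, 'k) monoid_scheme \<Rightarrow> (complex, 'w) module \<Rightarrow> (complex, 'g \<Rightarrow> 'w) module" where
  "group_tensor G W = direct_sum (carrier G) (\<lambda>_. W)"

definition tensor_elem ::
    "('g, 'k) monoid_scheme \<Rightarrow> (complex, 'w) module \<Rightarrow> 'g \<Rightarrow> 'w \<Rightarrow> ('g \<Rightarrow> 'w)" where
  "tensor_elem G W g w = (\<lambda>x\<in>carrier G. if x = g then w else \<zero>\<^bsub>W\<^esub>)"

definition induced_relations ::
    "('g, 'k) monoid_scheme \<Rightarrow> 'g set \<Rightarrow> (complex, 'w) module \<Rightarrow> ('g \<Rightarrow> 'w \<Rightarrow> 'w) \<Rightarrow> ('g \<Rightarrow> 'w) set" where
  "induced_relations G H W \<rho> = lin_span (group_tensor G W)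
     {tensor_elem G W (g \<otimes>\<^bsub>G\<^esub> h) w \<ominus>\<^bsub>group_tensor G W\<^esub> tensor_elem G W g (\<rho> h w) | g h w.
        g \<in> carrier G \<and> h \<in> H \<and> w \<in> carrier W}"

definition induced_module ::
    "('g, 'k) monoid_scheme \<Rightarrow> 'g set \<Rightarrow> (complex, 'w) module \<Rightarrow> ('g \<Rightarrow> 'w \<Rightarrow> 'w) \<Rightarrow>
     (complex, ('g \<Rightarrow> 'w) set) module" where
  "induced_module G H W \<rho> = quotient_space (group_tensor G W) (induced_relations G H W \<rho>)"

definition induced_action ::
    "('g, 'k) monoid_scheme \<Rightarrow> 'g \<Rightarrow> ('g \<Rightarrow> 'w) set \<Rightarrow> ('g \<Rightarrow> 'w) set" where
  "induced_action G x A = (\<lambda>u. \<lambda>g\<in>carrier G. u (inv\<^bsub>G\<^esub> x \<otimes>\<^bsub>G\<^esub> g)) ` A"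


section \<open>The generalized symmetric group\<close>

text \<open>
  Rows and columns of matrices are numbered from 0, so the entry usually written $w_{i,j}$ with
  $i, j \in \{1, \dots, d\}$ is at position $(i - 1, j - 1)$.
\<close>

definition gen_sym_group :: "nat \<Rightarrow> nat \<Rightarrow> complex mat monoid" where
  "gen_sym_group l d = \<lparr>carrier = {w \<in> carrier_mat d d.
       (\<forall>i<d. \<exists>!j. j < d \<and> w $$ (i, j) \<noteq> 0) \<and> (\<forall>j<d. \<exists>!i. i < d \<and> w $$ (i, j) \<noteq> 0) \<and>
       (\<forall>i<d. \<forall>j<d. w $$ (i, j) \<noteq> 0 \<longrightarrow> w $$ (i, j) ^ l = 1)},
     mult = (*), one = 1\<^sub>m d\<rparr>"

definition perm_mat :: "nat \<Rightarrow> (nat \<Rightarrow> nat) \<Rightarrow> complex mat" where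
  "perm_mat d \<sigma> = mat d d (\<lambda>(i, j). if Suc i = \<sigma> (Suc j) then 1 else 0)"

definition s0 :: "nat \<Rightarrow> complex \<Rightarrow> nat \<Rightarrow> complex mat" where
  "s0 d \<xi> j = mat d d (\<lambda>(r, c). if r \<noteq> c then 0 else if Suc r = j then \<xi> else 1)"


section \<open>The groupoid and its algebra\<close>

definition gpd_obj :: "nat \<Rightarrow> nat \<Rightarrow> (nat \<Rightarrow> nat) set" where
  "gpd_obj l d = {1..d} \<rightarrow>\<^sub>E {1..l}"

text \<open>
  A morphism $\sigma \colon f \to g$ is represented as the triple \<open>(f, \<sigma>, g)\<close>. Bijections of
  $\{1, \dots, d\}$ are extended by the identity, so \<open>g \<circ> \<sigma> = f\<close> may be required globally.
\<close>

type_synonym mor = "(nat \<Rightarrow> nat) \<times> (nat \<Rightarrow> nat) \<times> (nat \<Rightarrow> nat)"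

definition gpd_mor :: "nat \<Rightarrow> nat \<Rightarrow> mor set" where
  "gpd_mor l d = {(f, \<sigma>, g). f \<in> gpd_obj l d \<and> g \<in> gpd_obj l d \<and> \<sigma> permutes {1..d} \<and> g \<circ> \<sigma> = f}"

definition mor_id :: "(nat \<Rightarrow> nat) \<Rightarrow> mor" where
  "mor_id f = (f, id, f)"

fun mor_comp :: "mor \<Rightarrow> mor \<Rightarrow> mor option" where
  "mor_comp (g', \<tau>, h) (f, \<sigma>, g) = (if g' = g then Some (f, \<tau> \<circ> \<sigma>, h) else None)"

text \<open>
  The algebra with finite basis \<open>B\<close>, where the product of two basis elements is the basis element
  given by the partial operation \<open>m\<close> or 0, and where the unit is the sum of all elements of \<open>E\<close>.
  Its elements are the complex functions vanishing outside \<open>B\<close>.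
\<close>

definition basis_elem :: "'b \<Rightarrow> 'b \<Rightarrow> complex" where
  "basis_elem b = (\<lambda>x. if x = b then 1 else 0)"

definition partial_algebra ::
    "'b set \<Rightarrow> ('b \<Rightarrow> 'b \<Rightarrow> 'b option) \<Rightarrow> 'b set \<Rightarrow> (complex, 'b \<Rightarrow> complex) module" where
  "partial_algebra B m E = \<lparr>carrier = {a. \<forall>x. x \<notin> B \<longrightarrow> a x = 0},
     mult = (\<lambda>a b z. \<Sum>x\<in>B. \<Sum>y\<in>B. if m x y = Some z then a x * b y else 0),
     one = (\<lambda>z. \<Sum>e\<in>E. basis_elem e z),
     zero = (\<lambda>_. 0), add = (\<lambda>a b z. a z + b z), module.smult = (\<lambda>c a z. c * a z)\<rparr>"

definition group_algebra :: "('g, 'k) monoid_scheme \<Rightarrow> (complex, 'g \<Rightarrow> complex) module" where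
  "group_algebra G = partial_algebra (carrier G) (\<lambda>x y. Some (x \<otimes>\<^bsub>G\<^esub> y)) {\<one>\<^bsub>G\<^esub>}"

definition groupoid_algebra :: "nat \<Rightarrow> nat \<Rightarrow> (complex, mor \<Rightarrow> complex) module" where
  "groupoid_algebra l d = partial_algebra (gpd_mor l d) mor_comp (mor_id ` gpd_obj l d)"

definition algebra_isos ::
    "(complex, 'a, 'm) module_scheme \<Rightarrow> (complex, 'b, 'n) module_scheme \<Rightarrow> ('a \<Rightarrow> 'b) set" where
  "algebra_isos A B = ring_iso A B \<inter> linear_maps A B"

text \<open>
  On the carrier of the group algebra an element of \<open>Phi_isos\<close> is unique, since the permutation
  matrices and $s_0$ generate the group. For \<open>d = 0\<close> there is no $s_0$.
\<close>

definition Phi_isos ::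
    "nat \<Rightarrow> nat \<Rightarrow> complex \<Rightarrow> ((complex mat \<Rightarrow> complex) \<Rightarrow> (mor \<Rightarrow> complex)) set" where
  "Phi_isos l d \<xi> = {\<Phi> \<in> algebra_isos (group_algebra (gen_sym_group l d)) (groupoid_algebra l d).
     (\<forall>\<sigma>. \<sigma> permutes {1..d} \<longrightarrow> \<Phi> (basis_elem (perm_mat d \<sigma>)) =
        (\<lambda>m. \<Sum>f\<in>gpd_obj l d. \<Sum>g\<in>gpd_obj l d. if g \<circ> \<sigma> = f then basis_elem (f, \<sigma>, g) m else 0)) \<and>
     (d \<ge> 1 \<longrightarrow> \<Phi> (basis_elem (s0 d \<xi> 1)) =
        (\<lambda>m. \<Sum>f\<in>gpd_obj l d. \<xi> ^ f 1 * basis_elem (mor_id f) m))}"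


section \<open>Specht modules\<close>

text \<open>Tuples indexed by $\{1, \dots, \ell\}$ are extensional functions.\<close>

definition partitions :: "nat \<Rightarrow> nat list set" where
  "partitions n = {p. sorted_wrt (\<ge>) p \<and> 0 \<notin> set p \<and> sum_list p = n}"

definition compositions :: "nat \<Rightarrow> nat \<Rightarrow> (nat \<Rightarrow> nat) set" where
  "compositions l d = {lam \<in> {1..l} \<rightarrow>\<^sub>E UNIV. (\<Sum>i\<in>{1..l}. lam i) = d}"

definition multipartitions :: "nat \<Rightarrow> (nat \<Rightarrow> nat) \<Rightarrow> (nat \<Rightarrow> nat list) set" where
  "multipartitions l lam = (\<Pi>\<^sub>E i\<in>{1..l}. partitions (lam i))"

text \<open>
  Boxes are pairs (row, column), numbered from 0. A tableau of shape \<open>p\<close> is a bijection from the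
  boxes to $\{1, \dots, n\}$. The tabloid of a tableau, i.e. its class under permutations of the
  entries within the rows, is represented by the function assigning to every entry its row.
\<close>

definition diagram :: "nat list \<Rightarrow> (nat \<times> nat) set" where
  "diagram p = {(i, j). i < length p \<and> j < p ! i}"

definition tableaux :: "nat \<Rightarrow> nat list \<Rightarrow> (nat \<times> nat \<Rightarrow> nat) set" where
  "tableaux n p = {t. bij_betw t (diagram p) {1..n}}"

definition tabloid_of :: "nat \<Rightarrow> nat list \<Rightarrow> (nat \<times> nat \<Rightarrow> nat) \<Rightarrow> (nat \<Rightarrow> nat)" where
  "tabloid_of n p t = (\<lambda>k\<in>{1..n}. fst (inv_into (diagram p) t k))"

definition tabloids :: "nat \<Rightarrow> nat list \<Rightarrow> (nat \<Rightarrow> nat) set" where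
  "tabloids n p = tabloid_of n p ` tableaux n p"

definition column_stabilizer :: "nat \<Rightarrow> nat list \<Rightarrow> (nat \<times> nat \<Rightarrow> nat) \<Rightarrow> (nat \<Rightarrow> nat) set" where
  "column_stabilizer n p t = {\<pi>. \<pi> permutes {1..n} \<and>
     (\<forall>k\<in>{1..n}. snd (inv_into (diagram p) t (\<pi> k)) = snd (inv_into (diagram p) t k))}"

definition polytabloid :: "nat \<Rightarrow> nat list \<Rightarrow> (nat \<times> nat \<Rightarrow> nat) \<Rightarrow> (nat \<Rightarrow> nat) \<Rightarrow> complex" where
  "polytabloid n p t = (\<lambda>r. \<Sum>\<pi>\<in>column_stabilizer n p t.
     of_int (sign \<pi>) * basis_elem (tabloid_of n p (\<pi> \<circ> t)) r)"

definition specht :: "nat \<Rightarrow> nat list \<Rightarrow> (complex, (nat \<Rightarrow> nat) \<Rightarrow> complex) module" where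
  "specht n p = fun_space (lin_span (fun_space UNIV) (polytabloid n p ` tableaux n p))"

definition specht_action :: "(nat \<Rightarrow> nat) \<Rightarrow> ((nat \<Rightarrow> nat) \<Rightarrow> complex) \<Rightarrow> ((nat \<Rightarrow> nat) \<Rightarrow> complex)" where
  "specht_action \<pi> v = (\<lambda>r. v (r \<circ> \<pi>))"

text \<open>
  The external tensor product of subspaces of the function spaces $\mathbb{C}^{X_i}$ is taken
  inside $\mathbb{C}^{\prod_i X_i} = \bigotimes_i \mathbb{C}^{X_i}$.
\<close>

definition pure_tensor ::
    "'i set \<Rightarrow> ('i \<Rightarrow> 'x set) \<Rightarrow> ('i \<Rightarrow> 'x \<Rightarrow> complex) \<Rightarrow> ('i \<Rightarrow> 'x) \<Rightarrow> complex" where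
  "pure_tensor I X v = (\<lambda>r. if r \<in> Pi\<^sub>E I X then \<Prod>i\<in>I. v i (r i) else 0)"

definition tabloid_tuples :: "nat \<Rightarrow> (nat \<Rightarrow> nat) \<Rightarrow> (nat \<Rightarrow> nat list) \<Rightarrow> (nat \<Rightarrow> nat \<Rightarrow> nat) set" where
  "tabloid_tuples l lam p = (\<Pi>\<^sub>E i\<in>{1..l}. tabloids (lam i) (p i))"

definition specht_tensor ::
    "nat \<Rightarrow> (nat \<Rightarrow> nat) \<Rightarrow> (nat \<Rightarrow> nat list) \<Rightarrow> (complex, (nat \<Rightarrow> nat \<Rightarrow> nat) \<Rightarrow> complex) module" where
  "specht_tensor l lam p = fun_space (lin_span (fun_space UNIV)
     {pure_tensor {1..l} (\<lambda>i. tabloids (lam i) (p i)) v | v.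
        \<forall>i\<in>{1..l}. v i \<in> carrier (specht (lam i) (p i))})"

definition young_group :: "nat \<Rightarrow> (nat \<Rightarrow> nat) \<Rightarrow> (nat \<Rightarrow> nat \<Rightarrow> nat) monoid" where
  "young_group l lam = product_group {1..l} (\<lambda>i. sym_group (lam i))"

text \<open>
  The linear extension of $v_1 \otimes \dots \otimes v_\ell \mapsto
  \pi_1 v_1 \otimes \dots \otimes \pi_\ell v_\ell$, see \<open>specht_tensor_action_pure\<close> below.
\<close>

definition specht_tensor_action ::
    "nat \<Rightarrow> (nat \<Rightarrow> nat) \<Rightarrow> (nat \<Rightarrow> nat list) \<Rightarrow> (nat \<Rightarrow> nat \<Rightarrow> nat) \<Rightarrow>
     ((nat \<Rightarrow> nat \<Rightarrow> nat) \<Rightarrow> complex) \<Rightarrow> ((nat \<Rightarrow> nat \<Rightarrow> nat) \<Rightarrow> complex)" where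
  "specht_tensor_action l lam p \<pi> F =
     (\<lambda>r. if r \<in> tabloid_tuples l lam p then F (\<lambda>i\<in>{1..l}. r i \<circ> \<pi> i) else 0)"


section \<open>The functor and the module attached to a tuple of partitions\<close>

definition obj_type :: "nat \<Rightarrow> nat \<Rightarrow> (nat \<Rightarrow> nat) \<Rightarrow> (nat \<Rightarrow> nat)" where
  "obj_type l d f = (\<lambda>i\<in>{1..l}. card {j \<in> {1..d}. f j = i})"

definition std_mor :: "nat \<Rightarrow> (nat \<Rightarrow> nat) \<Rightarrow> (nat \<Rightarrow> nat) \<Rightarrow> (nat \<Rightarrow> nat)" where
  "std_mor d f g = (THE \<sigma>. \<sigma> permutes {1..d} \<and> g \<circ> \<sigma> = f \<and>
     (\<forall>i\<in>{1..d}. \<forall>j\<in>{1..d}. i < j \<and> f i = f j \<longrightarrow> \<sigma> i < \<sigma> j))"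

definition std_obj :: "nat \<Rightarrow> nat \<Rightarrow> (nat \<Rightarrow> nat) \<Rightarrow> (nat \<Rightarrow> nat)" where
  "std_obj l d lam = (THE f. f \<in> gpd_obj l d \<and> obj_type l d f = lam \<and> mono_on {1..d} f)"

text \<open>
  The identification of the endomorphisms of the weakly increasing object with \<open>young_group\<close>:
  the \<open>i\<close>-th block consists of the $\lambda_i$ elements following the first
  $\lambda_1 + \dots + \lambda_{i-1}$ ones.
\<close>

definition block_perms :: "nat \<Rightarrow> (nat \<Rightarrow> nat) \<Rightarrow> (nat \<Rightarrow> nat) \<Rightarrow> (nat \<Rightarrow> nat \<Rightarrow> nat)" where
  "block_perms l lam \<sigma> = (\<lambda>i\<in>{1..l}. \<lambda>k. let b = (\<Sum>j\<in>{1..<i}. lam j) in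
     if k \<in> {1..lam i} then \<sigma> (b + k) - b else k)"

definition L_obj ::
    "nat \<Rightarrow> nat \<Rightarrow> (nat \<Rightarrow> nat) \<Rightarrow> (nat \<Rightarrow> nat list) \<Rightarrow> (nat \<Rightarrow> nat) \<Rightarrow>
     (complex, (nat \<Rightarrow> nat \<Rightarrow> nat) \<Rightarrow> complex) module" where
  "L_obj l d lam p f = (if obj_type l d f = lam then specht_tensor l lam p else fun_space {\<lambda>_. 0})"

fun L_mor ::
    "nat \<Rightarrow> nat \<Rightarrow> (nat \<Rightarrow> nat) \<Rightarrow> (nat \<Rightarrow> nat list) \<Rightarrow> mor \<Rightarrow>
     ((nat \<Rightarrow> nat \<Rightarrow> nat) \<Rightarrow> complex) \<Rightarrow> ((nat \<Rightarrow> nat \<Rightarrow> nat) \<Rightarrow> complex)" where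
  "L_mor l d lam p (f, \<pi>, g) v =
     (if obj_type l d f = lam \<and> obj_type l d g = lam then
        specht_tensor_action l lam p (block_perms l lam
          (std_mor d g (std_obj l d lam) \<circ> \<pi> \<circ> std_mor d (std_obj l d lam) f)) v
      else (\<lambda>_. 0))"

definition L_module ::
    "nat \<Rightarrow> nat \<Rightarrow> (nat \<Rightarrow> nat) \<Rightarrow> (nat \<Rightarrow> nat list) \<Rightarrow>
     (complex, (nat \<Rightarrow> nat) \<Rightarrow> (nat \<Rightarrow> nat \<Rightarrow> nat) \<Rightarrow> complex) module" where
  "L_module l d lam p = direct_sum (gpd_obj l d) (L_obj l d lam p)"

definition groupoid_algebra_action ::
    "nat \<Rightarrow> nat \<Rightarrow> (nat \<Rightarrow> nat) \<Rightarrow> (nat \<Rightarrow> nat list) \<Rightarrow> (mor \<Rightarrow> complex) \<Rightarrow>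
     ((nat \<Rightarrow> nat) \<Rightarrow> (nat \<Rightarrow> nat \<Rightarrow> nat) \<Rightarrow> complex) \<Rightarrow>
     ((nat \<Rightarrow> nat) \<Rightarrow> (nat \<Rightarrow> nat \<Rightarrow> nat) \<Rightarrow> complex)" where
  "groupoid_algebra_action l d lam p a u = (\<lambda>h\<in>gpd_obj l d. \<lambda>r.
     \<Sum>(f, \<pi>, g) \<in> {(f, \<pi>, g) \<in> gpd_mor l d. g = h}. a (f, \<pi>, g) * L_mor l d lam p (f, \<pi>, g) (u f) r)"

definition Phi_bar_action ::
    "nat \<Rightarrow> nat \<Rightarrow> (nat \<Rightarrow> nat) \<Rightarrow> (nat \<Rightarrow> nat list) \<Rightarrow>
     ((complex mat \<Rightarrow> complex) \<Rightarrow> (mor \<Rightarrow> complex)) \<Rightarrow> complex mat \<Rightarrow>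
     ((nat \<Rightarrow> nat) \<Rightarrow> (nat \<Rightarrow> nat \<Rightarrow> nat) \<Rightarrow> complex) \<Rightarrow>
     ((nat \<Rightarrow> nat) \<Rightarrow> (nat \<Rightarrow> nat \<Rightarrow> nat) \<Rightarrow> complex)" where
  "Phi_bar_action l d lam p \<Phi> w = groupoid_algebra_action l d lam p (\<Phi> (basis_elem w))"

text \<open>The value of the functor at \<open>f\<close>, regarded as a summand of \<open>L_module\<close>.\<close>

definition L_summand ::
    "nat \<Rightarrow> nat \<Rightarrow> (nat \<Rightarrow> nat) \<Rightarrow> (nat \<Rightarrow> nat list) \<Rightarrow> (nat \<Rightarrow> nat) \<Rightarrow>
     (complex, (nat \<Rightarrow> nat) \<Rightarrow> (nat \<Rightarrow> nat \<Rightarrow> nat) \<Rightarrow> complex) module" where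
  "L_summand l d lam p f = (L_module l d lam p)
     \<lparr>carrier := {u \<in> carrier (L_module l d lam p). \<forall>g\<in>gpd_obj l d. g \<noteq> f \<longrightarrow> u g = (\<lambda>_. 0)}\<rparr>"


section \<open>The generalized Young subgroup\<close>

definition fiber_subgroup :: "nat \<Rightarrow> nat \<Rightarrow> complex \<Rightarrow> (nat \<Rightarrow> nat) \<Rightarrow> nat \<Rightarrow> complex mat set" where
  "fiber_subgroup l d \<xi> f i = generate (gen_sym_group l d)
     (s0 d \<xi> ` {j \<in> {1..d}. f j = i} \<union> perm_mat d ` {\<sigma>. \<sigma> permutes {j \<in> {1..d}. f j = i}})"

text \<open>The internal direct product of the pairwise commuting subgroups above.\<close>

definition gen_young_subgroup :: "nat \<Rightarrow> nat \<Rightarrow> complex \<Rightarrow> (nat \<Rightarrow> nat) \<Rightarrow> complex mat set" where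
  "gen_young_subgroup l d \<xi> f =
     foldr (\<lambda>i K. fiber_subgroup l d \<xi> f i <#>\<^bsub>gen_sym_group l d\<^esub> K) [1..<Suc l] {\<one>\<^bsub>gen_sym_group l d\<^esub>}"


section \<open>The tensor product action on pure tensors\<close>

lemma tabloids_permute:
  assumes "r \<in> tabloids n p" and "\<pi> permutes {1..n}"
  shows "r \<circ> \<pi> \<in> tabloids n p"
proof -
  obtain t where t: "bij_betw t (diagram p) {1..n}" and r: "r = tabloid_of n p t"
    using assms(1) by (auto simp: tabloids_def tableaux_def)
  define t' where "t' = inv_into UNIV \<pi> \<circ> t"
  have t': "bij_betw t' (diagram p) {1..n}"
    unfolding t'_def using t assms(2) bij_betw_trans permutes_imp_bij permutes_inv by blast
  have *: "inv_into (diagram p) t' k = inv_into (diagram p) t (\<pi> k)" if "k \<in> {1..n}" for k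
  proof -
    have k: "\<pi> k \<in> {1..n}" using that assms(2) by (simp only: permutes_in_image)
    then have "inv_into (diagram p) t (\<pi> k) \<in> diagram p"
      using t by (metis bij_betw_imp_surj_on inv_into_into)
    moreover have "t' (inv_into (diagram p) t (\<pi> k)) = k"
      using k t assms(2) by (simp add: t'_def bij_betw_inv_into_right permutes_inverses)
    ultimately show ?thesis
      using t' by (metis bij_betw_inv_into_left)
  qed
  have "r \<circ> \<pi> = tabloid_of n p t'"
  proof
    fix k
    show "(r \<circ> \<pi>) k = tabloid_of n p t' k"
      using * permutes_in_image[OF assms(2), of k] permutes_not_in[OF assms(2), of k]
      by (auto simp: r tabloid_of_def restrict_def)
  qed
  with t' show ?thesis by (auto simp: tabloids_def tableaux_def)
qed

lemma specht_tensor_action_pure: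
  assumes "\<pi> \<in> carrier (young_group l lam)"
  shows "specht_tensor_action l lam p \<pi> (pure_tensor {1..l} (\<lambda>i. tabloids (lam i) (p i)) v) =
    pure_tensor {1..l} (\<lambda>i. tabloids (lam i) (p i)) (\<lambda>i. specht_action (\<pi> i) (v i))"
proof
  fix r
  have \<pi>: "\<pi> i permutes {1..lam i}" if "i \<in> {1..l}" for i
    using assms that by (auto simp: young_group_def sym_group_def PiE_iff)
  show "specht_tensor_action l lam p \<pi> (pure_tensor {1..l} (\<lambda>i. tabloids (lam i) (p i)) v) r =
    pure_tensor {1..l} (\<lambda>i. tabloids (lam i) (p i)) (\<lambda>i. specht_action (\<pi> i) (v i)) r"
  proof (cases "r \<in> tabloid_tuples l lam p")
    case True
    then have "(\<lambda>i\<in>{1..l}. r i \<circ> \<pi> i) \<in> tabloid_tuples l lam p"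
      unfolding tabloid_tuples_def using tabloids_permute \<pi> by (simp add: PiE_iff)
    with True show ?thesis
      unfolding specht_tensor_action_def pure_tensor_def specht_action_def tabloid_tuples_def[symmetric]
      by simp
  next
    case False
    then show ?thesis
      unfolding specht_tensor_action_def pure_tensor_def tabloid_tuples_def[symmetric] by simp
  qed
qed


section \<open>Existence of the isomorphism of algebras\<close>

lemma sum_root_powers:
  fixes z :: complex
  assumes "z ^ l = 1"
  shows "(\<Sum>k\<in>{1..l}. z ^ k) = (if z = 1 then of_nat l else 0)"
proof (cases "z = 1")
  case False
  have eq: "{1..l} = Suc ` {..<l}" by (auto simp: image_Suc_lessThan)
  have "(\<Sum>k\<in>{1..l}. z ^ k) = z * (\<Sum>k<l. z ^ k)"
    unfolding eq by (simp add: sum.reindex sum_distrib_left)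
  also have "(\<Sum>k<l. z ^ k) = 0" using False assms by (simp add: geometric_sum)
  finally show ?thesis using False by simp
qed simp

lemma sum_powers_roots:
  assumes l: "l > 0" and "a \<in> {1..l}" "b \<in> {1..l}"
  shows "(\<Sum>z | z ^ l = (1::complex). z ^ a * cnj z ^ b) = (if a = b then of_nat l else 0)"
proof -
  let ?C = "{z::complex. z ^ l = 1}"
  have norm1: "z * cnj z = 1" if "z \<in> ?C" for z
  proof -
    have "norm z ^ l = 1 ^ l" using that by (simp flip: norm_power)
    then have "norm z = 1" by (rule power_eq_imp_eq_base) (use l in simp_all)
    then show ?thesis by (simp add: complex_norm_square[symmetric])
  qed
  show ?thesis
  proof (cases "a = b")
    case True
    have "(\<Sum>z\<in>?C. z ^ a * cnj z ^ b) = (\<Sum>z\<in>?C. 1)"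
      by (intro sum.cong) (simp_all add: True norm1 flip: power_mult_distrib)
    then show ?thesis using l True by (simp add: card_roots_unity_eq)
  next
    case False
    define \<zeta> where "\<zeta> = cis (2 * pi / real l)"
    have pw: "\<zeta> ^ k = cis (2 * pi * real k / real l)" for k
      by (simp add: \<zeta>_def DeMoivre mult_ac)
    have inj: "inj_on (\<lambda>k. \<zeta> ^ k) {..<l}"
      using bij_betw_roots_unity[OF l] unfolding pw bij_betw_def by blast
    have \<zeta>: "\<zeta> \<in> ?C" using l by (simp add: pw)
    then have nz: "\<zeta> \<noteq> 0" using l by (auto simp: power_0_left)
    define \<omega> where "\<omega> = \<zeta> ^ a * cnj \<zeta> ^ b"
    have "\<omega> \<noteq> 1"
    proof
      assume "\<omega> = 1"
      then have "\<zeta> ^ a * (cnj \<zeta> ^ b * \<zeta> ^ b) = \<zeta> ^ b" by (simp add: \<omega>_def flip: mult.assoc)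
      then have "\<zeta> ^ a = \<zeta> ^ b" using norm1[OF \<zeta>] by (simp add: mult.commute flip: power_mult_distrib)
      moreover have "a = Suc (a - 1)" "b = Suc (b - 1)" using assms by auto
      ultimately have "\<zeta> ^ (a - 1) = \<zeta> ^ (b - 1)" using nz
        by (metis mult_left_cancel power_Suc)
      then have "a - 1 = b - 1" using inj assms by (auto dest!: inj_onD)
      with False assms show False by auto
    qed
    have bij: "bij_betw (\<lambda>z. \<zeta> * z) ?C ?C"
      using \<zeta> nz by (intro bij_betw_byWitness[where f' = "\<lambda>z. z / \<zeta>"])
        (auto simp: power_mult_distrib power_divide)
    have "(\<Sum>z\<in>?C. z ^ a * cnj z ^ b) = (\<Sum>z\<in>?C. (\<zeta> * z) ^ a * cnj (\<zeta> * z) ^ b)"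
      by (rule sum.reindex_bij_betw[OF bij, symmetric])
    also have "\<dots> = \<omega> * (\<Sum>z\<in>?C. z ^ a * cnj z ^ b)"
      by (simp add: \<omega>_def sum_distrib_left power_mult_distrib mult_ac)
    finally have "(1 - \<omega>) * (\<Sum>z\<in>?C. z ^ a * cnj z ^ b) = 0"
      unfolding left_diff_distrib by simp
    with \<open>\<omega> \<noteq> 1\<close> False show ?thesis by simp
  qed
qed

definition monomial_mat :: "nat \<Rightarrow> (nat \<Rightarrow> nat) \<Rightarrow> (nat \<Rightarrow> complex) \<Rightarrow> complex mat" where
  "monomial_mat d \<pi> c = mat d d (\<lambda>(i, j). if Suc i = \<pi> (Suc j) then c (Suc j) else 0)"

lemma monomial_mat_eq_iff:
  assumes "\<pi> permutes {1..d}" "\<pi>' permutes {1..d}"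
    and "\<And>j. j \<in> {1..d} \<Longrightarrow> c j \<noteq> 0" "\<And>j. j \<in> {1..d} \<Longrightarrow> c' j \<noteq> 0"
  shows "monomial_mat d \<pi> c = monomial_mat d \<pi>' c' \<longleftrightarrow> \<pi> = \<pi>' \<and> (\<forall>j\<in>{1..d}. c j = c' j)"
proof
  assume eq: "monomial_mat d \<pi> c = monomial_mat d \<pi>' c'"
  have *: "\<pi> j = \<pi>' j \<and> c j = c' j" if "j \<in> {1..d}" for j
  proof -
    have 1: "\<pi> j \<in> {1..d}" using that assms(1) by (simp only: permutes_in_image)
    have "monomial_mat d \<pi> c $$ (\<pi> j - 1, j - 1) = monomial_mat d \<pi>' c' $$ (\<pi> j - 1, j - 1)"
      by (simp add: eq)
    moreover have "\<pi> j - 1 < d" "j - 1 < d" "Suc (\<pi> j - 1) = \<pi> j" "Suc (j - 1) = j"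
      using 1 that by auto
    ultimately have "c j = (if \<pi> j = \<pi>' j then c' j else 0)"
      by (simp add: monomial_mat_def del: Suc_diff_1)
    with assms(3)[OF that] show ?thesis by (simp split: if_splits)
  qed
  moreover have "\<pi> = \<pi>'"
  proof
    fix j show "\<pi> j = \<pi>' j"
      using * permutes_not_in[OF assms(1)] permutes_not_in[OF assms(2)] by (cases "j \<in> {1..d}") auto
  qed
  ultimately show "\<pi> = \<pi>' \<and> (\<forall>j\<in>{1..d}. c j = c' j)" by blast
next
  assume "\<pi> = \<pi>' \<and> (\<forall>j\<in>{1..d}. c j = c' j)"
  then show "monomial_mat d \<pi> c = monomial_mat d \<pi>' c'"
    unfolding monomial_mat_def by (intro eq_matI) auto
qed

lemma monomial_mat_carrier:
  assumes "\<pi> permutes {1..d}" "l > 0" "\<And>j. j \<in> {1..d} \<Longrightarrow> c j ^ l = 1"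
  shows "monomial_mat d \<pi> c \<in> carrier (gen_sym_group l d)"
proof -
  have nz: "c (Suc j) \<noteq> 0" if "j < d" for j
    using assms(3)[of "Suc j"] assms(2) that by (auto simp: power_0_left)
  have 1: "\<exists>!j. j < d \<and> monomial_mat d \<pi> c $$ (i, j) \<noteq> 0" if i: "i < d" for i
  proof -
    have p: "inv_into UNIV \<pi> (Suc i) \<in> {1..d}"
      using i permutes_in_image[OF permutes_inv[OF assms(1)], of "Suc i"] by simp
    have e: "Suc i = \<pi> (Suc j) \<longleftrightarrow> j = inv_into UNIV \<pi> (Suc i) - 1" for j
    proof -
      have "Suc i = \<pi> (Suc j) \<longleftrightarrow> Suc j = inv_into UNIV \<pi> (Suc i)"
        using permutes_inv_eq[OF assms(1), of "Suc i" "Suc j"] by metis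
      also have "\<dots> \<longleftrightarrow> j = inv_into UNIV \<pi> (Suc i) - 1" using p by auto
      finally show ?thesis .
    qed
    have "c (inv_into UNIV \<pi> (Suc i)) \<noteq> 0"
      using assms(3)[OF p] assms(2) by (auto simp: power_0_left)
    moreover define k where "k = inv_into UNIV \<pi> (Suc i) - 1"
    ultimately have k: "k < d" "c (Suc k) \<noteq> 0" using p by auto
    have m: "monomial_mat d \<pi> c $$ (i, j) = (if j = k then c (Suc j) else 0)" if "j < d" for j
      using i that e[of j] by (simp add: monomial_mat_def k_def)
    show ?thesis
    proof (rule ex1I)
      show "k < d \<and> monomial_mat d \<pi> c $$ (i, k) \<noteq> 0" using k m[OF k(1)] by simp
      show "j = k" if "j < d \<and> monomial_mat d \<pi> c $$ (i, j) \<noteq> 0" for j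
        using that m[of j] by (simp split: if_splits)
    qed
  qed
  have 2: "\<exists>!i. i < d \<and> monomial_mat d \<pi> c $$ (i, j) \<noteq> 0" if j: "j < d" for j
  proof -
    have p: "\<pi> (Suc j) \<in> {1..d}"
      using j permutes_in_image[OF assms(1), of "Suc j"] by simp
    show ?thesis
      by (rule ex1I[of _ "\<pi> (Suc j) - 1"])
        (use p j nz in \<open>auto simp: monomial_mat_def split: if_splits\<close>)
  qed
  have 3: "monomial_mat d \<pi> c $$ (i, j) ^ l = 1"
    if "i < d" "j < d" "monomial_mat d \<pi> c $$ (i, j) \<noteq> 0" for i j
    using that assms(3)[of "Suc j"] by (auto simp: monomial_mat_def split: if_splits)
  have 4: "monomial_mat d \<pi> c \<in> carrier_mat d d"
    by (simp add: monomial_mat_def)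
  show ?thesis
    unfolding gen_sym_group_def partial_object.simps by (intro CollectI conjI allI impI 1 2 3 4)
qed

lemma gen_sym_group_cases:
  assumes "w \<in> carrier (gen_sym_group l d)"
  obtains \<pi> c where "\<pi> permutes {1..d}" "c \<in> {1..d} \<rightarrow>\<^sub>E {z. z ^ l = 1}" "w = monomial_mat d \<pi> c"
proof -
  have w: "w \<in> carrier_mat d d" and row: "\<And>i. i < d \<Longrightarrow> \<exists>!j. j < d \<and> w $$ (i, j) \<noteq> 0"
    and col: "\<And>j. j < d \<Longrightarrow> \<exists>!i. i < d \<and> w $$ (i, j) \<noteq> 0"
    and rt: "\<And>i j. i < d \<Longrightarrow> j < d \<Longrightarrow> w $$ (i, j) \<noteq> 0 \<Longrightarrow> w $$ (i, j) ^ l = 1"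
    using assms by (auto simp: gen_sym_group_def)
  define q where "q j = (THE i. i < d \<and> w $$ (i, j) \<noteq> 0)" for j
  have q: "q j < d \<and> w $$ (q j, j) \<noteq> 0" if "j < d" for j
    unfolding q_def by (rule theI'[OF col[OF that]])
  have qu: "i = q j" if "j < d" "i < d" "w $$ (i, j) \<noteq> 0" for i j
    using col[of j] q[of j] that by blast
  define \<pi> where "\<pi> k = (if k \<in> {1..d} then Suc (q (k - 1)) else k)" for k
  define c where "c = (\<lambda>k\<in>{1..d}. w $$ (q (k - 1), k - 1))"
  have inj: "inj_on \<pi> {1..d}"
  proof (rule inj_onI)
    fix x y assume xy: "x \<in> {1..d}" "y \<in> {1..d}" "\<pi> x = \<pi> y"
    then have eq: "q (x - 1) = q (y - 1)" by (simp add: \<pi>_def)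
    have "x - 1 < d" "y - 1 < d" using xy by auto
    then have 1: "x - 1 < d \<and> w $$ (q (x - 1), x - 1) \<noteq> 0"
      and 2: "y - 1 < d \<and> w $$ (q (x - 1), y - 1) \<noteq> 0" and 3: "q (x - 1) < d"
      using q[of "x - 1"] q[of "y - 1"] eq by simp_all
    obtain k where "\<forall>j. j < d \<and> w $$ (q (x - 1), j) \<noteq> 0 \<longrightarrow> j = k"
      using row[OF 3] by (elim ex1E) blast
    then have "x - 1 = k" "y - 1 = k" using 1 2 by blast+
    with xy show "x = y" by auto
  qed
  have sub: "\<pi> ` {1..d} \<subseteq> {1..d}"
  proof
    fix y assume "y \<in> \<pi> ` {1..d}"
    then obtain x where x: "x \<in> {1..d}" "y = Suc (q (x - 1))" by (auto simp: \<pi>_def)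
    then have "x - 1 < d" by auto
    with q[of "x - 1"] x show "y \<in> {1..d}" by auto
  qed
  have "\<pi> permutes {1..d}"
  proof (rule bij_imp_permutes)
    show "bij_betw \<pi> {1..d} {1..d}"
      unfolding bij_betw_def using inj endo_inj_surj[OF _ sub inj] by simp
    show "\<pi> x = x" if "x \<notin> {1..d}" for x
      unfolding \<pi>_def using that by (rule if_not_P)
  qed
  moreover have "c \<in> {1..d} \<rightarrow>\<^sub>E {z. z ^ l = 1}"
  proof (rule PiE_I)
    fix k assume k: "k \<in> {1..d}"
    then have "k - 1 < d" by auto
    with rt[of "q (k - 1)" "k - 1"] q[of "k - 1"] have "w $$ (q (k - 1), k - 1) ^ l = 1" by blast
    with k show "c k \<in> {z. z ^ l = 1}" by (simp add: c_def)
  qed (use c_def in auto)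
  moreover have "w = monomial_mat d \<pi> c"
  proof (rule eq_matI)
    fix i j assume "i < dim_row (monomial_mat d \<pi> c)" "j < dim_col (monomial_mat d \<pi> c)"
    then have ij: "i < d" "j < d" by (simp_all add: monomial_mat_def)
    then have "monomial_mat d \<pi> c $$ (i, j) = (if i = q j then w $$ (q j, j) else 0)"
      by (simp add: monomial_mat_def \<pi>_def c_def)
    also have "\<dots> = w $$ (i, j)" using qu[OF ij(2,1)] by argo
    finally show "w $$ (i, j) = monomial_mat d \<pi> c $$ (i, j)" by simp
  qed (use w in \<open>simp_all add: monomial_mat_def\<close>)
  ultimately show ?thesis by (rule that)
qed

lemma monomial_mat_mult:
  assumes "\<pi>' permutes {1..d}"
  shows "monomial_mat d \<pi> c * monomial_mat d \<pi>' c' = monomial_mat d (\<pi> \<circ> \<pi>') (\<lambda>j. c (\<pi>' j) * c' j)"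
proof (rule eq_matI)
  fix i j assume "i < dim_row (monomial_mat d (\<pi> \<circ> \<pi>') (\<lambda>j. c (\<pi>' j) * c' j))"
    "j < dim_col (monomial_mat d (\<pi> \<circ> \<pi>') (\<lambda>j. c (\<pi>' j) * c' j))"
  then have ij: "i < d" "j < d" by (auto simp: monomial_mat_def)
  have p: "\<pi>' (Suc j) \<in> {1..d}" using permutes_in_image[OF assms, of "Suc j"] ij by simp
  have "(monomial_mat d \<pi> c * monomial_mat d \<pi>' c') $$ (i, j) =
    (\<Sum>k<d. (if Suc i = \<pi> (Suc k) then c (Suc k) else 0) * (if Suc k = \<pi>' (Suc j) then c' (Suc j) else 0))"
    using ij by (simp add: monomial_mat_def scalar_prod_def lessThan_atLeast0)
  also have "\<dots> = (\<Sum>k<d. if k = \<pi>' (Suc j) - 1 then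
      (if Suc i = \<pi> (\<pi>' (Suc j)) then c (\<pi>' (Suc j)) * c' (Suc j) else 0) else 0)"
    using p by (intro sum.cong) auto
  also have "\<dots> = (if Suc i = \<pi> (\<pi>' (Suc j)) then c (\<pi>' (Suc j)) * c' (Suc j) else 0)"
    using p by (auto simp: sum.delta)
  finally show "(monomial_mat d \<pi> c * monomial_mat d \<pi>' c') $$ (i, j) =
      monomial_mat d (\<pi> \<circ> \<pi>') (\<lambda>j. c (\<pi>' j) * c' j) $$ (i, j)"
    using ij by (simp add: monomial_mat_def)
qed (auto simp: monomial_mat_def)

lemma finite_gpd_obj: "finite (gpd_obj l d)"
  unfolding gpd_obj_def by (intro finite_PiE) auto

lemma bij_gpd_mor:
  "bij_betw (\<lambda>(f, \<sigma>). (f, \<sigma>, f \<circ> inv_into UNIV \<sigma>)) (gpd_obj l d \<times> {\<sigma>. \<sigma> permutes {1..d}}) (gpd_mor l d)"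
proof (rule bij_betw_byWitness[where f' = "\<lambda>(f, \<sigma>, g). (f, \<sigma>)"])
  have "f \<circ> inv_into UNIV \<sigma> \<in> gpd_obj l d"
    if f: "f \<in> gpd_obj l d" and \<sigma>: "\<sigma> permutes {1..d}" for f \<sigma>
    unfolding gpd_obj_def
  proof (rule PiE_I)
    have p: "inv_into UNIV \<sigma> permutes {1..d}" using \<sigma> by (rule permutes_inv)
    fix k
    show "(f \<circ> inv_into UNIV \<sigma>) k \<in> {1..l}" if "k \<in> {1..d}"
      using f permutes_in_image[OF p, of k] that by (auto simp: gpd_obj_def)
    show "(f \<circ> inv_into UNIV \<sigma>) k = undefined" if "k \<notin> {1..d}"
      using f permutes_not_in[OF p, of k] that by (auto simp: gpd_obj_def)
  qed
  then show "(\<lambda>(f, \<sigma>). (f, \<sigma>, f \<circ> inv_into UNIV \<sigma>)) ` (gpd_obj l d \<times> {\<sigma>. \<sigma> permutes {1..d}})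
      \<subseteq> gpd_mor l d"
    by (auto simp: gpd_mor_def o_assoc[symmetric] permutes_inv_o)
  show "\<forall>a\<in>gpd_mor l d. (\<lambda>(f, \<sigma>). (f, \<sigma>, f \<circ> inv_into UNIV \<sigma>)) ((\<lambda>(f, \<sigma>, g). (f, \<sigma>)) a) = a"
    by (auto simp: gpd_mor_def o_assoc[symmetric] permutes_inv_o)
  show "(\<lambda>(f, \<sigma>, g). (f, \<sigma>)) ` gpd_mor l d \<subseteq> gpd_obj l d \<times> {\<sigma>. \<sigma> permutes {1..d}}"
    by (auto simp: gpd_mor_def)
qed auto

lemma finite_gpd_mor: "finite (gpd_mor l d)"
  using bij_betw_finite[OF bij_gpd_mor] finite_gpd_obj finite_permutations[of "{1..d}"]
  by (metis finite_atLeastAtMost finite_cartesian_product)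

lemma bij_gen_sym_group:
  assumes "l > 0"
  shows "bij_betw (\<lambda>(\<pi>, c). monomial_mat d \<pi> c)
    ({\<pi>. \<pi> permutes {1..d}} \<times> ({1..d} \<rightarrow>\<^sub>E {z. z ^ l = 1})) (carrier (gen_sym_group l d))"
  unfolding bij_betw_def
proof
  have nz: "c j \<noteq> 0" if "c \<in> {1..d} \<rightarrow>\<^sub>E {z. z ^ l = (1::complex)}" "j \<in> {1..d}" for c j
  proof -
    have "c j ^ l = 1" using that by blast
    with assms show ?thesis by (auto simp: power_0_left)
  qed
  show "inj_on (\<lambda>(\<pi>, c). monomial_mat d \<pi> c)
      ({\<pi>. \<pi> permutes {1..d}} \<times> ({1..d} \<rightarrow>\<^sub>E {z. z ^ l = 1}))"
  proof (rule inj_onI, clarify)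
    fix \<pi> c \<pi>' c'
    assume *: "\<pi> permutes {1..d}" "\<pi>' permutes {1..d}"
      and c: "c \<in> {1..d} \<rightarrow>\<^sub>E {z. z ^ l = (1::complex)}" and c': "c' \<in> {1..d} \<rightarrow>\<^sub>E {z. z ^ l = 1}"
      and eq: "monomial_mat d \<pi> c = monomial_mat d \<pi>' c'"
    have "\<pi> = \<pi>' \<and> (\<forall>j\<in>{1..d}. c j = c' j)"
      using monomial_mat_eq_iff[OF *, of c c'] nz[OF c] nz[OF c'] eq by metis
    with c c' show "\<pi> = \<pi>' \<and> c = c'" by (blast intro: PiE_ext)
  qed
  show "(\<lambda>(\<pi>, c). monomial_mat d \<pi> c) ` ({\<pi>. \<pi> permutes {1..d}} \<times> ({1..d} \<rightarrow>\<^sub>E {z. z ^ l = 1})) =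
      carrier (gen_sym_group l d)"
  proof (intro subset_antisym subsetI)
    fix w assume "w \<in> (\<lambda>(\<pi>, c). monomial_mat d \<pi> c) ` ({\<pi>. \<pi> permutes {1..d}} \<times> ({1..d} \<rightarrow>\<^sub>E {z. z ^ l = 1}))"
    then obtain x where x: "w = (\<lambda>(\<pi>, c). monomial_mat d \<pi> c) x"
      "x \<in> {\<pi>. \<pi> permutes {1..d}} \<times> ({1..d} \<rightarrow>\<^sub>E {z. z ^ l = 1})" by (rule imageE)
    obtain \<pi> c where "x = (\<pi>, c)" by (cases x)
    with x have \<pi>: "\<pi> permutes {1..d}" and c: "c \<in> {1..d} \<rightarrow>\<^sub>E {z. z ^ l = 1}"
      and w: "w = monomial_mat d \<pi> c" by simp_all
    have "c j ^ l = 1" if "j \<in> {1..d}" for j using c that by blast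
    with \<pi> assms show "w \<in> carrier (gen_sym_group l d)"
      unfolding w by (rule monomial_mat_carrier)
  next
    fix w assume "w \<in> carrier (gen_sym_group l d)"
    then show "w \<in> (\<lambda>(\<pi>, c). monomial_mat d \<pi> c) ` ({\<pi>. \<pi> permutes {1..d}} \<times> ({1..d} \<rightarrow>\<^sub>E {z. z ^ l = 1}))"
    proof (rule gen_sym_group_cases)
      fix \<pi> c assume "\<pi> permutes {1..d}" "c \<in> {1..d} \<rightarrow>\<^sub>E {z. z ^ l = 1}" "w = monomial_mat d \<pi> c"
      then show ?thesis by (intro image_eqI[of _ _ "(\<pi>, c)"]) simp_all
    qed
  qed
qed

lemma finite_gen_sym_group:
  assumes "l > 0"
  shows "finite (carrier (gen_sym_group l d))"
proof -
  have "finite ({\<pi>. \<pi> permutes {1..d}} \<times> ({1..d} \<rightarrow>\<^sub>E {z. z ^ l = (1::complex)}))"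
    by (intro finite_cartesian_product finite_permutations finite_PiE finite_atLeastAtMost)
      (use finite_roots_unity[of l] assms in auto)
  then show ?thesis using bij_betw_finite[OF bij_gen_sym_group[OF assms]] by blast
qed

text \<open>The coefficients of the images of the group elements under the isomorphism.\<close>

definition Phi_coeff :: "nat \<Rightarrow> nat \<Rightarrow> complex mat \<Rightarrow> mor \<Rightarrow> complex" where
  "Phi_coeff l d w = (\<lambda>(f, \<sigma>, g). if (f, \<sigma>, g) \<in> gpd_mor l d
     then \<Prod>j\<in>{1..d}. w $$ (\<sigma> j - 1, j - 1) ^ f j else 0)"

lemma Phi_coeff_monomial_mat:
  assumes \<pi>: "\<pi> permutes {1..d}" and m: "(f, \<sigma>, g) \<in> gpd_mor l d"
  shows "Phi_coeff l d (monomial_mat d \<pi> c) (f, \<sigma>, g) =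
    (if \<sigma> = \<pi> then \<Prod>j\<in>{1..d}. c j ^ f j else 0)"
proof -
  have \<sigma>: "\<sigma> permutes {1..d}" and f: "f \<in> gpd_obj l d" using m by (auto simp: gpd_mor_def)
  have ent: "monomial_mat d \<pi> c $$ (\<sigma> j - 1, j - 1) = (if \<sigma> j = \<pi> j then c j else 0)"
    if j: "j \<in> {1..d}" for j
  proof -
    have "\<sigma> j \<in> {1..d}" using j permutes_in_image[OF \<sigma>] by simp
    then have "\<sigma> j - 1 < d" "j - 1 < d" "Suc (\<sigma> j - 1) = \<sigma> j" "Suc (j - 1) = j" using j by auto
    then show ?thesis by (simp add: monomial_mat_def del: Suc_diff_1)
  qed
  have eq: "Phi_coeff l d (monomial_mat d \<pi> c) (f, \<sigma>, g) =
      (\<Prod>j\<in>{1..d}. (if \<sigma> j = \<pi> j then c j else 0) ^ f j)"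
    unfolding Phi_coeff_def prod.case if_P[OF m] by (intro prod.cong) (simp_all only: ent)
  show ?thesis
  proof (cases "\<sigma> = \<pi>")
    case False
    then obtain j where j: "\<sigma> j \<noteq> \<pi> j" by blast
    then have "j \<in> {1..d}" using permutes_not_in[OF \<sigma>, of j] permutes_not_in[OF \<pi>, of j] by metis
    moreover from this have "f j > 0" using f by (auto simp: gpd_obj_def dest!: PiE_mem)
    ultimately have "(\<Prod>j\<in>{1..d}. (if \<sigma> j = \<pi> j then c j else 0) ^ f j) = 0"
      using j by (intro prod_zero) (auto intro!: bexI[of _ j])
    with eq False show ?thesis by simp
  next
    case True
    then show ?thesis unfolding eq by simp
  qed
qed

lemma Phi_coeff_not_mor: "m \<notin> gpd_mor l d \<Longrightarrow> Phi_coeff l d w m = 0"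
  by (cases m) (simp add: Phi_coeff_def)

lemma Phi_coeff_mult:
  assumes l: "l > 0" and u: "u \<in> carrier (gen_sym_group l d)" and v: "v \<in> carrier (gen_sym_group l d)"
  shows "Phi_coeff l d (u * v) m = (\<Sum>x\<in>gpd_mor l d. \<Sum>y\<in>gpd_mor l d.
    if mor_comp x y = Some m then Phi_coeff l d u x * Phi_coeff l d v y else 0)"
proof -
  obtain \<pi> c where \<pi>: "\<pi> permutes {1..d}" and u_eq: "u = monomial_mat d \<pi> c"
    using gen_sym_group_cases[OF u] by metis
  obtain \<pi>' c' where \<pi>': "\<pi>' permutes {1..d}" and v_eq: "v = monomial_mat d \<pi>' c'"
    using gen_sym_group_cases[OF v] by metis
  obtain f \<rho> h where m: "m = (f, \<rho>, h)" by (cases m)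
  define g where "g = f \<circ> inv_into UNIV \<pi>'"
  define P where "P = (if m \<in> gpd_mor l d \<and> \<rho> = \<pi> \<circ> \<pi>' then \<Prod>j\<in>{1..d}. (c (\<pi>' j) * c' j) ^ f j else 0)"
  have pp: "\<pi> \<circ> \<pi>' permutes {1..d}" by (rule permutes_compose[OF \<pi>' \<pi>])
  have L: "Phi_coeff l d (u * v) m = P"
  proof (cases "m \<in> gpd_mor l d")
    case True
    then show ?thesis
      unfolding P_def u_eq v_eq monomial_mat_mult[OF \<pi>'] unfolding m
      by (simp only: Phi_coeff_monomial_mat[OF pp] simp_thms)
  next
    case False
    then show ?thesis using Phi_coeff_not_mor by (simp add: P_def)
  qed
  have *: "(if mor_comp x y = Some m then Phi_coeff l d u x * Phi_coeff l d v y else 0) =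
      (if y = (f, \<pi>', g) then if x = (g, \<pi>, h) then P else 0 else 0)"
    if x: "x \<in> gpd_mor l d" and y: "y \<in> gpd_mor l d" for x y
  proof -
    obtain g1 \<tau> h1 where x_eq: "x = (g1, \<tau>, h1)" by (cases x)
    obtain f1 \<sigma> g2 where y_eq: "y = (f1, \<sigma>, g2)" by (cases y)
    have x': "\<tau> permutes {1..d}" "h1 \<circ> \<tau> = g1" "g1 \<in> gpd_obj l d" "h1 \<in> gpd_obj l d"
      using x by (auto simp: x_eq gpd_mor_def)
    have y': "\<sigma> permutes {1..d}" "g2 \<circ> \<sigma> = f1" "f1 \<in> gpd_obj l d"
      using y by (auto simp: y_eq gpd_mor_def)
    have cx: "Phi_coeff l d u x = (if \<tau> = \<pi> then \<Prod>j\<in>{1..d}. c j ^ g1 j else 0)"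
      unfolding u_eq x_eq by (rule Phi_coeff_monomial_mat[OF \<pi> x[unfolded x_eq]])
    have cy: "Phi_coeff l d v y = (if \<sigma> = \<pi>' then \<Prod>j\<in>{1..d}. c' j ^ f1 j else 0)"
      unfolding v_eq y_eq by (rule Phi_coeff_monomial_mat[OF \<pi>' y[unfolded y_eq]])
    show ?thesis
    proof (cases "\<tau> = \<pi> \<and> \<sigma> = \<pi>' \<and> mor_comp x y = Some m")
      case True
      then have t: "\<tau> = \<pi>" "\<sigma> = \<pi>'" "g1 = g2" "f1 = f" "h1 = h" "\<rho> = \<pi> \<circ> \<pi>'"
        by (auto simp: x_eq y_eq m split: if_splits)
      have g: "g = g1" using y' t by (auto simp: g_def o_assoc[symmetric] permutes_inv_o)
      have mm: "m \<in> gpd_mor l d"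
        using x' y' t pp by (simp add: m gpd_mor_def o_assoc)
      have "(\<Prod>j\<in>{1..d}. c j ^ g1 j) = (\<Prod>j\<in>{1..d}. c (\<pi>' j) ^ g1 (\<pi>' j))"
        by (rule prod.reindex_bij_betw[OF permutes_imp_bij[OF \<pi>'], symmetric])
      also have "\<dots> = (\<Prod>j\<in>{1..d}. c (\<pi>' j) ^ f j)" using y' t by auto
      finally have "Phi_coeff l d u x * Phi_coeff l d v y = P"
        using mm t by (simp add: cx cy P_def power_mult_distrib prod.distrib)
      moreover have "x = (g, \<pi>, h)" "y = (f, \<pi>', g)" using t g by (simp_all add: x_eq y_eq)
      ultimately show ?thesis using True by simp
    next
      case False
      have 1: "(if mor_comp x y = Some m then Phi_coeff l d u x * Phi_coeff l d v y else 0) = 0"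
        using False by (auto simp: cx cy)
      have 2: "P = 0" if "x = (g, \<pi>, h)" "y = (f, \<pi>', g)"
      proof (rule ccontr)
        assume "P \<noteq> 0"
        then have "\<rho> = \<pi> \<circ> \<pi>'" by (auto simp: P_def split: if_splits)
        moreover have "\<tau> = \<pi>" "\<sigma> = \<pi>'" using that by (simp_all add: x_eq y_eq)
        ultimately show False using False that by (simp add: m)
      qed
      show ?thesis unfolding 1 using 2 by auto
    qed
  qed
  have "(\<Sum>x\<in>gpd_mor l d. \<Sum>y\<in>gpd_mor l d.
      if mor_comp x y = Some m then Phi_coeff l d u x * Phi_coeff l d v y else 0) =
    (\<Sum>x\<in>gpd_mor l d. \<Sum>y\<in>gpd_mor l d. if y = (f, \<pi>', g) then if x = (g, \<pi>, h) then P else 0 else 0)"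
    using * by (intro sum.cong refl) blast
  also have "\<dots> = (if (f, \<pi>', g) \<in> gpd_mor l d \<and> (g, \<pi>, h) \<in> gpd_mor l d then P else 0)"
    using finite_gpd_mor[of l d] by (cases "(f, \<pi>', g) \<in> gpd_mor l d") simp_all
  also have "\<dots> = P"
  proof (cases "m \<in> gpd_mor l d \<and> \<rho> = \<pi> \<circ> \<pi>'")
    case True
    then have f: "f \<in> gpd_obj l d" "h \<in> gpd_obj l d" "h \<circ> \<pi> \<circ> \<pi>' = f"
      by (auto simp: m gpd_mor_def o_assoc)
    have 1: "(f, \<pi>', g) \<in> gpd_mor l d"
      using bij_betw_apply[OF bij_gpd_mor, of "(f, \<pi>')" l d] f \<pi>' by (simp add: g_def)
    have "h \<circ> \<pi> = g" unfolding g_def f(3)[symmetric] using \<pi>' by (simp add: o_assoc[symmetric] permutes_inv_o)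
    then have "(g, \<pi>, h) \<in> gpd_mor l d" using 1 f \<pi> by (auto simp: gpd_mor_def)
    with 1 show ?thesis by simp
  qed (auto simp: P_def)
  finally show ?thesis using L by simp
qed

lemma root_of_unity_cnj:
  fixes z :: complex
  assumes "z ^ l = 1" "l > 0"
  shows "z * cnj z = 1"
proof -
  have "norm z ^ l = 1 ^ l" using assms(1) by (simp flip: norm_power)
  then have "norm z = 1" by (rule power_eq_imp_eq_base) (use assms(2) in simp_all)
  then show ?thesis by (simp add: complex_norm_square[symmetric])
qed

lemma prod_if_const:
  fixes a :: complex
  assumes "finite J"
  shows "(\<Prod>j\<in>J. if P j then a else 0) = (if \<forall>j\<in>J. P j then a ^ card J else 0)"
proof (cases "\<forall>j\<in>J. P j")
  case False
  then have "(\<Prod>j\<in>J. if P j then a else 0) = 0" using assms by (intro prod_zero) auto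
  then show ?thesis using False by (simp only: if_False)
qed simp

lemma Phi_coeff_orth_group:
  assumes l: "l > 0" and v: "v \<in> carrier (gen_sym_group l d)" and w: "w \<in> carrier (gen_sym_group l d)"
  shows "(\<Sum>m\<in>gpd_mor l d. Phi_coeff l d v m * cnj (Phi_coeff l d w m)) =
    (if v = w then of_nat l ^ d else 0)"
proof -
  obtain \<pi> c where \<pi>: "\<pi> permutes {1..d}" and c: "c \<in> {1..d} \<rightarrow>\<^sub>E {z. z ^ l = 1}"
    and v_eq: "v = monomial_mat d \<pi> c" using v by (rule gen_sym_group_cases)
  obtain \<pi>' c' where \<pi>': "\<pi>' permutes {1..d}" and c': "c' \<in> {1..d} \<rightarrow>\<^sub>E {z. z ^ l = 1}"
    and w_eq: "w = monomial_mat d \<pi>' c'" using w by (rule gen_sym_group_cases)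
  let ?P = "{\<sigma>. \<sigma> permutes {1..d}}"
  have finP: "finite ?P" by (rule finite_permutations) simp
  have c1: "c j ^ l = 1" "c' j ^ l = 1" if "j \<in> {1..d}" for j using c c' that by blast+
  have nz: "c j \<noteq> 0" "c' j \<noteq> 0" if "j \<in> {1..d}" for j
    using c1[OF that] l by (auto simp: power_0_left)
  have vw: "v = w \<longleftrightarrow> \<pi> = \<pi>' \<and> (\<forall>j\<in>{1..d}. c j = c' j)"
    unfolding v_eq w_eq by (rule monomial_mat_eq_iff[OF \<pi> \<pi>' nz])
  have z: "c j * cnj (c' j) = 1 \<longleftrightarrow> c j = c' j" if "j \<in> {1..d}" for j
  proof
    assume "c j * cnj (c' j) = 1"
    then have "c j * (c' j * cnj (c' j)) = c' j" by (simp add: mult.left_commute)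
    then show "c j = c' j" using root_of_unity_cnj[OF c1(2)[OF that] l] by simp
  qed (use root_of_unity_cnj[OF c1(2)[OF that] l] in simp)
  have "(\<Sum>m\<in>gpd_mor l d. Phi_coeff l d v m * cnj (Phi_coeff l d w m)) =
    (\<Sum>x\<in>gpd_obj l d \<times> ?P. case x of (f, \<sigma>) \<Rightarrow>
      (if \<sigma> = \<pi> then \<Prod>j\<in>{1..d}. c j ^ f j else 0) * cnj (if \<sigma> = \<pi>' then \<Prod>j\<in>{1..d}. c' j ^ f j else 0))"
  proof (subst sum.reindex_bij_betw[OF bij_gpd_mor, symmetric], rule sum.cong[OF refl], clarify)
    fix f \<sigma> assume "f \<in> gpd_obj l d" "\<sigma> permutes {1..d}"
    then have m: "(f, \<sigma>, f \<circ> inv_into UNIV \<sigma>) \<in> gpd_mor l d"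
      using bij_betw_apply[OF bij_gpd_mor, of "(f, \<sigma>)" l d] by simp
    show "Phi_coeff l d v (f, \<sigma>, f \<circ> inv_into UNIV \<sigma>) * cnj (Phi_coeff l d w (f, \<sigma>, f \<circ> inv_into UNIV \<sigma>)) =
      (if \<sigma> = \<pi> then \<Prod>j\<in>{1..d}. c j ^ f j else 0) * cnj (if \<sigma> = \<pi>' then \<Prod>j\<in>{1..d}. c' j ^ f j else 0)"
      unfolding v_eq w_eq Phi_coeff_monomial_mat[OF \<pi> m] Phi_coeff_monomial_mat[OF \<pi>' m] ..
  qed
  also have "\<dots> = (\<Sum>f\<in>gpd_obj l d. \<Sum>\<sigma>\<in>?P. if \<sigma> = \<pi> then
      (if \<pi> = \<pi>' then \<Prod>j\<in>{1..d}. (c j * cnj (c' j)) ^ f j else 0) else 0)"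
    unfolding sum.cartesian_product
    by (intro sum.cong refl) (auto simp: power_mult_distrib prod.distrib)
  also have "\<dots> = (\<Sum>f\<in>gpd_obj l d. if \<pi> = \<pi>' then \<Prod>j\<in>{1..d}. (c j * cnj (c' j)) ^ f j else 0)"
    using finP \<pi> by simp
  also have "\<dots> = (if \<pi> = \<pi>' then (\<Sum>f\<in>gpd_obj l d. \<Prod>j\<in>{1..d}. (c j * cnj (c' j)) ^ f j) else 0)"
    by simp
  also have "(\<Sum>f\<in>gpd_obj l d. \<Prod>j\<in>{1..d}. (c j * cnj (c' j)) ^ f j) =
      (\<Prod>j\<in>{1..d}. \<Sum>k\<in>{1..l}. (c j * cnj (c' j)) ^ k)"
    unfolding gpd_obj_def by (rule prod_sum_PiE[symmetric]) auto
  also have "\<dots> = (\<Prod>j\<in>{1..d}. if c j = c' j then of_nat l else 0)"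
  proof (rule prod.cong[OF refl])
    fix j assume j: "j \<in> {1..d}"
    have "(c j * cnj (c' j)) ^ l = 1"
      using c1[OF j] by (simp add: power_mult_distrib flip: complex_cnj_power)
    then show "(\<Sum>k\<in>{1..l}. (c j * cnj (c' j)) ^ k) = (if c j = c' j then of_nat l else 0)"
      by (subst sum_root_powers) (simp_all only: z[OF j])
  qed
  also have "\<dots> = (if \<forall>j\<in>{1..d}. c j = c' j then of_nat l ^ d else 0)"
    using prod_if_const[of "{1..d}" "\<lambda>j. c j = c' j" "of_nat l"] by simp
  finally show ?thesis unfolding vw by simp
qed

lemma Phi_coeff_orth_mor:
  assumes l: "l > 0" and m: "m \<in> gpd_mor l d" and m': "m' \<in> gpd_mor l d"
  shows "(\<Sum>w\<in>carrier (gen_sym_group l d). Phi_coeff l d w m * cnj (Phi_coeff l d w m')) =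
    (if m = m' then of_nat l ^ d else 0)"
proof -
  obtain f \<sigma> g where m_eq: "m = (f, \<sigma>, g)" by (cases m)
  obtain f' \<sigma>' g' where m'_eq: "m' = (f', \<sigma>', g')" by (cases m')
  let ?P = "{\<sigma>. \<sigma> permutes {1..d}}" and ?C = "{1..d} \<rightarrow>\<^sub>E {z::complex. z ^ l = 1}"
  have finP: "finite ?P" by (rule finite_permutations) simp
  have f: "f \<in> gpd_obj l d" "f' \<in> gpd_obj l d" and \<sigma>: "\<sigma> permutes {1..d}" "\<sigma>' permutes {1..d}"
    and g: "g \<circ> \<sigma> = f" "g' \<circ> \<sigma>' = f'"
    using m m' by (auto simp: m_eq m'_eq gpd_mor_def)
  have fj: "f j \<in> {1..l}" "f' j \<in> {1..l}" if "j \<in> {1..d}" for j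
    using f that unfolding gpd_obj_def by (blast dest: PiE_mem)+
  have mm: "m = m' \<longleftrightarrow> \<sigma> = \<sigma>' \<and> (\<forall>j\<in>{1..d}. f j = f' j)"
  proof
    assume *: "\<sigma> = \<sigma>' \<and> (\<forall>j\<in>{1..d}. f j = f' j)"
    then have ff: "f = f'" using f unfolding gpd_obj_def by (blast intro: PiE_ext)
    have "g = f \<circ> inv_into UNIV \<sigma>" "g' = f' \<circ> inv_into UNIV \<sigma>'"
      unfolding g[symmetric] by (simp_all only: o_assoc[symmetric] permutes_inv_o[OF \<sigma>(1)] permutes_inv_o[OF \<sigma>(2)] comp_id)
    with * ff show "m = m'" by (simp add: m_eq m'_eq)
  qed (simp add: m_eq m'_eq)
  have "(\<Sum>w\<in>carrier (gen_sym_group l d). Phi_coeff l d w m * cnj (Phi_coeff l d w m')) =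
    (\<Sum>x\<in>?P \<times> ?C. case x of (\<pi>, c) \<Rightarrow>
      (if \<sigma> = \<pi> then \<Prod>j\<in>{1..d}. c j ^ f j else 0) * cnj (if \<sigma>' = \<pi> then \<Prod>j\<in>{1..d}. c j ^ f' j else 0))"
  proof (subst sum.reindex_bij_betw[OF bij_gen_sym_group[OF l], symmetric], rule sum.cong[OF refl], clarify)
    fix \<pi> c assume \<pi>: "\<pi> permutes {1..d}"
    show "Phi_coeff l d (monomial_mat d \<pi> c) m * cnj (Phi_coeff l d (monomial_mat d \<pi> c) m') =
      (if \<sigma> = \<pi> then \<Prod>j\<in>{1..d}. c j ^ f j else 0) * cnj (if \<sigma>' = \<pi> then \<Prod>j\<in>{1..d}. c j ^ f' j else 0)"
      unfolding m_eq m'_eq Phi_coeff_monomial_mat[OF \<pi> m[unfolded m_eq]]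
        Phi_coeff_monomial_mat[OF \<pi> m'[unfolded m'_eq]] ..
  qed
  also have "\<dots> = (\<Sum>\<pi>\<in>?P. \<Sum>c\<in>?C.
      (if \<sigma> = \<pi> then \<Prod>j\<in>{1..d}. c j ^ f j else 0) * cnj (if \<sigma>' = \<pi> then \<Prod>j\<in>{1..d}. c j ^ f' j else 0))"
    by (rule sum.cartesian_product[symmetric])
  also have "\<dots> = (\<Sum>\<pi>\<in>?P. if \<pi> = \<sigma> then
      (if \<sigma> = \<sigma>' then \<Sum>c\<in>?C. \<Prod>j\<in>{1..d}. c j ^ f j * cnj (c j) ^ f' j else 0) else 0)"
    by (rule sum.cong[OF refl]) (simp add: prod.distrib)
  also have "\<dots> = (if \<sigma> = \<sigma>' then \<Sum>c\<in>?C. \<Prod>j\<in>{1..d}. c j ^ f j * cnj (c j) ^ f' j else 0)"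
    using finP \<sigma> by simp
  also have "(\<Sum>c\<in>?C. \<Prod>j\<in>{1..d}. c j ^ f j * cnj (c j) ^ f' j) =
      (\<Prod>j\<in>{1..d}. \<Sum>z | z ^ l = (1::complex). z ^ f j * cnj z ^ f' j)"
    by (rule prod_sum_PiE[symmetric]) (use finite_roots_unity[of l] l in auto)
  also have "\<dots> = (\<Prod>j\<in>{1..d}. if f j = f' j then of_nat l else 0)"
    by (rule prod.cong[OF refl]) (rule sum_powers_roots[OF l fj])
  also have "\<dots> = (if \<forall>j\<in>{1..d}. f j = f' j then of_nat l ^ d else 0)"
    using prod_if_const[of "{1..d}" "\<lambda>j. f j = f' j" "of_nat l"] by simp
  finally show ?thesis unfolding mm by simp
qed

lemma gen_sym_group_simps:
  "x \<otimes>\<^bsub>gen_sym_group l d\<^esub> y = x * y" "\<one>\<^bsub>gen_sym_group l d\<^esub> = 1\<^sub>m d"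
  by (simp_all add: gen_sym_group_def)

lemma perm_mat_monomial: "perm_mat d \<sigma> = monomial_mat d \<sigma> (\<lambda>_. 1)"
  by (simp add: perm_mat_def monomial_mat_def)

lemma one_mat_monomial: "1\<^sub>m d = monomial_mat d id (\<lambda>_. 1)"
  by (intro eq_matI) (auto simp: monomial_mat_def)

lemma s0_monomial: "s0 d \<xi> k = monomial_mat d id (\<lambda>j. if j = k then \<xi> else 1)"
  by (intro eq_matI) (auto simp: s0_def monomial_mat_def)

lemma gen_sym_group_mult_closed:
  assumes l: "l > 0" and "v \<in> carrier (gen_sym_group l d)" "w \<in> carrier (gen_sym_group l d)"
  shows "v * w \<in> carrier (gen_sym_group l d)"
proof -
  obtain \<pi> c where \<pi>: "\<pi> permutes {1..d}" and c: "c \<in> {1..d} \<rightarrow>\<^sub>E {z. z ^ l = 1}"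
    and v_eq: "v = monomial_mat d \<pi> c" using assms(2) by (rule gen_sym_group_cases)
  obtain \<pi>' c' where \<pi>': "\<pi>' permutes {1..d}" and c': "c' \<in> {1..d} \<rightarrow>\<^sub>E {z. z ^ l = 1}"
    and w_eq: "w = monomial_mat d \<pi>' c'" using assms(3) by (rule gen_sym_group_cases)
  show ?thesis
    unfolding v_eq w_eq monomial_mat_mult[OF \<pi>']
  proof (rule monomial_mat_carrier[OF permutes_compose[OF \<pi>' \<pi>] l])
    fix j assume j: "j \<in> {1..d}"
    then have "\<pi>' j \<in> {1..d}" using permutes_in_image[OF \<pi>'] by simp
    then have "c (\<pi>' j) ^ l = 1" "c' j ^ l = 1" using c c' j by blast+
    then show "(c (\<pi>' j) * c' j) ^ l = 1" by (simp add: power_mult_distrib)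
  qed
qed

lemma Phi_isos_nonempty:
  assumes l: "l > 0" and \<xi>: "\<xi> ^ l = 1"
  shows "Phi_isos l d \<xi> \<noteq> {}"
proof -
  define G where "G = carrier (gen_sym_group l d)"
  define M where "M = gpd_mor l d"
  define \<Phi> where "\<Phi> a = (\<lambda>m. \<Sum>w\<in>G. a w * Phi_coeff l d w m)" for a
  define \<Psi> where "\<Psi> b = (\<lambda>w. if w \<in> G then (\<Sum>m\<in>M. b m * cnj (Phi_coeff l d w m)) / of_nat l ^ d else 0)" for b
  have finG: "finite G" and finM: "finite M"
    unfolding G_def M_def using finite_gen_sym_group[OF l] finite_gpd_mor by blast+
  have ld: "(of_nat l :: complex) ^ d \<noteq> 0" using l by simp
  have cA: "carrier (group_algebra (gen_sym_group l d)) = {a. \<forall>x. x \<notin> G \<longrightarrow> a x = 0}"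
    by (simp add: group_algebra_def partial_algebra_def G_def)
  have cB: "carrier (groupoid_algebra l d) = {a. \<forall>x. x \<notin> M \<longrightarrow> a x = 0}"
    by (simp add: groupoid_algebra_def partial_algebra_def M_def)
  have bas: "\<Phi> (basis_elem w) = Phi_coeff l d w" if "w \<in> G" for w
    unfolding \<Phi>_def basis_elem_def using that finG by (simp add: if_distrib[of "\<lambda>x. x * _"] cong: if_cong)
  have perm: "\<Phi> (basis_elem (perm_mat d \<sigma>)) =
      (\<lambda>m. \<Sum>f\<in>gpd_obj l d. \<Sum>g\<in>gpd_obj l d. if g \<circ> \<sigma> = f then basis_elem (f, \<sigma>, g) m else 0)"
    if \<sigma>: "\<sigma> permutes {1..d}" for \<sigma>
  proof
    fix m :: mor
    obtain f' \<sigma>' g' where m: "m = (f', \<sigma>', g')" by (cases m)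
    have "perm_mat d \<sigma> \<in> G"
      unfolding perm_mat_monomial G_def by (rule monomial_mat_carrier[OF \<sigma> l]) simp
    then have "\<Phi> (basis_elem (perm_mat d \<sigma>)) m = Phi_coeff l d (monomial_mat d \<sigma> (\<lambda>_. 1)) m"
      by (simp add: bas perm_mat_monomial)
    also have "\<dots> = (if m \<in> gpd_mor l d \<and> \<sigma>' = \<sigma> then 1 else 0)"
      using Phi_coeff_monomial_mat[OF \<sigma>, of f' \<sigma>' g' l "\<lambda>_. 1"] Phi_coeff_not_mor[of m l d]
      by (cases "m \<in> gpd_mor l d") (simp_all add: m)
    also have "\<dots> = (if f' \<in> gpd_obj l d then if g' \<in> gpd_obj l d then if \<sigma>' = \<sigma> \<and> g' \<circ> \<sigma> = f' then 1 else 0 else 0 else 0)"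
      using \<sigma> by (auto simp: m gpd_mor_def)
    also have "\<dots> = (\<Sum>f\<in>gpd_obj l d. \<Sum>g\<in>gpd_obj l d. if g = g' then
        if f = f' then if \<sigma>' = \<sigma> \<and> g' \<circ> \<sigma> = f' then 1 else 0 else 0 else 0)"
      using finite_gpd_obj by simp
    also have "\<dots> = (\<Sum>f\<in>gpd_obj l d. \<Sum>g\<in>gpd_obj l d. if g \<circ> \<sigma> = f then basis_elem (f, \<sigma>, g) m else 0)"
      by (intro sum.cong refl) (auto simp: basis_elem_def m)
    finally show "\<Phi> (basis_elem (perm_mat d \<sigma>)) m =
      (\<Sum>f\<in>gpd_obj l d. \<Sum>g\<in>gpd_obj l d. if g \<circ> \<sigma> = f then basis_elem (f, \<sigma>, g) m else 0)" .
  qed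
  have diag: "Phi_coeff l d (monomial_mat d id c) m =
      (\<Sum>f\<in>gpd_obj l d. (\<Prod>j\<in>{1..d}. c j ^ f j) * basis_elem (mor_id f) m)" for c m
  proof -
    obtain f' \<sigma>' g' where m: "m = (f', \<sigma>', g')" by (cases m)
    have "Phi_coeff l d (monomial_mat d id c) m =
      (if m \<in> gpd_mor l d \<and> \<sigma>' = id then \<Prod>j\<in>{1..d}. c j ^ f' j else 0)"
      using Phi_coeff_monomial_mat[OF permutes_id, of f' \<sigma>' g' l d c] Phi_coeff_not_mor[of m l d]
      by (cases "m \<in> gpd_mor l d") (simp_all add: m)
    also have "\<dots> = (if f' \<in> gpd_obj l d then if g' = f' \<and> \<sigma>' = id then \<Prod>j\<in>{1..d}. c j ^ f' j else 0 else 0)"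
      by (auto simp: m gpd_mor_def permutes_id)
    also have "\<dots> = (\<Sum>f\<in>gpd_obj l d. if f = f' then if g' = f' \<and> \<sigma>' = id then \<Prod>j\<in>{1..d}. c j ^ f' j else 0 else 0)"
      using finite_gpd_obj by simp
    also have "\<dots> = (\<Sum>f\<in>gpd_obj l d. (\<Prod>j\<in>{1..d}. c j ^ f j) * basis_elem (mor_id f) m)"
      by (intro sum.cong refl) (auto simp: basis_elem_def mor_id_def m)
    finally show ?thesis .
  qed
  have s0: "\<Phi> (basis_elem (s0 d \<xi> 1)) = (\<lambda>m. \<Sum>f\<in>gpd_obj l d. \<xi> ^ f 1 * basis_elem (mor_id f) m)"
    if d: "d \<ge> 1"
  proof
    fix m
    have pr: "(\<Prod>j\<in>{1..d}. (if j = 1 then \<xi> else 1) ^ f j) = \<xi> ^ f 1" for f :: "nat \<Rightarrow> nat"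
    proof -
      have "(\<Prod>j\<in>{1..d}. (if j = 1 then \<xi> else 1) ^ f j) = (\<Prod>j\<in>{1..d}. if j = 1 then \<xi> ^ f j else 1)"
        by (intro prod.cong) auto
      then show ?thesis using d by simp
    qed
    have "s0 d \<xi> 1 \<in> G"
      unfolding s0_monomial G_def by (rule monomial_mat_carrier[OF permutes_id l]) (simp add: \<xi>)
    then have "\<Phi> (basis_elem (s0 d \<xi> 1)) m =
        Phi_coeff l d (monomial_mat d id (\<lambda>j. if j = 1 then \<xi> else 1)) m"
      by (simp add: bas s0_monomial)
    then show "\<Phi> (basis_elem (s0 d \<xi> 1)) m = (\<Sum>f\<in>gpd_obj l d. \<xi> ^ f 1 * basis_elem (mor_id f) m)"
      unfolding diag pr .
  qed
  have one: "\<Phi> \<one>\<^bsub>group_algebra (gen_sym_group l d)\<^esub> = \<one>\<^bsub>groupoid_algebra l d\<^esub>"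
  proof
    fix m
    have 1: "1\<^sub>m d \<in> G"
      unfolding one_mat_monomial G_def by (rule monomial_mat_carrier[OF permutes_id l]) simp
    have "\<one>\<^bsub>group_algebra (gen_sym_group l d)\<^esub> = basis_elem (1\<^sub>m d)"
      by (simp add: group_algebra_def partial_algebra_def gen_sym_group_simps)
    then have "\<Phi> \<one>\<^bsub>group_algebra (gen_sym_group l d)\<^esub> m = Phi_coeff l d (monomial_mat d id (\<lambda>_. 1)) m"
      using bas[OF 1] by (simp add: one_mat_monomial)
    also have "\<dots> = (\<Sum>f\<in>gpd_obj l d. basis_elem (mor_id f) m)" by (simp add: diag)
    also have "\<dots> = (\<Sum>e\<in>mor_id ` gpd_obj l d. basis_elem e m)"
      by (subst sum.reindex) (auto simp: inj_on_def mor_id_def)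
    finally show "\<Phi> \<one>\<^bsub>group_algebra (gen_sym_group l d)\<^esub> m = \<one>\<^bsub>groupoid_algebra l d\<^esub> m"
      by (simp add: groupoid_algebra_def partial_algebra_def)
  qed
  have mult: "\<Phi> (a \<otimes>\<^bsub>group_algebra (gen_sym_group l d)\<^esub> b) = \<Phi> a \<otimes>\<^bsub>groupoid_algebra l d\<^esub> \<Phi> b" for a b
  proof
    fix m
    have "\<Phi> (a \<otimes>\<^bsub>group_algebra (gen_sym_group l d)\<^esub> b) m =
        (\<Sum>w\<in>G. \<Sum>x\<in>G. \<Sum>y\<in>G. if w = x * y then a x * b y * Phi_coeff l d w m else 0)"
      unfolding \<Phi>_def group_algebra_def partial_algebra_def
      by (simp add: gen_sym_group_simps sum_distrib_right flip: G_def)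
        (intro sum.cong refl, auto)
    also have "\<dots> = (\<Sum>x\<in>G. \<Sum>w\<in>G. \<Sum>y\<in>G. if w = x * y then a x * b y * Phi_coeff l d w m else 0)"
      by (rule sum.swap)
    also have "\<dots> = (\<Sum>x\<in>G. \<Sum>y\<in>G. \<Sum>w\<in>G. if w = x * y then a x * b y * Phi_coeff l d w m else 0)"
      by (rule sum.cong[OF refl]) (rule sum.swap)
    also have "\<dots> = (\<Sum>x\<in>G. \<Sum>y\<in>G. a x * b y * Phi_coeff l d (x * y) m)"
      using finG gen_sym_group_mult_closed[OF l] by (intro sum.cong refl) (simp add: G_def)
    also have "\<dots> = (\<Sum>x\<in>G. \<Sum>y\<in>G. \<Sum>u\<in>M. \<Sum>v\<in>M. if mor_comp u v = Some m
        then (a x * Phi_coeff l d x u) * (b y * Phi_coeff l d y v) else 0)"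
      by (intro sum.cong refl)
        (simp add: Phi_coeff_mult[OF l] G_def M_def sum_distrib_left if_distrib[of "\<lambda>x. _ * x"] mult_ac cong: if_cong)
    also have "\<dots> = (\<Sum>x\<in>G. \<Sum>u\<in>M. \<Sum>y\<in>G. \<Sum>v\<in>M. if mor_comp u v = Some m
        then (a x * Phi_coeff l d x u) * (b y * Phi_coeff l d y v) else 0)"
      by (rule sum.cong[OF refl]) (rule sum.swap)
    also have "\<dots> = (\<Sum>u\<in>M. \<Sum>x\<in>G. \<Sum>y\<in>G. \<Sum>v\<in>M. if mor_comp u v = Some m
        then (a x * Phi_coeff l d x u) * (b y * Phi_coeff l d y v) else 0)"
      by (rule sum.swap)
    also have "\<dots> = (\<Sum>u\<in>M. \<Sum>x\<in>G. \<Sum>v\<in>M. \<Sum>y\<in>G. if mor_comp u v = Some m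
        then (a x * Phi_coeff l d x u) * (b y * Phi_coeff l d y v) else 0)"
      by (rule sum.cong[OF refl], rule sum.cong[OF refl], rule sum.swap)
    also have "\<dots> = (\<Sum>u\<in>M. \<Sum>v\<in>M. \<Sum>x\<in>G. \<Sum>y\<in>G. if mor_comp u v = Some m
        then (a x * Phi_coeff l d x u) * (b y * Phi_coeff l d y v) else 0)"
      by (rule sum.cong[OF refl]) (rule sum.swap)
    also have "\<dots> = (\<Sum>u\<in>M. \<Sum>v\<in>M. if mor_comp u v = Some m then \<Phi> a u * \<Phi> b v else 0)"
      by (intro sum.cong refl) (simp add: \<Phi>_def sum_product)
    finally show "\<Phi> (a \<otimes>\<^bsub>group_algebra (gen_sym_group l d)\<^esub> b) m = (\<Phi> a \<otimes>\<^bsub>groupoid_algebra l d\<^esub> \<Phi> b) m"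
      by (simp add: groupoid_algebra_def partial_algebra_def M_def)
  qed
  have add: "\<Phi> (a \<oplus>\<^bsub>group_algebra (gen_sym_group l d)\<^esub> b) = \<Phi> a \<oplus>\<^bsub>groupoid_algebra l d\<^esub> \<Phi> b" for a b
    by (simp add: \<Phi>_def group_algebra_def groupoid_algebra_def partial_algebra_def distrib_right sum.distrib)
  have smult: "\<Phi> (k \<odot>\<^bsub>group_algebra (gen_sym_group l d)\<^esub> a) = k \<odot>\<^bsub>groupoid_algebra l d\<^esub> \<Phi> a" for k a
    by (simp add: \<Phi>_def group_algebra_def groupoid_algebra_def partial_algebra_def sum_distrib_left mult.assoc)
  have clos: "\<Phi> a \<in> carrier (groupoid_algebra l d)" for a
    unfolding cB \<Phi>_def M_def by (simp add: Phi_coeff_not_mor)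
  have "bij_betw \<Phi> (carrier (group_algebra (gen_sym_group l d))) (carrier (groupoid_algebra l d))"
  proof (rule bij_betw_byWitness[where f' = \<Psi>])
    show "\<Phi> ` carrier (group_algebra (gen_sym_group l d)) \<subseteq> carrier (groupoid_algebra l d)"
      using clos by blast
    show "\<Psi> ` carrier (groupoid_algebra l d) \<subseteq> carrier (group_algebra (gen_sym_group l d))"
      unfolding cA \<Psi>_def by auto
    show "\<forall>a\<in>carrier (group_algebra (gen_sym_group l d)). \<Psi> (\<Phi> a) = a"
    proof (intro ballI ext)
      fix a w assume a: "a \<in> carrier (group_algebra (gen_sym_group l d))"
      show "\<Psi> (\<Phi> a) w = a w"
      proof (cases "w \<in> G")
        case True
        have "(\<Sum>m\<in>M. \<Phi> a m * cnj (Phi_coeff l d w m)) =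
            (\<Sum>m\<in>M. \<Sum>v\<in>G. a v * (Phi_coeff l d v m * cnj (Phi_coeff l d w m)))"
          by (simp add: \<Phi>_def sum_distrib_right mult.assoc)
        also have "\<dots> = (\<Sum>v\<in>G. a v * (\<Sum>m\<in>M. Phi_coeff l d v m * cnj (Phi_coeff l d w m)))"
          unfolding sum_distrib_left by (rule sum.swap)
        also have "\<dots> = (\<Sum>v\<in>G. if v = w then a v * of_nat l ^ d else 0)"
          using Phi_coeff_orth_group[OF l] True
          by (intro sum.cong refl) (simp add: G_def M_def)
        also have "\<dots> = a w * of_nat l ^ d" using True finG by simp
        finally show ?thesis using True ld by (simp add: \<Psi>_def)
      next
        case False
        then show ?thesis using a by (simp add: cA \<Psi>_def)
      qed
    qed
    show "\<forall>b\<in>carrier (groupoid_algebra l d). \<Phi> (\<Psi> b) = b"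
    proof (intro ballI ext)
      fix b m assume b: "b \<in> carrier (groupoid_algebra l d)"
      show "\<Phi> (\<Psi> b) m = b m"
      proof (cases "m \<in> M")
        case True
        have "\<Phi> (\<Psi> b) m = (\<Sum>w\<in>G. (\<Sum>x\<in>M. b x * cnj (Phi_coeff l d w x)) / of_nat l ^ d * Phi_coeff l d w m)"
          unfolding \<Phi>_def by (intro sum.cong refl) (simp add: \<Psi>_def)
        also have "\<dots> = (\<Sum>w\<in>G. \<Sum>x\<in>M. b x / of_nat l ^ d * (Phi_coeff l d w m * cnj (Phi_coeff l d w x)))"
          unfolding sum_divide_distrib sum_distrib_right by (intro sum.cong refl) (simp add: mult_ac)
        also have "\<dots> = (\<Sum>x\<in>M. b x / of_nat l ^ d * (\<Sum>w\<in>G. Phi_coeff l d w m * cnj (Phi_coeff l d w x)))"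
          unfolding sum_distrib_left by (rule sum.swap)
        also have "\<dots> = (\<Sum>x\<in>M. if x = m then b x else 0)"
          using Phi_coeff_orth_mor[OF l] True ld
          by (intro sum.cong refl) (auto simp: G_def M_def)
        also have "\<dots> = b m" using True finM by simp
        finally show ?thesis .
      next
        case False
        then have "\<Phi> (\<Psi> b) m = 0" "b m = 0" using b clos[of "\<Psi> b"] unfolding cB by blast+
        then show ?thesis by simp
      qed
    qed
  qed
  then have "\<Phi> \<in> algebra_isos (group_algebra (gen_sym_group l d)) (groupoid_algebra l d)"
    unfolding algebra_isos_def ring_iso_def Ring.ring_hom_def linear_maps_def
    using mult add smult one clos by blast
  with perm s0 have "\<Phi> \<in> Phi_isos l d \<xi>" unfolding Phi_isos_def by blast
  then show ?thesis by blast
qed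

end

theory Submission
  imports Defs
begin

text \<open>
  A monomial matrix with permutation \<open>\<pi>\<close> and entries \<open>c\<close> maps the summand at $g \circ \pi$ to
  the summand at \<open>g\<close> by $\prod_j c_j^{g(\pi(j))}$ times the value of the functor at \<open>\<pi>\<close>. Hence
  the group permutes the summands transitively on objects of a given type, and the generalized
  Young subgroup of \<open>f\<close> is exactly the stabilizer of the summand at \<open>f\<close>, which gives the induced
  module. On this summand the stabilizer acts, up to scalars, through the whole Young group, and
  James' submodule theorem shows that the tensor product of Specht modules is simple.
\<close>

section \<open>Complex vector spaces\<close>

text \<open>\<open>\<Phi>\<close> is prescribed only on permutation matrices and on the first
  diagonal generator, so its values on monomial matrices have to be recovered from multiplicativity.
  This and the description of the generalized Young subgroup rest on one induction principle for
  monomial matrices, in which every root of unity is a power of \<open>\<xi>\<close>. Simplicity of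
  an external tensor product is no formal consequence of simplicity of the factors; the usual
  argument uses endomorphism rings or density. Antisymmetrizing all factors at once avoids this,
  since the product of the signed column sums still has rank at most one. The scalars of the
  diagonal matrices do not interfere: permutation matrices, whose nonzero entries are 1, already
  realize the whole Young group. The induced module is a quotient of functions on the group and
  comes without a basis. Summing over the whole group inverts the multiplication map up to the order
  of the stabilizer, because the matrices taking the summand at f to another one of the same type
  form a coset of that stabilizer.\<close>

lemma complex_field_simps [simp]:
  "carrier complex_field = UNIV" "a \<otimes>\<^bsub>complex_field\<^esub> b = a * b" "a \<oplus>\<^bsub>complex_field\<^esub> b = a + b"
  "\<one>\<^bsub>complex_field\<^esub> = 1" "\<zero>\<^bsub>complex_field\<^esub> = 0"
  by (simp_all add: complex_field_def)

lemma cring_complex_field: "cring complex_field"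
proof (rule cringI)
  show "abelian_group complex_field"
    by (rule abelian_groupI) (auto simp: add.assoc add.commute intro: exI[of _ "- x" for x])
  show "Group.comm_monoid complex_field"
    by (rule comm_monoidI) (auto simp: mult.assoc mult.commute)
qed (auto simp: distrib_right)

text \<open>Additive inverses come from scaling by -1, which is why
  \<open>0 \<odot> v = \<zero>\<close> stands among the hypotheses instead of a condition on
  negatives.\<close>

lemma complex_moduleI:
  fixes V (structure)
  assumes "\<And>u v. u \<in> carrier V \<Longrightarrow> v \<in> carrier V \<Longrightarrow> u \<oplus> v \<in> carrier V"
    and "\<zero> \<in> carrier V"
    and "\<And>c v. v \<in> carrier V \<Longrightarrow> c \<odot> v \<in> carrier V"
    and "\<And>u v w. u \<in> carrier V \<Longrightarrow> v \<in> carrier V \<Longrightarrow> w \<in> carrier V \<Longrightarrow> (u \<oplus> v) \<oplus> w = u \<oplus> (v \<oplus> w)"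
    and "\<And>u v. u \<in> carrier V \<Longrightarrow> v \<in> carrier V \<Longrightarrow> u \<oplus> v = v \<oplus> u"
    and "\<And>v. v \<in> carrier V \<Longrightarrow> \<zero> \<oplus> v = v"
    and "\<And>a b v. v \<in> carrier V \<Longrightarrow> (a + b) \<odot> v = (a \<odot> v) \<oplus> (b \<odot> v)"
    and "\<And>a u v. u \<in> carrier V \<Longrightarrow> v \<in> carrier V \<Longrightarrow> a \<odot> (u \<oplus> v) = (a \<odot> u) \<oplus> (a \<odot> v)"
    and "\<And>a b v. v \<in> carrier V \<Longrightarrow> (a * b) \<odot> v = a \<odot> (b \<odot> v)"
    and one: "\<And>v. v \<in> carrier V \<Longrightarrow> 1 \<odot> v = v"
    and zero: "\<And>v. v \<in> carrier V \<Longrightarrow> 0 \<odot> v = \<zero>"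
  shows "module complex_field V"
proof (rule moduleI[OF cring_complex_field])
  show "abelian_group V"
  proof (rule abelian_groupI)
    fix v assume v: "v \<in> carrier V"
    have "(-1 + 1) \<odot> v = ((-1) \<odot> v) \<oplus> (1 \<odot> v)" by (rule assms(7)[OF v])
    then have "((-1) \<odot> v) \<oplus> v = \<zero>" using v by (simp add: one zero)
    then show "\<exists>y\<in>carrier V. y \<oplus> v = \<zero>" using v assms(3) by blast
  qed (use assms in auto)
qed (use assms in auto)

lemma complex_uminus:
  assumes "module complex_field V" "v \<in> carrier V"
  shows "\<ominus>\<^bsub>V\<^esub> v = (-1) \<odot>\<^bsub>V\<^esub> v"
proof -
  interpret module complex_field V by fact
  have "((-1) + 1) \<odot>\<^bsub>V\<^esub> v = ((-1) \<odot>\<^bsub>V\<^esub> v) \<oplus>\<^bsub>V\<^esub> (1 \<odot>\<^bsub>V\<^esub> v)"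
    using smult_l_distr[of "-1" 1 v] assms by simp
  then have "((-1) \<odot>\<^bsub>V\<^esub> v) \<oplus>\<^bsub>V\<^esub> v = \<zero>\<^bsub>V\<^esub>"
    using smult_one[of v] smult_l_null[of v] assms by simp
  then show ?thesis using M.minus_equality[of "(-1) \<odot>\<^bsub>V\<^esub> v" v] smult_closed[of "-1" v] assms by simp
qed

text \<open>Scaling by -1 supplies the negatives, so the subgroup condition hidden in
  \<open>submodule\<close> reduces to zero, sums and multiples.\<close>

lemma complex_submodule_iff:
  assumes "module complex_field V"
  shows "submodule W complex_field V \<longleftrightarrow> W \<subseteq> carrier V \<and> \<zero>\<^bsub>V\<^esub> \<in> W \<and>
    (\<forall>u\<in>W. \<forall>v\<in>W. u \<oplus>\<^bsub>V\<^esub> v \<in> W) \<and> (\<forall>c. \<forall>v\<in>W. c \<odot>\<^bsub>V\<^esub> v \<in> W)"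
proof -
  interpret module complex_field V by fact
  show ?thesis
  proof
    assume W: "submodule W complex_field V"
    note E = submoduleE[OF W]
    obtain w where w: "w \<in> W" using E(2) by blast
    then have "\<zero>\<^bsub>V\<^esub> = 0 \<odot>\<^bsub>V\<^esub> w" using smult_l_null[of w] E(1) by auto
    then have "\<zero>\<^bsub>V\<^esub> \<in> W" using E(4)[of 0 w] w by simp
    then show "W \<subseteq> carrier V \<and> \<zero>\<^bsub>V\<^esub> \<in> W \<and>
      (\<forall>u\<in>W. \<forall>v\<in>W. u \<oplus>\<^bsub>V\<^esub> v \<in> W) \<and> (\<forall>c. \<forall>v\<in>W. c \<odot>\<^bsub>V\<^esub> v \<in> W)"
      using E by simp
  next
    assume "W \<subseteq> carrier V \<and> \<zero>\<^bsub>V\<^esub> \<in> W \<and>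
      (\<forall>u\<in>W. \<forall>v\<in>W. u \<oplus>\<^bsub>V\<^esub> v \<in> W) \<and> (\<forall>c. \<forall>v\<in>W. c \<odot>\<^bsub>V\<^esub> v \<in> W)"
    then show "submodule W complex_field V"
      by (intro submoduleI) (auto simp: complex_uminus[OF assms] subset_iff)
  qed
qed

lemma lin_span_submodule:
  assumes "module complex_field V" "B \<subseteq> carrier V"
  shows "submodule (lin_span V B) complex_field V"
  using module.carrier_is_submodule[OF assms(1)] assms(2)
  unfolding complex_submodule_iff[OF assms(1)] lin_span_def by blast

lemma lin_span_superset: "B \<subseteq> lin_span V B"
  by (auto simp: lin_span_def)

lemma lin_span_least: "submodule W complex_field V \<Longrightarrow> B \<subseteq> W \<Longrightarrow> lin_span V B \<subseteq> W"
  by (auto simp: lin_span_def)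

section \<open>Function spaces and direct sums as vector spaces\<close>

lemma fun_space_simps [simp]:
  "carrier (fun_space V) = V" "\<zero>\<^bsub>fun_space V\<^esub> = (\<lambda>_. 0)" "u \<oplus>\<^bsub>fun_space V\<^esub> v = (\<lambda>x. u x + v x)"
  "c \<odot>\<^bsub>fun_space V\<^esub> v = (\<lambda>x. c * v x)"
  by (simp_all add: fun_space_def)

lemma module_fun_space_UNIV: "module complex_field (fun_space UNIV)"
  by (rule complex_moduleI) (auto simp: algebra_simps)

lemma submodule_fun_space_iff:
  "submodule W complex_field (fun_space UNIV) \<longleftrightarrow> (\<lambda>_. 0) \<in> W \<and>
    (\<forall>u\<in>W. \<forall>v\<in>W. (\<lambda>x. u x + v x) \<in> W) \<and> (\<forall>c. \<forall>v\<in>W. (\<lambda>x. c * v x) \<in> W)"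
  unfolding complex_submodule_iff[OF module_fun_space_UNIV] by simp

lemma module_fun_space:
  assumes "submodule W complex_field (fun_space UNIV)"
  shows "module complex_field (fun_space W)"
  using submodule.submodule_is_module[OF assms module_fun_space_UNIV] by (simp add: fun_space_def)

lemma direct_sum_simps [simp]:
  "carrier (direct_sum I V) = (\<Pi>\<^sub>E i\<in>I. carrier (V i))" "\<zero>\<^bsub>direct_sum I V\<^esub> = (\<lambda>i\<in>I. \<zero>\<^bsub>V i\<^esub>)"
  "u \<oplus>\<^bsub>direct_sum I V\<^esub> v = (\<lambda>i\<in>I. u i \<oplus>\<^bsub>V i\<^esub> v i)"
  "c \<odot>\<^bsub>direct_sum I V\<^esub> v = (\<lambda>i\<in>I. c \<odot>\<^bsub>V i\<^esub> v i)"
  by (simp_all add: direct_sum_def)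

lemma module_direct_sum:
  assumes "\<And>i. i \<in> I \<Longrightarrow> module complex_field (V i)"
  shows "module complex_field (direct_sum I V)"
proof (rule complex_moduleI)
  note ab = module.axioms(2)[OF assms]
  note mon = abelian_group.axioms(1)[OF ab]
  fix a b and u v w
  assume u: "u \<in> carrier (direct_sum I V)"
  have ui: "u i \<in> carrier (V i)" if "i \<in> I" for i using u that by (auto simp: PiE_iff)
  have ext: "(\<lambda>i\<in>I. u i) = u" using u by auto
  show "a \<odot>\<^bsub>direct_sum I V\<^esub> u \<in> carrier (direct_sum I V)"
    using ui module.smult_closed[OF assms] by simp
  show "\<zero>\<^bsub>direct_sum I V\<^esub> \<oplus>\<^bsub>direct_sum I V\<^esub> u = u"
    by (subst (2) ext[symmetric], simp, rule restrict_ext) (simp add: abelian_monoid.l_zero[OF mon] ui)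
  show "(a + b) \<odot>\<^bsub>direct_sum I V\<^esub> u =
      (a \<odot>\<^bsub>direct_sum I V\<^esub> u) \<oplus>\<^bsub>direct_sum I V\<^esub> (b \<odot>\<^bsub>direct_sum I V\<^esub> u)"
    using module.smult_l_distr[OF assms, of _ a b] ui by (auto intro!: restrict_ext)
  show "(a * b) \<odot>\<^bsub>direct_sum I V\<^esub> u = a \<odot>\<^bsub>direct_sum I V\<^esub> (b \<odot>\<^bsub>direct_sum I V\<^esub> u)"
    using module.smult_assoc1[OF assms, of _ a b] ui by (auto intro!: restrict_ext)
  show "1 \<odot>\<^bsub>direct_sum I V\<^esub> u = u"
    by (subst (2) ext[symmetric], simp, rule restrict_ext)
      (use module.smult_one[OF assms] ui in simp)
  show "0 \<odot>\<^bsub>direct_sum I V\<^esub> u = \<zero>\<^bsub>direct_sum I V\<^esub>"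
    using module.smult_l_null[OF assms] ui by (auto intro!: restrict_ext)
  assume v: "v \<in> carrier (direct_sum I V)"
  have vi: "v i \<in> carrier (V i)" if "i \<in> I" for i using v that by (auto simp: PiE_iff)
  show "u \<oplus>\<^bsub>direct_sum I V\<^esub> v \<in> carrier (direct_sum I V)"
    using ui vi abelian_monoid.a_closed[OF mon] by simp
  show "u \<oplus>\<^bsub>direct_sum I V\<^esub> v = v \<oplus>\<^bsub>direct_sum I V\<^esub> u"
    using ui vi abelian_monoid.a_comm[OF mon] by (auto intro!: restrict_ext)
  show "a \<odot>\<^bsub>direct_sum I V\<^esub> (u \<oplus>\<^bsub>direct_sum I V\<^esub> v) =
      (a \<odot>\<^bsub>direct_sum I V\<^esub> u) \<oplus>\<^bsub>direct_sum I V\<^esub> (a \<odot>\<^bsub>direct_sum I V\<^esub> v)"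
    using module.smult_r_distr[OF assms, of _ a] ui vi by (auto intro!: restrict_ext)
  assume w: "w \<in> carrier (direct_sum I V)"
  have wi: "w i \<in> carrier (V i)" if "i \<in> I" for i using w that by (auto simp: PiE_iff)
  show "(u \<oplus>\<^bsub>direct_sum I V\<^esub> v) \<oplus>\<^bsub>direct_sum I V\<^esub> w =
      u \<oplus>\<^bsub>direct_sum I V\<^esub> (v \<oplus>\<^bsub>direct_sum I V\<^esub> w)"
    using ui vi wi abelian_monoid.a_assoc[OF mon] by (auto intro!: restrict_ext)
next
  show "\<zero>\<^bsub>direct_sum I V\<^esub> \<in> carrier (direct_sum I V)"
    using abelian_monoid.zero_closed[OF abelian_group.axioms(1)[OF module.axioms(2)[OF assms]]] by simp
qed

section \<open>Antisymmetrizing tabloids over a column stabilizer\<close>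

text \<open>Induction by removing the maximum m: since A lies in \<open>{..m}\<close>, n + 1
  distinct numbers have m at least n, and equality of the sums forces m = n.\<close>

lemma
  fixes A :: "nat set"
  assumes "finite A"
  shows sum_lessThan_card_le: "\<Sum>{..<card A} \<le> \<Sum>A"
    and sum_lessThan_card_eqD: "\<Sum>A = \<Sum>{..<card A} \<Longrightarrow> A = {..<card A}"
proof -
  have "\<Sum>{..<n} \<le> \<Sum>A \<and> (\<Sum>A = \<Sum>{..<n} \<longrightarrow> A = {..<n})" if "finite A" "card A = n" for n A
    using that
  proof (induction n arbitrary: A)
    case (Suc n)
    define m where "m = Max A"
    have A: "A \<noteq> {}" "finite A" using Suc.prems by auto
    have m: "m \<in> A" "A \<subseteq> {..m}" using A by (auto simp: m_def)
    have "card A \<le> card {..m}" using m(2) by (intro card_mono) auto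
    then have nm: "n \<le> m" using Suc.prems by simp
    have IH: "\<Sum>{..<n} \<le> \<Sum>(A - {m})" using Suc.IH[of "A - {m}"] Suc.prems m(1) by simp
    have s: "\<Sum>A = m + \<Sum>(A - {m})" using A m(1) by (simp add: sum.remove)
    have "A = {..<Suc n}" if "\<Sum>A = \<Sum>{..<Suc n}"
    proof (rule card_subset_eq)
      have "m \<le> n" using that s IH by simp
      then show "A \<subseteq> {..<Suc n}" using m(2) by auto
    qed (use Suc.prems in auto)
    with nm IH s show ?case by simp
  qed simp
  with assms show "\<Sum>{..<card A} \<le> \<Sum>A" "\<Sum>A = \<Sum>{..<card A} \<Longrightarrow> A = {..<card A}" by blast+
qed

lemma diagram_Sigma: "diagram p = (SIGMA i:{..<length p}. {..<p ! i})"
  by (auto simp: diagram_def)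

lemma finite_diagram: "finite (diagram p)"
  unfolding diagram_Sigma by blast

text \<open>
  The rows of \<open>s\<close> have the same lengths as those of \<open>t\<close>, and the sum of all column indices is
  the same for both, so the minimality of $0 + \dots + (m - 1)$ among the sums of \<open>m\<close> distinct
  numbers makes every row of column indices an initial segment.
\<close>

lemma columns_fill_rows:
  assumes t: "t \<in> tableaux n p" and s: "s \<in> tableaux n p"
    and inj: "\<And>i. i < length p \<Longrightarrow> inj_on (\<lambda>j. snd (inv_into (diagram p) t (s (i, j)))) {..<p ! i}"
    and i: "i < length p"
  shows "(\<lambda>j. snd (inv_into (diagram p) t (s (i, j)))) ` {..<p ! i} = {..<p ! i}"
proof -
  define c where "c k = snd (inv_into (diagram p) t k)" for k
  have bt: "bij_betw t (diagram p) {1..n}" and bs: "bij_betw s (diagram p) {1..n}"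
    using t s by (auto simp: tableaux_def)
  have "(\<Sum>i<length p. \<Sum>j<p ! i. c (s (i, j))) = (\<Sum>b\<in>diagram p. c (s b))"
    unfolding diagram_Sigma by (subst sum.Sigma) (auto simp: case_prod_beta)
  also have "\<dots> = (\<Sum>k\<in>{1..n}. c k)" by (rule sum.reindex_bij_betw[OF bs])
  also have "\<dots> = (\<Sum>b\<in>diagram p. c (t b))" by (rule sum.reindex_bij_betw[OF bt, symmetric])
  also have "\<dots> = (\<Sum>b\<in>diagram p. snd b)"
    using bij_betw_inv_into_left[OF bt] by (intro sum.cong) (auto simp: c_def)
  also have "\<dots> = (\<Sum>i<length p. \<Sum>{..<p ! i})"
    unfolding diagram_Sigma by (subst sum.Sigma) (auto simp: case_prod_beta)
  finally have eq: "(\<Sum>i<length p. \<Sum>{..<p ! i}) = (\<Sum>i<length p. \<Sum>j<p ! i. c (s (i, j)))" by simp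
  define A where "A i = (\<lambda>j. c (s (i, j))) ` {..<p ! i}" for i
  have A: "finite (A i)" "card (A i) = p ! i" "\<Sum>(A i) = (\<Sum>j<p ! i. c (s (i, j)))" if "i < length p" for i
    using inj[OF that] by (auto simp: A_def c_def card_image sum.reindex)
  have "\<Sum>{..<p ! i} = (\<Sum>j<p ! i. c (s (i, j)))"
  proof (rule sum_mono_inv[OF eq])
    fix i assume "i \<in> {..<length p}"
    then show "\<Sum>{..<p ! i} \<le> (\<Sum>j<p ! i. c (s (i, j)))"
      using A[of i] sum_lessThan_card_le[of "A i"] by simp
  qed (use i in auto)
  then have "A i = {..<p ! i}"
    using A[OF i] sum_lessThan_card_eqD[of "A i"] by simp
  then show ?thesis by (simp add: A_def c_def)
qed

lemma inv_into_comp_permutes: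
  assumes "t \<in> tableaux n p" "\<pi> permutes {1..n}" "k \<in> {1..n}"
  shows "inv_into (diagram p) (\<pi> \<circ> t) (\<pi> k) = inv_into (diagram p) t k"
proof -
  have bt: "bij_betw t (diagram p) {1..n}" using assms by (simp add: tableaux_def)
  have bpt: "bij_betw (\<pi> \<circ> t) (diagram p) {1..n}"
    using bt permutes_imp_bij[OF assms(2)] by (rule bij_betw_trans)
  have "inv_into (diagram p) t k \<in> diagram p"
    using bt assms(3) by (metis bij_betw_imp_surj_on inv_into_into)
  then show ?thesis
    using bij_betw_inv_into_left[OF bpt] bij_betw_inv_into_right[OF bt assms(3)] by fastforce
qed

lemma tableaux_permute: "t \<in> tableaux n p \<Longrightarrow> \<pi> permutes {1..n} \<Longrightarrow> \<pi> \<circ> t \<in> tableaux n p"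
  by (auto simp: tableaux_def intro: bij_betw_trans permutes_imp_bij)

text \<open>A tabloid is a function of the entries, so relabelling the entries by \<pi> precomposes
  it with the inverse of \<pi>. Moving \<pi> to the other side keeps the inverse out of the
  formula.\<close>

lemma tabloid_of_permute:
  assumes "t \<in> tableaux n p" "\<pi> permutes {1..n}"
  shows "tabloid_of n p (\<pi> \<circ> t) \<circ> \<pi> = tabloid_of n p t"
proof
  fix k
  show "(tabloid_of n p (\<pi> \<circ> t) \<circ> \<pi>) k = tabloid_of n p t k"
    using inv_into_comp_permutes[OF assms, of k] permutes_in_image[OF assms(2), of k]
    by (auto simp: tabloid_of_def restrict_def)
qed

lemma comp_permutes_eq_iff:
  assumes "\<pi> permutes S" shows "f \<circ> \<pi> = g \<circ> \<pi> \<longleftrightarrow> f = g"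
  using permutes_inv_o(1)[OF assms] by (metis comp_assoc comp_id)

section \<open>The column stabilizer as a group, and its signed sum\<close>

lemma column_stabilizerD:
  assumes "\<pi> \<in> column_stabilizer n p t"
  shows "\<pi> permutes {1..n}"
    and "k \<in> {1..n} \<Longrightarrow> snd (inv_into (diagram p) t (\<pi> k)) = snd (inv_into (diagram p) t k)"
  using assms by (auto simp: column_stabilizer_def)

lemma finite_column_stabilizer: "finite (column_stabilizer n p t)"
  by (rule finite_subset[OF _ finite_permutations[of "{1..n}"]]) (auto simp: column_stabilizer_def)

lemma id_in_column_stabilizer: "id \<in> column_stabilizer n p t"
  by (auto simp: column_stabilizer_def permutes_id)

lemma column_stabilizer_comp:
  assumes \<pi>: "\<pi> \<in> column_stabilizer n p t" and \<sigma>: "\<sigma> \<in> column_stabilizer n p t"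
  shows "\<pi> \<circ> \<sigma> \<in> column_stabilizer n p t"
proof -
  have "\<sigma> k \<in> {1..n}" if "k \<in> {1..n}" for k
    using that permutes_in_image[OF column_stabilizerD(1)[OF \<sigma>]] by simp
  then show ?thesis
    using column_stabilizerD[OF \<pi>] column_stabilizerD[OF \<sigma>]
    by (auto simp: column_stabilizer_def permutes_compose)
qed

lemma column_stabilizer_inv:
  assumes \<pi>: "\<pi> \<in> column_stabilizer n p t"
  shows "inv' \<pi> \<in> column_stabilizer n p t"
proof -
  note p = column_stabilizerD(1)[OF \<pi>]
  have "snd (inv_into (diagram p) t (inv' \<pi> k)) = snd (inv_into (diagram p) t k)" if k: "k \<in> {1..n}" for k
  proof -
    have "inv' \<pi> k \<in> {1..n}" using k permutes_in_image[OF permutes_inv[OF p]] by simp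
    from column_stabilizerD(2)[OF \<pi> this] show ?thesis by (simp add: permutes_inverses(1)[OF p])
  qed
  then show ?thesis using permutes_inv[OF p] by (simp add: column_stabilizer_def)
qed

lemma permutes_sign_comp:
  "\<pi> permutes {1..n::nat} \<Longrightarrow> \<sigma> permutes {1..n} \<Longrightarrow> sign (\<pi> \<circ> \<sigma>) = sign \<pi> * sign \<sigma>"
  by (intro sign_compose) (auto simp: permutation_permutes)

lemma bij_column_stabilizer_comp:
  assumes \<sigma>: "\<sigma> \<in> column_stabilizer n p t"
  shows "bij_betw (\<lambda>\<pi>. \<pi> \<circ> \<sigma>) (column_stabilizer n p t) (column_stabilizer n p t)"
proof (rule bij_betw_byWitness[where f' = "\<lambda>\<pi>. \<pi> \<circ> inv' \<sigma>"])
  note p = column_stabilizerD(1)[OF \<sigma>]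
  show "\<forall>\<pi>\<in>column_stabilizer n p t. \<pi> \<circ> \<sigma> \<circ> inv' \<sigma> = \<pi>"
    "\<forall>\<pi>\<in>column_stabilizer n p t. \<pi> \<circ> inv' \<sigma> \<circ> \<sigma> = \<pi>"
    by (simp_all add: comp_assoc permutes_inv_o[OF p])
qed (use column_stabilizer_comp column_stabilizer_inv \<sigma> in blast)+

text \<open>The signed column sum of t as an operator, with \<pi> acting as in
  \<open>specht_action\<close>. It accepts any function, so it can be evaluated on the tabloids of
  other tableaux.\<close>

definition column_antisym ::
    "nat \<Rightarrow> nat list \<Rightarrow> (nat \<times> nat \<Rightarrow> nat) \<Rightarrow> ((nat \<Rightarrow> nat) \<Rightarrow> complex) \<Rightarrow> (nat \<Rightarrow> nat) \<Rightarrow> complex" where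
  "column_antisym n p t F = (\<lambda>r. \<Sum>\<pi>\<in>column_stabilizer n p t. of_int (sign \<pi>) * F (r \<circ> \<pi>))"

lemma polytabloid_eq_antisym:
  assumes "t \<in> tableaux n p"
  shows "polytabloid n p t = column_antisym n p t (basis_elem (tabloid_of n p t))"
proof
  fix r
  have "basis_elem (tabloid_of n p (\<pi> \<circ> t)) r = basis_elem (tabloid_of n p t) (r \<circ> \<pi>)"
    if "\<pi> \<in> column_stabilizer n p t" for \<pi>
    using tabloid_of_permute[OF assms] column_stabilizerD(1)[OF that] comp_permutes_eq_iff
    unfolding basis_elem_def by metis
  then show "polytabloid n p t r = column_antisym n p t (basis_elem (tabloid_of n p t)) r"
    unfolding polytabloid_def column_antisym_def by (intro sum.cong) auto
qed

text \<open>Substituting \<open>\<pi> \<circ> \<sigma>\<close> for \<pi> in the sum over the group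
  pulls out the sign, and \<sigma> cancels from both arguments of \<open>basis_elem\<close>.\<close>

lemma column_antisym_precomp:
  assumes \<sigma>: "\<sigma> \<in> column_stabilizer n p t"
  shows "column_antisym n p t (basis_elem (x \<circ> \<sigma>)) r =
    of_int (sign \<sigma>) * column_antisym n p t (basis_elem x) r"
proof -
  note p = column_stabilizerD(1)[OF \<sigma>]
  have "column_antisym n p t (basis_elem (x \<circ> \<sigma>)) r =
    (\<Sum>\<pi>\<in>column_stabilizer n p t. of_int (sign (\<pi> \<circ> \<sigma>)) * basis_elem (x \<circ> \<sigma>) (r \<circ> (\<pi> \<circ> \<sigma>)))"
    unfolding column_antisym_def by (rule sum.reindex_bij_betw[OF bij_column_stabilizer_comp[OF \<sigma>], symmetric])
  also have "\<dots> = (\<Sum>\<pi>\<in>column_stabilizer n p t. of_int (sign \<sigma>) * (of_int (sign \<pi>) * basis_elem x (r \<circ> \<pi>)))"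
  proof (rule sum.cong[OF refl])
    fix \<pi> assume "\<pi> \<in> column_stabilizer n p t"
    then have "sign (\<pi> \<circ> \<sigma>) = sign \<pi> * sign \<sigma>" using permutes_sign_comp p column_stabilizerD(1) by blast
    moreover have "basis_elem (x \<circ> \<sigma>) (r \<circ> (\<pi> \<circ> \<sigma>)) = basis_elem x (r \<circ> \<pi>)"
      unfolding basis_elem_def o_assoc comp_permutes_eq_iff[OF p] ..
    ultimately show "of_int (sign (\<pi> \<circ> \<sigma>)) * basis_elem (x \<circ> \<sigma>) (r \<circ> (\<pi> \<circ> \<sigma>)) =
      of_int (sign \<sigma>) * (of_int (sign \<pi>) * basis_elem x (r \<circ> \<pi>))" by simp
  qed
  finally show ?thesis by (simp add: column_antisym_def sum_distrib_left)
qed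

text \<open>A dichotomy: if two entries share a row of x and a column of t, their transposition
  fixes x and reverses the sign, so the result is zero. Otherwise the counting in
  \<open>columns_fill_rows\<close> makes x a column permutation of the tabloid of t, and the result
  is a sign times the polytabloid.\<close>

lemma column_antisym_tabloid:
  assumes t: "t \<in> tableaux n p" and x: "x \<in> tabloids n p"
  shows "\<exists>c. \<forall>r. column_antisym n p t (basis_elem x) r = c * polytabloid n p t r"
proof -
  define c where "c k = snd (inv_into (diagram p) t k)" for k
  have bt: "bij_betw t (diagram p) {1..n}" using t by (simp add: tableaux_def)
  obtain s where s: "s \<in> tableaux n p" and xs: "x = tabloid_of n p s" using x by (auto simp: tabloids_def)
  have bs: "bij_betw s (diagram p) {1..n}" using s by (simp add: tableaux_def)
  show ?thesis
  proof (cases "\<exists>a\<in>{1..n}. \<exists>b\<in>{1..n}. a \<noteq> b \<and> c a = c b \<and> x a = x b")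
    case True
    then obtain a b where ab: "a \<in> {1..n}" "b \<in> {1..n}" "a \<noteq> b" "c a = c b" "x a = x b" by blast
    define \<tau> where "\<tau> = transpose a b"
    have "\<tau> \<in> column_stabilizer n p t"
      using ab by (auto simp: column_stabilizer_def \<tau>_def permutes_swap_id c_def transpose_def)
    moreover have "x \<circ> \<tau> = x" using ab by (auto simp: \<tau>_def transpose_def fun_eq_iff)
    moreover have "sign \<tau> = -1" using ab by (simp add: \<tau>_def sign_swap_id)
    ultimately have "column_antisym n p t (basis_elem x) r = - column_antisym n p t (basis_elem x) r" for r
      using column_antisym_precomp[of \<tau> n p t x r] by simp
    then show ?thesis by (intro exI[of _ 0]) simp
  next
    case False
    have x_s: "x (s (i, j)) = i" "s (i, j) \<in> {1..n}" if "(i, j) \<in> diagram p" for i j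
    proof -
      show "s (i, j) \<in> {1..n}" using bs that bij_betwE by fastforce
      then show "x (s (i, j)) = i"
        using bij_betw_inv_into_left[OF bs that] by (simp add: xs tabloid_of_def)
    qed
    have inj: "inj_on (\<lambda>j. snd (inv_into (diagram p) t (s (i, j)))) {..<p ! i}" if i: "i < length p" for i
    proof (rule inj_onI)
      fix j j' assume "j \<in> {..<p ! i}" "j' \<in> {..<p ! i}"
        and eq: "snd (inv_into (diagram p) t (s (i, j))) = snd (inv_into (diagram p) t (s (i, j')))"
      then have d: "(i, j) \<in> diagram p" "(i, j') \<in> diagram p" using i by (auto simp: diagram_def)
      then have "s (i, j) = s (i, j')" using False x_s eq unfolding c_def by metis
      then show "j = j'" using d bs by (auto dest: bij_betw_imp_inj_on inj_onD)
    qed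
    \<comment> \<open>Row i of s meets exactly the first \<open>p ! i\<close> columns of t, so the
      row of k in x and its column in t are the coordinates of an actual box.\<close>
    have dg: "(x k, c k) \<in> diagram p" if k: "k \<in> {1..n}" for k
    proof -
      obtain i j where ij: "(i, j) \<in> diagram p" "k = s (i, j)"
        using bs k by (metis bij_betw_imp_surj_on imageE surj_pair)
      then have "i < length p" "j < p ! i" by (auto simp: diagram_def)
      then have "c k \<in> {..<p ! i}" using columns_fill_rows[OF t s inj] ij unfolding c_def by blast
      then show ?thesis using ij x_s \<open>i < length p\<close> by (simp add: diagram_def)
    qed
    \<comment> \<open>The entry of t in the row that k has in x and the column that k has in t.
      Hence \<sigma> preserves the columns of t, and the row of \<open>\<sigma> k\<close> in t is
      \<open>x k\<close>.\<close>
    define \<sigma> where "\<sigma> k = (if k \<in> {1..n} then t (x k, c k) else k)" for k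
    have \<sigma>_in: "\<sigma> k \<in> {1..n}" if "k \<in> {1..n}" for k
      using dg[OF that] that bt bij_betwE by (fastforce simp: \<sigma>_def)
    have inv\<sigma>: "inv_into (diagram p) t (\<sigma> k) = (x k, c k)" if "k \<in> {1..n}" for k
      using that dg[OF that] bij_betw_inv_into_left[OF bt] by (simp add: \<sigma>_def)
    have "inj_on \<sigma> {1..n}"
      using False inv\<sigma> by (intro inj_onI) (metis Pair_inject)
    then have "bij_betw \<sigma> {1..n} {1..n}"
      using endo_inj_surj[of "{1..n}" \<sigma>] \<sigma>_in unfolding bij_betw_def by blast
    then have perm: "\<sigma> permutes {1..n}" by (rule bij_imp_permutes) (simp add: \<sigma>_def del: atLeastAtMost_iff)
    have "\<sigma> \<in> column_stabilizer n p t" using perm inv\<sigma> by (simp add: column_stabilizer_def c_def)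
    moreover have "tabloid_of n p t \<circ> \<sigma> = x"
    proof
      fix k
      show "(tabloid_of n p t \<circ> \<sigma>) k = x k"
        using \<sigma>_in[of k] inv\<sigma>[of k] by (cases "k \<in> {1..n}") (auto simp: tabloid_of_def \<sigma>_def xs)
    qed
    ultimately show ?thesis
      using column_antisym_precomp[of \<sigma> n p t "tabloid_of n p t"] polytabloid_eq_antisym[OF t] by auto
  qed
qed

text \<open>A permutation that preserves both the row and the column of every entry of t is the
  identity, so only one term of the sum survives. This is the source of nonzero vectors.\<close>

lemma polytabloid_tabloid_of:
  assumes t: "t \<in> tableaux n p"
  shows "polytabloid n p t (tabloid_of n p t) = 1"
proof -
  have bt: "bij_betw t (diagram p) {1..n}" using t by (simp add: tableaux_def)
  have "basis_elem (tabloid_of n p t) (tabloid_of n p t \<circ> \<pi>) = (if \<pi> = id then 1 else 0)"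
    if \<pi>: "\<pi> \<in> column_stabilizer n p t" for \<pi>
  proof -
    have "\<pi> = id" if eq: "tabloid_of n p t \<circ> \<pi> = tabloid_of n p t"
    proof
      fix k
      show "\<pi> k = id k"
      proof (cases "k \<in> {1..n}")
        case True
        then have \<pi>k: "\<pi> k \<in> {1..n}" using permutes_in_image[OF column_stabilizerD(1)[OF \<pi>]] by simp
        have "inv_into (diagram p) t (\<pi> k) = inv_into (diagram p) t k"
          using column_stabilizerD(2)[OF \<pi> True] fun_cong[OF eq, of k] True \<pi>k
          by (intro prod_eqI) (auto simp: tabloid_of_def)
        then show ?thesis using bij_betw_inv_into_right[OF bt] True \<pi>k by (metis id_apply)
      next
        case False
        then show ?thesis using permutes_not_in[OF column_stabilizerD(1)[OF \<pi>]] by simp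
      qed
    qed
    then show ?thesis by (auto simp: basis_elem_def)
  qed
  then have "polytabloid n p t (tabloid_of n p t) =
      (\<Sum>\<pi>\<in>column_stabilizer n p t. if \<pi> = id then of_int (sign \<pi>) else 0)"
    unfolding polytabloid_eq_antisym[OF t] column_antisym_def by (intro sum.cong) auto
  then show ?thesis by (simp add: finite_column_stabilizer id_in_column_stabilizer)
qed

text \<open>The signed column sum is symmetric for the pairing in which tabloids are orthonormal,
  because inversion permutes the stabilizer and keeps signs. Evaluation at the tabloid of t thus
  becomes pairing with the polytabloid.\<close>

lemma column_antisym_at_tabloid:
  assumes t: "t \<in> tableaux n p"
  shows "column_antisym n p t (basis_elem x) (tabloid_of n p t) = polytabloid n p t x"
proof -
  have bij: "bij_betw inv' (column_stabilizer n p t) (column_stabilizer n p t)"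
    by (rule bij_betw_byWitness[where f' = inv'])
      (use column_stabilizer_inv column_stabilizerD(1) permutes_inv_inv in blast)+
  have "column_antisym n p t (basis_elem x) (tabloid_of n p t) =
    (\<Sum>\<pi>\<in>column_stabilizer n p t. of_int (sign (inv' \<pi>)) * basis_elem x (tabloid_of n p t \<circ> inv' \<pi>))"
    unfolding column_antisym_def by (rule sum.reindex_bij_betw[OF bij, symmetric])
  also have "\<dots> = (\<Sum>\<pi>\<in>column_stabilizer n p t. of_int (sign \<pi>) * basis_elem (tabloid_of n p t) (x \<circ> \<pi>))"
  proof (rule sum.cong[OF refl])
    fix \<pi> assume "\<pi> \<in> column_stabilizer n p t"
    then have p: "\<pi> permutes {1..n}" by (rule column_stabilizerD)
    have "sign (inv' \<pi>) = sign \<pi>" using p by (intro sign_inverse) (auto simp: permutation_permutes)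
    moreover have "tabloid_of n p t \<circ> inv' \<pi> = x \<longleftrightarrow> x \<circ> \<pi> = tabloid_of n p t"
      using comp_permutes_eq_iff[OF p, of "tabloid_of n p t \<circ> inv' \<pi>" x]
      by (auto simp: comp_assoc permutes_inv_o[OF p])
    ultimately show "of_int (sign (inv' \<pi>)) * basis_elem x (tabloid_of n p t \<circ> inv' \<pi>) =
      of_int (sign \<pi>) * basis_elem (tabloid_of n p t) (x \<circ> \<pi>)" by (simp add: basis_elem_def)
  qed
  finally show ?thesis unfolding polytabloid_eq_antisym[OF t] column_antisym_def .
qed

section \<open>Equivariance of polytabloids and transitivity on them\<close>

lemma column_stabilizer_permute:
  assumes t: "t \<in> tableaux n p" and \<pi>: "\<pi> permutes {1..n}"
    and \<tau>: "\<tau> \<in> column_stabilizer n p t"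
  shows "\<pi> \<circ> \<tau> \<circ> inv' \<pi> \<in> column_stabilizer n p (\<pi> \<circ> t)"
proof -
  have "snd (inv_into (diagram p) (\<pi> \<circ> t) (\<pi> (\<tau> (inv' \<pi> k)))) = snd (inv_into (diagram p) (\<pi> \<circ> t) k)"
    if k: "k \<in> {1..n}" for k
  proof -
    have 1: "inv' \<pi> k \<in> {1..n}" using k permutes_in_image[OF permutes_inv[OF \<pi>]] by simp
    then have 2: "\<tau> (inv' \<pi> k) \<in> {1..n}" using permutes_in_image[OF column_stabilizerD(1)[OF \<tau>]] by simp
    have "snd (inv_into (diagram p) (\<pi> \<circ> t) (\<pi> (\<tau> (inv' \<pi> k)))) = snd (inv_into (diagram p) t (inv' \<pi> k))"
      unfolding inv_into_comp_permutes[OF t \<pi> 2] by (rule column_stabilizerD(2)[OF \<tau> 1])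
    also have "\<dots> = snd (inv_into (diagram p) (\<pi> \<circ> t) (\<pi> (inv' \<pi> k)))"
      unfolding inv_into_comp_permutes[OF t \<pi> 1] ..
    finally show ?thesis by (simp add: permutes_inverses[OF \<pi>])
  qed
  then show ?thesis
    using permutes_compose[OF permutes_compose[OF permutes_inv[OF \<pi>] column_stabilizerD(1)[OF \<tau>]] \<pi>]
    by (simp add: column_stabilizer_def comp_assoc)
qed

text \<open>Conjugation by \<pi> carries the column stabilizer of t onto that of
  \<open>\<pi> \<circ> t\<close> and preserves signs; the defining sum is reindexed along
  it.\<close>

lemma specht_action_polytabloid:
  assumes t: "t \<in> tableaux n p" and \<pi>: "\<pi> permutes {1..n}"
  shows "specht_action \<pi> (polytabloid n p t) = polytabloid n p (\<pi> \<circ> t)"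
proof
  fix r
  have t': "\<pi> \<circ> t \<in> tableaux n p" using t \<pi> by (rule tableaux_permute)
  have inv: "inv' \<pi> permutes {1..n}" using \<pi> by (rule permutes_inv)
  have bij: "bij_betw (\<lambda>\<tau>. \<pi> \<circ> \<tau> \<circ> inv' \<pi>) (column_stabilizer n p t) (column_stabilizer n p (\<pi> \<circ> t))"
  proof (rule bij_betw_byWitness[where f' = "\<lambda>\<tau>. inv' \<pi> \<circ> \<tau> \<circ> \<pi>"])
    show "(\<lambda>\<tau>. inv' \<pi> \<circ> \<tau> \<circ> \<pi>) ` column_stabilizer n p (\<pi> \<circ> t) \<subseteq> column_stabilizer n p t"
      using column_stabilizer_permute[OF t' inv] by (auto simp: o_assoc permutes_inv_o[OF \<pi>] permutes_inv_inv[OF \<pi>])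
    have "inv' \<pi> \<circ> (\<pi> \<circ> \<tau> \<circ> inv' \<pi>) \<circ> \<pi> = (inv' \<pi> \<circ> \<pi>) \<circ> \<tau> \<circ> (inv' \<pi> \<circ> \<pi>)"
      "\<pi> \<circ> (inv' \<pi> \<circ> \<tau> \<circ> \<pi>) \<circ> inv' \<pi> = (\<pi> \<circ> inv' \<pi>) \<circ> \<tau> \<circ> (\<pi> \<circ> inv' \<pi>)" for \<tau>
      by (simp_all add: o_assoc)
    then show "\<forall>\<tau>\<in>column_stabilizer n p t. inv' \<pi> \<circ> (\<pi> \<circ> \<tau> \<circ> inv' \<pi>) \<circ> \<pi> = \<tau>"
      "\<forall>\<tau>\<in>column_stabilizer n p (\<pi> \<circ> t). \<pi> \<circ> (inv' \<pi> \<circ> \<tau> \<circ> \<pi>) \<circ> inv' \<pi> = \<tau>"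
      by (simp_all add: permutes_inv_o[OF \<pi>])
  qed (use column_stabilizer_permute[OF t \<pi>] in blast)
  have "polytabloid n p (\<pi> \<circ> t) r = (\<Sum>\<tau>\<in>column_stabilizer n p t.
      of_int (sign (\<pi> \<circ> \<tau> \<circ> inv' \<pi>)) * basis_elem (tabloid_of n p (\<pi> \<circ> t)) (r \<circ> (\<pi> \<circ> \<tau> \<circ> inv' \<pi>)))"
    unfolding polytabloid_eq_antisym[OF t'] column_antisym_def
    by (rule sum.reindex_bij_betw[OF bij, symmetric])
  also have "\<dots> = (\<Sum>\<tau>\<in>column_stabilizer n p t. of_int (sign \<tau>) * basis_elem (tabloid_of n p t) (r \<circ> \<pi> \<circ> \<tau>))"
  proof (rule sum.cong[OF refl])
    fix \<tau> assume "\<tau> \<in> column_stabilizer n p t"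
    then have \<tau>: "\<tau> permutes {1..n}" by (rule column_stabilizerD)
    have "sign (\<pi> \<circ> \<tau> \<circ> inv' \<pi>) = sign \<pi> * sign \<tau> * sign (inv' \<pi>)"
      using permutes_sign_comp \<pi> \<tau> inv permutes_compose by metis
    also have "sign (inv' \<pi>) = sign \<pi>" using \<pi> by (intro sign_inverse) (auto simp: permutation_permutes)
    also have "sign \<pi> * sign \<tau> * sign \<pi> = sign \<tau>" using sign_idempotent[of \<pi>] by (simp add: mult_ac)
    finally have "sign (\<pi> \<circ> \<tau> \<circ> inv' \<pi>) = sign \<tau>" .
    moreover have "r \<circ> (\<pi> \<circ> \<tau> \<circ> inv' \<pi>) = tabloid_of n p (\<pi> \<circ> t) \<longleftrightarrow> r \<circ> \<pi> \<circ> \<tau> = tabloid_of n p t"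
      using comp_permutes_eq_iff[OF \<pi>, of "r \<circ> (\<pi> \<circ> \<tau> \<circ> inv' \<pi>)" "tabloid_of n p (\<pi> \<circ> t)"]
      by (simp add: tabloid_of_permute[OF t \<pi>] comp_assoc permutes_inv_o[OF \<pi>])
    ultimately show "of_int (sign (\<pi> \<circ> \<tau> \<circ> inv' \<pi>)) * basis_elem (tabloid_of n p (\<pi> \<circ> t)) (r \<circ> (\<pi> \<circ> \<tau> \<circ> inv' \<pi>)) =
      of_int (sign \<tau>) * basis_elem (tabloid_of n p t) (r \<circ> \<pi> \<circ> \<tau>)" by (simp add: basis_elem_def)
  qed
  finally show "specht_action \<pi> (polytabloid n p t) r = polytabloid n p (\<pi> \<circ> t) r"
    unfolding specht_action_def polytabloid_eq_antisym[OF t] column_antisym_def by simp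
qed

lemma inv_into_cong_on:
  assumes "\<And>x. x \<in> A \<Longrightarrow> f x = g x" shows "inv_into A f = inv_into A g"
  unfolding inv_into_def using assms by (auto intro!: ext arg_cong[of _ _ Eps])

text \<open>Tableaux are total functions with arbitrary values outside the diagram, so two of them
  can represent the same filling. \<open>polytabloid_transitive\<close> obtains its permutation only
  up to this ambiguity.\<close>

lemma polytabloid_cong:
  assumes t: "t \<in> tableaux n p" and t': "t' \<in> tableaux n p" and eq: "\<And>b. b \<in> diagram p \<Longrightarrow> t b = t' b"
  shows "polytabloid n p t = polytabloid n p t'"
proof -
  have "inv_into (diagram p) t = inv_into (diagram p) t'" using eq by (rule inv_into_cong_on)
  then show ?thesis
    unfolding polytabloid_eq_antisym[OF t] polytabloid_eq_antisym[OF t'] column_antisym_def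
      column_stabilizer_def tabloid_of_def by simp
qed

lemma polytabloid_transitive:
  assumes t: "t \<in> tableaux n p" and t': "t' \<in> tableaux n p"
  obtains \<pi> where "\<pi> permutes {1..n}" "polytabloid n p t' = specht_action \<pi> (polytabloid n p t)"
proof -
  have bt: "bij_betw t (diagram p) {1..n}" and bt': "bij_betw t' (diagram p) {1..n}"
    using t t' by (auto simp: tableaux_def)
  define \<pi> where "\<pi> k = (if k \<in> {1..n} then t' (inv_into (diagram p) t k) else k)" for k
  have "bij_betw (t' \<circ> inv_into (diagram p) t) {1..n} {1..n}"
    using bij_betw_inv_into[OF bt] bt' by (rule bij_betw_trans)
  then have "bij_betw \<pi> {1..n} {1..n}"
    by (subst bij_betw_cong[of _ \<pi> "t' \<circ> inv_into (diagram p) t"]) (auto simp: \<pi>_def)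
  then have \<pi>: "\<pi> permutes {1..n}" by (rule bij_imp_permutes) (simp add: \<pi>_def del: atLeastAtMost_iff)
  have "(\<pi> \<circ> t) b = t' b" if b: "b \<in> diagram p" for b
    using bij_betw_inv_into_left[OF bt b] bij_betwE[OF bt] b by (simp add: \<pi>_def)
  then have "polytabloid n p t' = polytabloid n p (\<pi> \<circ> t)"
    using polytabloid_cong tableaux_permute[OF t \<pi>] t' by metis
  then show ?thesis using that \<pi> specht_action_polytabloid[OF t \<pi>] by simp
qed

lemma tableaux_nonempty:
  assumes "p \<in> partitions n"
  shows "tableaux n p \<noteq> {}"
proof -
  have "card (diagram p) = (\<Sum>i<length p. p ! i)" unfolding diagram_Sigma by simp
  also have "\<dots> = n" using assms by (simp add: partitions_def sum_list_sum_nth lessThan_atLeast0)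
  finally have "\<exists>t. bij_betw t (diagram p) {1..n}"
    using finite_same_card_bij[OF finite_diagram, of "{1..n}" p] by simp
  then show ?thesis by (auto simp: tableaux_def)
qed

lemma finite_tabloids: "finite (tabloids n p)"
proof (rule finite_subset)
  show "tabloids n p \<subseteq> {1..n} \<rightarrow>\<^sub>E {..<length p}"
  proof
    fix x assume "x \<in> tabloids n p"
    then obtain t where t: "bij_betw t (diagram p) {1..n}" "x = tabloid_of n p t"
      by (auto simp: tabloids_def tableaux_def)
    have "inv_into (diagram p) t k \<in> diagram p" if "k \<in> {1..n}" for k
      using that t(1) by (metis bij_betw_imp_surj_on inv_into_into)
    then show "x \<in> {1..n} \<rightarrow>\<^sub>E {..<length p}"
      by (fastforce simp: t(2) tabloid_of_def diagram_def)
  qed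
qed (auto intro: finite_PiE)

section \<open>Simplicity of the external tensor product of Specht modules\<close>

lemma submodule_fun_space_sum:
  assumes "submodule W complex_field (fun_space UNIV)" "\<And>a. a \<in> A \<Longrightarrow> g a \<in> W"
  shows "(\<lambda>r. \<Sum>a\<in>A. g a r) \<in> W"
  using assms(2) by (induction A rule: infinite_finite_induct)
    (use assms(1) in \<open>simp_all add: submodule_fun_space_iff\<close>)

lemma pure_tensor_cong:
  "(\<And>i. i \<in> I \<Longrightarrow> v i = v' i) \<Longrightarrow> pure_tensor I X v = pure_tensor I X v'"
  unfolding pure_tensor_def by (intro ext if_cong prod.cong) auto

text \<open>Isolates the factor at j: x enters only through \<open>x (r j)\<close>, which makes a
  pure tensor visibly linear in that factor.\<close>

lemma pure_tensor_fun_upd: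
  assumes "finite I" "j \<in> I"
  shows "pure_tensor I X (v(j := x)) =
    (\<lambda>r. x (r j) * (if r \<in> Pi\<^sub>E I X then \<Prod>i\<in>I - {j}. v i (r i) else 0))"
proof -
  have "(\<Prod>i\<in>I. (v(j := x)) i (r i)) = x (r j) * (\<Prod>i\<in>I - {j}. v i (r i))" for r
    using prod.remove[OF assms, of "\<lambda>i. (v(j := x)) i (r i)"] by simp
  then show ?thesis unfolding pure_tensor_def by auto
qed

lemma carrier_specht: "carrier (specht n p) = lin_span (fun_space UNIV) (polytabloid n p ` tableaux n p)"
  by (simp add: specht_def)

text \<open>An induction principle: a subspace containing the tensors of polytabloids contains the
  whole tensor product. By multilinearity the polytabloids may be replaced by arbitrary Specht
  vectors one factor at a time; J collects the factors already freed.\<close>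

lemma specht_tensor_subset:
  assumes W: "submodule W complex_field (fun_space UNIV)"
    and poly: "\<And>t. (\<And>i. i \<in> {1..l} \<Longrightarrow> t i \<in> tableaux (lam i) (p i)) \<Longrightarrow>
      pure_tensor {1..l} (\<lambda>i. tabloids (lam i) (p i)) (\<lambda>i. polytabloid (lam i) (p i) (t i)) \<in> W"
  shows "carrier (specht_tensor l lam p) \<subseteq> W"
proof -
  define T where "T = pure_tensor {1..l} (\<lambda>i. tabloids (lam i) (p i))"
  have *: "T v \<in> W" if "finite J" "J \<subseteq> {1..l}" "\<And>i. i \<in> J \<Longrightarrow> v i \<in> carrier (specht (lam i) (p i))"
    "\<And>i. i \<in> {1..l} - J \<Longrightarrow> v i \<in> polytabloid (lam i) (p i) ` tableaux (lam i) (p i)" for J v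
    using that
  proof (induction J arbitrary: v rule: finite_induct)
    case empty
    then have "\<forall>i\<in>{1..l}. \<exists>t. t \<in> tableaux (lam i) (p i) \<and> v i = polytabloid (lam i) (p i) t" by blast
    then obtain t where "\<forall>i\<in>{1..l}. t i \<in> tableaux (lam i) (p i) \<and> v i = polytabloid (lam i) (p i) (t i)"
      by (rule bchoice[THEN exE])
    then show ?case
      using poly[of t] pure_tensor_cong[of "{1..l}" v "\<lambda>i. polytabloid (lam i) (p i) (t i)"]
      unfolding T_def by simp
  next
    case (insert j J)
    \<comment> \<open>The vectors admissible in factor j while the others stay fixed. Linearity in
      that factor makes them a subspace, so the polytabloids span their way to all of the Specht
      module.\<close>
    define Z where "Z = {x. T (v(j := x)) \<in> W}"
    have j: "j \<in> {1..l}" using insert.prems by blast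
    have "submodule Z complex_field (fun_space UNIV)"
      using W unfolding submodule_fun_space_iff Z_def T_def pure_tensor_fun_upd[OF finite_atLeastAtMost j]
      by (auto simp: distrib_right mult.assoc)
    moreover have "polytabloid (lam j) (p j) ` tableaux (lam j) (p j) \<subseteq> Z"
    proof
      fix x assume x: "x \<in> polytabloid (lam j) (p j) ` tableaux (lam j) (p j)"
      have "T (v(j := x)) \<in> W"
      proof (rule insert.IH)
        show "J \<subseteq> {1..l}" using insert.prems by blast
        show "(v(j := x)) i \<in> carrier (specht (lam i) (p i))" if "i \<in> J" for i
          using that insert by auto
        show "(v(j := x)) i \<in> polytabloid (lam i) (p i) ` tableaux (lam i) (p i)" if "i \<in> {1..l} - J" for i
          using that x insert.prems(3)[of i] by (cases "i = j") auto
      qed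
      then show "x \<in> Z" by (simp add: Z_def)
    qed
    ultimately have "carrier (specht (lam j) (p j)) \<subseteq> Z"
      unfolding carrier_specht by (rule lin_span_least)
    then have "v j \<in> Z" using insert.prems(2)[of j] by blast
    then show ?case by (simp add: Z_def)
  qed
  have "T v \<in> W" if "\<forall>i\<in>{1..l}. v i \<in> carrier (specht (lam i) (p i))" for v
    using that by (intro *[of "{1..l}"]) auto
  then show ?thesis
    unfolding specht_tensor_def fun_space_simps by (intro lin_span_least[OF W]) (auto simp: T_def)
qed

lemma submodule_specht_tensor: "submodule (carrier (specht_tensor l lam p)) complex_field (fun_space UNIV)"
  unfolding specht_tensor_def fun_space_simps by (rule lin_span_submodule[OF module_fun_space_UNIV]) simp

lemma polytabloid_tensor_in_specht_tensor:
  assumes "\<And>i. i \<in> {1..l} \<Longrightarrow> t i \<in> tableaux (lam i) (p i)"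
  shows "pure_tensor {1..l} (\<lambda>i. tabloids (lam i) (p i)) (\<lambda>i. polytabloid (lam i) (p i) (t i))
    \<in> carrier (specht_tensor l lam p)"
proof -
  have "\<forall>i\<in>{1..l}. polytabloid (lam i) (p i) (t i) \<in> carrier (specht (lam i) (p i))"
    using assms by (auto simp: carrier_specht intro!: subsetD[OF lin_span_superset])
  then show ?thesis
    unfolding specht_tensor_def fun_space_simps
    by (intro subsetD[OF lin_span_superset] CollectI exI[of _ "\<lambda>i. polytabloid (lam i) (p i) (t i)"]) blast
qed

text \<open>The ambient functions live on all of their type, and \<open>specht_tensor_action\<close>
  truncates to tabloid tuples. Vanishing outside the tuples is what makes the identity act as the
  identity.\<close>

lemma specht_tensor_support:
  assumes "F \<in> carrier (specht_tensor l lam p)" "r \<notin> tabloid_tuples l lam p"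
  shows "F r = 0"
proof -
  have "submodule {F. F r = 0} complex_field (fun_space UNIV)"
    by (simp add: submodule_fun_space_iff)
  moreover have "pure_tensor {1..l} (\<lambda>i. tabloids (lam i) (p i)) v r = 0" for v
    using assms(2) by (simp add: pure_tensor_def tabloid_tuples_def)
  ultimately have "carrier (specht_tensor l lam p) \<subseteq> {F. F r = 0}"
    by (intro specht_tensor_subset) simp_all
  with assms(1) show ?thesis by blast
qed

lemma carrier_young_group:
  "carrier (young_group l lam) = (\<Pi>\<^sub>E i\<in>{1..l}. {\<pi>. \<pi> permutes {1..lam i}})"
  by (simp add: young_group_def sym_group_def)

lemma tabloid_tuples_permute:
  assumes "\<pi> \<in> carrier (young_group l lam)" "r \<in> tabloid_tuples l lam p"
  shows "(\<lambda>i\<in>{1..l}. r i \<circ> \<pi> i) \<in> tabloid_tuples l lam p"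
  using assms tabloids_permute unfolding tabloid_tuples_def carrier_young_group by (simp add: PiE_iff)

text \<open>The preimage of the tensor product is a subspace, and tensors of polytabloids are sent
  to such tensors again.\<close>

lemma specht_tensor_action_closed:
  assumes \<pi>: "\<pi> \<in> carrier (young_group l lam)" and F: "F \<in> carrier (specht_tensor l lam p)"
  shows "specht_tensor_action l lam p \<pi> F \<in> carrier (specht_tensor l lam p)"
proof -
  define W where "W = {F. specht_tensor_action l lam p \<pi> F \<in> carrier (specht_tensor l lam p)}"
  have "(\<lambda>r. if P r then 0 else 0) = (\<lambda>_. 0::complex)"
    "(\<lambda>r. if P r then a r + b r else 0) = (\<lambda>r. (if P r then a r else 0) + (if P r then b r else 0))"
    "(\<lambda>r. if P r then c * a r else 0) = (\<lambda>r. c * (if P r then a r else 0))"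
    for P :: "(nat \<Rightarrow> nat \<Rightarrow> nat) \<Rightarrow> bool" and a b :: "(nat \<Rightarrow> nat \<Rightarrow> nat) \<Rightarrow> complex" and c by auto
  then have "submodule W complex_field (fun_space UNIV)"
    using submodule_specht_tensor[of l lam p]
    unfolding submodule_fun_space_iff W_def specht_tensor_action_def by simp
  moreover have "pure_tensor {1..l} (\<lambda>i. tabloids (lam i) (p i)) (\<lambda>i. polytabloid (lam i) (p i) (t i)) \<in> W"
    if t: "\<And>i. i \<in> {1..l} \<Longrightarrow> t i \<in> tableaux (lam i) (p i)" for t
  proof -
    have p: "\<pi> i permutes {1..lam i}" if "i \<in> {1..l}" for i
      using \<pi> that by (auto simp: carrier_young_group PiE_iff)
    have "pure_tensor {1..l} (\<lambda>i. tabloids (lam i) (p i)) (\<lambda>i. specht_action (\<pi> i) (polytabloid (lam i) (p i) (t i))) =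
      pure_tensor {1..l} (\<lambda>i. tabloids (lam i) (p i)) (\<lambda>i. polytabloid (lam i) (p i) (\<pi> i \<circ> t i))"
      by (rule pure_tensor_cong) (rule specht_action_polytabloid[OF t p])
    also have "\<dots> \<in> carrier (specht_tensor l lam p)"
      by (rule polytabloid_tensor_in_specht_tensor) (rule tableaux_permute[OF t p])
    finally show ?thesis
      unfolding W_def mem_Collect_eq specht_tensor_action_pure[OF \<pi>] .
  qed
  ultimately have "carrier (specht_tensor l lam p) \<subseteq> W" by (rule specht_tensor_subset)
  with F show ?thesis by (auto simp: W_def)
qed

text \<open>Evaluation passes from r to \<open>r \<circ> \<pi>\<close> and then to
  \<open>r \<circ> \<pi> \<circ> \<sigma>\<close> in each factor, so precomposition of the argument
  gives a left action. The truncation is harmless because \<pi> preserves the tabloid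
  tuples.\<close>

lemma specht_tensor_action_comp:
  assumes "\<pi> \<in> carrier (young_group l lam)"
  shows "specht_tensor_action l lam p \<pi> (specht_tensor_action l lam p \<sigma> F) =
    specht_tensor_action l lam p (\<lambda>i\<in>{1..l}. \<pi> i \<circ> \<sigma> i) F"
proof
  fix r :: "nat \<Rightarrow> nat \<Rightarrow> nat"
  have "(\<lambda>i\<in>{1..l}. (\<lambda>i\<in>{1..l}. r i \<circ> \<pi> i) i \<circ> \<sigma> i) = (\<lambda>i\<in>{1..l}. r i \<circ> (\<lambda>i\<in>{1..l}. \<pi> i \<circ> \<sigma> i) i)"
    by (rule restrict_ext) (simp add: comp_assoc)
  then show "specht_tensor_action l lam p \<pi> (specht_tensor_action l lam p \<sigma> F) r =
      specht_tensor_action l lam p (\<lambda>i\<in>{1..l}. \<pi> i \<circ> \<sigma> i) F r"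
    using tabloid_tuples_permute[OF assms, of r p] by (simp add: specht_tensor_action_def)
qed

lemma specht_tensor_action_id:
  assumes "F \<in> carrier (specht_tensor l lam p)"
  shows "specht_tensor_action l lam p (\<lambda>i\<in>{1..l}. id) F = F"
proof
  fix r
  have "(\<lambda>i\<in>{1..l}. r i \<circ> (\<lambda>i\<in>{1..l}. id) i) = r" if "r \<in> tabloid_tuples l lam p"
    using that by (auto simp: tabloid_tuples_def PiE_iff extensional_def)
  then show "specht_tensor_action l lam p (\<lambda>i\<in>{1..l}. id) F r = F r"
    using specht_tensor_support[OF assms] unfolding specht_tensor_action_def by auto
qed

section \<open>The signed column sum of all factors together\<close>

lemma finite_tabloid_tuples: "finite (tabloid_tuples l lam p)"
  unfolding tabloid_tuples_def by (intro finite_PiE finite_tabloids) simp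

lemma basis_elem_pure_tensor:
  assumes x: "x \<in> Pi\<^sub>E I X" and I: "finite I"
  shows "basis_elem x = pure_tensor I X (\<lambda>i. basis_elem (x i))"
proof
  fix r
  show "basis_elem x r = pure_tensor I X (\<lambda>i. basis_elem (x i)) r"
  proof (cases "r = x")
    case True
    then show ?thesis using x by (simp add: basis_elem_def pure_tensor_def)
  next
    case False
    have "(\<Prod>i\<in>I. basis_elem (x i) (r i)) = 0" if r: "r \<in> Pi\<^sub>E I X"
    proof -
      obtain i where "i \<in> I" "r i \<noteq> x i" using PiE_ext[OF r x] False by blast
      then show ?thesis using I by (intro prod_zero bexI[of _ i]) (simp_all add: basis_elem_def)
    qed
    then show ?thesis using False by (simp add: basis_elem_def pure_tensor_def)
  qed
qed

text \<open>The tensor product of the signed column sums, written as a combination of Young group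
  elements so that it visibly preserves invariant subspaces.\<close>

definition tensor_antisym ::
    "nat \<Rightarrow> (nat \<Rightarrow> nat) \<Rightarrow> (nat \<Rightarrow> nat list) \<Rightarrow> (nat \<Rightarrow> nat \<times> nat \<Rightarrow> nat) \<Rightarrow>
     ((nat \<Rightarrow> nat \<Rightarrow> nat) \<Rightarrow> complex) \<Rightarrow> ((nat \<Rightarrow> nat \<Rightarrow> nat) \<Rightarrow> complex)" where
  "tensor_antisym l lam p t F =
     (\<lambda>r. \<Sum>\<pi>\<in>(\<Pi>\<^sub>E i\<in>{1..l}. column_stabilizer (lam i) (p i) (t i)).
        (\<Prod>i\<in>{1..l}. of_int (sign (\<pi> i))) * specht_tensor_action l lam p \<pi> F r)"

lemma column_stabilizers_in_young_group:
  assumes "\<pi> \<in> (\<Pi>\<^sub>E i\<in>{1..l}. column_stabilizer (lam i) (p i) (t i))"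
  shows "\<pi> \<in> carrier (young_group l lam)"
  unfolding carrier_young_group
  by (rule subsetD[OF PiE_mono assms]) (auto dest: column_stabilizerD(1))

text \<open>On pure tensors the group acts factorwise, and the sum over tuples of column
  permutations of a product is the product of the sums (\<open>prod_sum_PiE\<close>).\<close>

lemma tensor_antisym_basis_elem:
  assumes x: "x \<in> tabloid_tuples l lam p"
  shows "tensor_antisym l lam p t (basis_elem x) = pure_tensor {1..l} (\<lambda>i. tabloids (lam i) (p i))
    (\<lambda>i. column_antisym (lam i) (p i) (t i) (basis_elem (x i)))"
proof
  fix r
  let ?C = "\<Pi>\<^sub>E i\<in>{1..l}. column_stabilizer (lam i) (p i) (t i)"
  let ?X = "\<lambda>i. tabloids (lam i) (p i)"
  have "tensor_antisym l lam p t (basis_elem x) r =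
    (\<Sum>\<pi>\<in>?C. (\<Prod>i\<in>{1..l}. of_int (sign (\<pi> i))) *
      pure_tensor {1..l} ?X (\<lambda>i. specht_action (\<pi> i) (basis_elem (x i))) r)"
    unfolding tensor_antisym_def
  proof (rule sum.cong[OF refl])
    fix \<pi> assume "\<pi> \<in> ?C"
    then have "\<pi> \<in> carrier (young_group l lam)" by (rule column_stabilizers_in_young_group)
    then have "specht_tensor_action l lam p \<pi> (basis_elem x) =
        pure_tensor {1..l} ?X (\<lambda>i. specht_action (\<pi> i) (basis_elem (x i)))"
      using basis_elem_pure_tensor[OF x[unfolded tabloid_tuples_def]] specht_tensor_action_pure by simp
    then show "(\<Prod>i\<in>{1..l}. of_int (sign (\<pi> i))) * specht_tensor_action l lam p \<pi> (basis_elem x) r =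
      (\<Prod>i\<in>{1..l}. of_int (sign (\<pi> i))) *
        pure_tensor {1..l} ?X (\<lambda>i. specht_action (\<pi> i) (basis_elem (x i))) r" by simp
  qed
  also have "\<dots> = (if r \<in> Pi\<^sub>E {1..l} ?X then
      (\<Sum>\<pi>\<in>?C. \<Prod>i\<in>{1..l}. of_int (sign (\<pi> i)) * basis_elem (x i) (r i \<circ> \<pi> i)) else 0)"
    by (simp add: pure_tensor_def specht_action_def prod.distrib)
  also have "(\<Sum>\<pi>\<in>?C. \<Prod>i\<in>{1..l}. of_int (sign (\<pi> i)) * basis_elem (x i) (r i \<circ> \<pi> i)) =
      (\<Prod>i\<in>{1..l}. column_antisym (lam i) (p i) (t i) (basis_elem (x i)) (r i))"
    unfolding column_antisym_def by (rule prod_sum_PiE[symmetric]) (auto simp: finite_column_stabilizer)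
  finally show "tensor_antisym l lam p t (basis_elem x) r = pure_tensor {1..l} ?X
      (\<lambda>i. column_antisym (lam i) (p i) (t i) (basis_elem (x i))) r"
    by (simp add: pure_tensor_def)
qed

text \<open>The action reads F only at tabloid tuples, which are finite in number, so F may be
  expanded in their basis elements.\<close>

lemma tensor_antisym_expand:
  "tensor_antisym l lam p t F r =
    (\<Sum>x\<in>tabloid_tuples l lam p. F x * tensor_antisym l lam p t (basis_elem x) r)"
proof -
  let ?C = "\<Pi>\<^sub>E i\<in>{1..l}. column_stabilizer (lam i) (p i) (t i)" and ?X = "tabloid_tuples l lam p"
  let ?s = "\<lambda>\<pi>. \<Prod>i\<in>{1..l}. of_int (sign (\<pi> i)) :: complex"
  have "specht_tensor_action l lam p \<pi> F r = (\<Sum>x\<in>?X. F x * specht_tensor_action l lam p \<pi> (basis_elem x) r)"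
    if \<pi>: "\<pi> \<in> ?C" for \<pi>
  proof (cases "r \<in> ?X")
    case True
    define r' where "r' = (\<lambda>i\<in>{1..l}. r i \<circ> \<pi> i)"
    have "r' \<in> ?X"
      unfolding r'_def by (rule tabloid_tuples_permute[OF column_stabilizers_in_young_group[OF \<pi>] True])
    then have "F r' = (\<Sum>x\<in>?X. if x = r' then F x else 0)" using finite_tabloid_tuples by simp
    also have "\<dots> = (\<Sum>x\<in>?X. F x * basis_elem x r')" by (intro sum.cong) (auto simp: basis_elem_def)
    finally show ?thesis using True by (simp add: specht_tensor_action_def r'_def)
  qed (simp add: specht_tensor_action_def)
  then have "tensor_antisym l lam p t F r =
    (\<Sum>\<pi>\<in>?C. \<Sum>x\<in>?X. F x * (?s \<pi> * specht_tensor_action l lam p \<pi> (basis_elem x) r))"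
    unfolding tensor_antisym_def by (intro sum.cong refl) (simp add: sum_distrib_left mult_ac)
  also have "\<dots> = (\<Sum>x\<in>?X. \<Sum>\<pi>\<in>?C. F x * (?s \<pi> * specht_tensor_action l lam p \<pi> (basis_elem x) r))"
    by (rule sum.swap)
  finally show ?thesis by (simp add: tensor_antisym_def sum_distrib_left)
qed

text \<open>The operator has rank at most one: on a basis element the constants of the factors from
  \<open>column_antisym_tabloid\<close> multiply, and for general F these products are combined
  linearly.\<close>

lemma tensor_antisym_multiple:
  assumes t: "\<And>i. i \<in> {1..l} \<Longrightarrow> t i \<in> tableaux (lam i) (p i)"
  shows "\<exists>c. tensor_antisym l lam p t F = (\<lambda>r. c *
    pure_tensor {1..l} (\<lambda>i. tabloids (lam i) (p i)) (\<lambda>i. polytabloid (lam i) (p i) (t i)) r)"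
proof -
  let ?X = "tabloid_tuples l lam p"
  let ?e = "pure_tensor {1..l} (\<lambda>i. tabloids (lam i) (p i)) (\<lambda>i. polytabloid (lam i) (p i) (t i))"
  have "\<exists>c. \<forall>r. tensor_antisym l lam p t (basis_elem x) r = c * ?e r" if x: "x \<in> ?X" for x
  proof -
    have "\<forall>i\<in>{1..l}. \<exists>c. \<forall>r. column_antisym (lam i) (p i) (t i) (basis_elem (x i)) r =
        c * polytabloid (lam i) (p i) (t i) r"
      using x column_antisym_tabloid[OF t] by (auto simp: tabloid_tuples_def PiE_iff)
    then obtain c where "\<forall>i\<in>{1..l}. \<forall>r. column_antisym (lam i) (p i) (t i) (basis_elem (x i)) r =
        c i * polytabloid (lam i) (p i) (t i) r" by (rule bchoice[THEN exE])
    then have "tensor_antisym l lam p t (basis_elem x) r = (\<Prod>i\<in>{1..l}. c i) * ?e r" for r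
      unfolding tensor_antisym_basis_elem[OF x] by (simp add: pure_tensor_def prod.distrib)
    then show ?thesis by blast
  qed
  then have "\<exists>c. \<forall>x\<in>?X. \<forall>r. tensor_antisym l lam p t (basis_elem x) r = c x * ?e r"
    by (intro bchoice) blast
  then obtain c where c: "\<And>x r. x \<in> ?X \<Longrightarrow> tensor_antisym l lam p t (basis_elem x) r = c x * ?e r"
    by blast
  have "tensor_antisym l lam p t F r = (\<Sum>x\<in>?X. F x * c x) * ?e r" for r
    unfolding tensor_antisym_expand[of l lam p t F r] sum_distrib_right
    by (rule sum.cong) (simp_all add: c)
  then show ?thesis by blast
qed

text \<open>Symmetry of each signed column sum turns this single value into the pairing of F with
  the generator, so an antisymmetrizer that annihilates F makes F orthogonal to that
  generator.\<close>

lemma tensor_antisym_at_tabloid: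
  assumes t: "\<And>i. i \<in> {1..l} \<Longrightarrow> t i \<in> tableaux (lam i) (p i)"
  shows "tensor_antisym l lam p t F (\<lambda>i\<in>{1..l}. tabloid_of (lam i) (p i) (t i)) =
    (\<Sum>x\<in>tabloid_tuples l lam p. F x *
      pure_tensor {1..l} (\<lambda>i. tabloids (lam i) (p i)) (\<lambda>i. polytabloid (lam i) (p i) (t i)) x)"
  unfolding tensor_antisym_expand[of l lam p t F]
proof (rule sum.cong[OF refl])
  fix x assume x: "x \<in> tabloid_tuples l lam p"
  have "(\<lambda>i\<in>{1..l}. tabloid_of (lam i) (p i) (t i)) \<in> (\<Pi>\<^sub>E i\<in>{1..l}. tabloids (lam i) (p i))"
    using t by (auto simp: tabloids_def)
  then show "F x * tensor_antisym l lam p t (basis_elem x) (\<lambda>i\<in>{1..l}. tabloid_of (lam i) (p i) (t i)) =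
    F x * pure_tensor {1..l} (\<lambda>i. tabloids (lam i) (p i)) (\<lambda>i. polytabloid (lam i) (p i) (t i)) x"
    unfolding tensor_antisym_basis_elem[OF x] pure_tensor_def
    using x column_antisym_at_tabloid[OF t] by (simp add: tabloid_tuples_def)
qed

text \<open>With real generators the bilinear pairing above agrees with the Hermitian one, which is
  positive definite.\<close>

lemma cnj_polytabloid: "cnj (polytabloid n p t r) = polytabloid n p t r"
  unfolding polytabloid_def basis_elem_def by (simp add: if_distrib cong: if_cong)

text \<open>
  James' submodule theorem, applied to all tensor factors at once: either some antisymmetrizer
  does not annihilate \<open>U\<close>, so that \<open>U\<close> contains a generator, or \<open>U\<close> is orthogonal to all
  generators and hence, over the complex numbers, to itself.
\<close>

theorem specht_tensor_simple:
  assumes U: "submodule U complex_field (fun_space UNIV)" and sub: "U \<subseteq> carrier (specht_tensor l lam p)"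
    and inv: "\<And>\<pi> F. \<pi> \<in> carrier (young_group l lam) \<Longrightarrow> F \<in> U \<Longrightarrow> specht_tensor_action l lam p \<pi> F \<in> U"
  shows "U = {\<lambda>_. 0} \<or> U = carrier (specht_tensor l lam p)"
proof -
  let ?T = "pure_tensor {1..l} (\<lambda>i. tabloids (lam i) (p i))"
  let ?e = "\<lambda>t. ?T (\<lambda>i. polytabloid (lam i) (p i) (t i))"
  let ?X = "tabloid_tuples l lam p"
  have scale: "(\<lambda>r. c * F r) \<in> U" if "F \<in> U" for c F
    using U that by (simp add: submodule_fun_space_iff)
  have \<kappa>: "tensor_antisym l lam p t F \<in> U" if F: "F \<in> U" for t F
    unfolding tensor_antisym_def
    by (intro submodule_fun_space_sum[OF U] scale inv F column_stabilizers_in_young_group)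
  show ?thesis
  proof (cases "\<exists>F\<in>U. \<exists>t. (\<forall>i\<in>{1..l}. t i \<in> tableaux (lam i) (p i)) \<and> tensor_antisym l lam p t F \<noteq> (\<lambda>_. 0)")
    case True
    then obtain F t where F: "F \<in> U" and t: "\<And>i. i \<in> {1..l} \<Longrightarrow> t i \<in> tableaux (lam i) (p i)"
      and nz: "tensor_antisym l lam p t F \<noteq> (\<lambda>_. 0)" by blast
    obtain c where c: "tensor_antisym l lam p t F = (\<lambda>r. c * ?e t r)"
      using tensor_antisym_multiple[of l t lam p F] t by blast
    have "c \<noteq> 0" using nz unfolding c by auto
    then have e: "?e t \<in> U" using scale[OF \<kappa>[OF F, of t], of "1 / c"] unfolding c by simp
    \<comment> \<open>The Young group is transitive on the generators, with one permutation per
      factor, so a single generator in U brings all the others.\<close>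
    have "?e t' \<in> U" if t': "\<And>i. i \<in> {1..l} \<Longrightarrow> t' i \<in> tableaux (lam i) (p i)" for t'
    proof -
      have "\<forall>i\<in>{1..l}. \<exists>\<pi>. \<pi> permutes {1..lam i} \<and>
          polytabloid (lam i) (p i) (t' i) = specht_action \<pi> (polytabloid (lam i) (p i) (t i))"
        using polytabloid_transitive[OF t t'] by metis
      then obtain \<pi> where \<pi>: "\<forall>i\<in>{1..l}. \<pi> i permutes {1..lam i} \<and>
          polytabloid (lam i) (p i) (t' i) = specht_action (\<pi> i) (polytabloid (lam i) (p i) (t i))"
        by (rule bchoice[THEN exE])
      have y: "restrict \<pi> {1..l} \<in> carrier (young_group l lam)" using \<pi> by (simp add: carrier_young_group)
      have "?e t' = ?T (\<lambda>i. specht_action (restrict \<pi> {1..l} i) (polytabloid (lam i) (p i) (t i)))"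
        using \<pi> by (intro pure_tensor_cong) simp
      also have "\<dots> = specht_tensor_action l lam p (restrict \<pi> {1..l}) (?e t)"
        by (rule specht_tensor_action_pure[OF y, symmetric])
      finally show ?thesis using inv[OF y e] by simp
    qed
    then have "carrier (specht_tensor l lam p) \<subseteq> U" by (intro specht_tensor_subset[OF U]) blast
    with sub show ?thesis by blast
  next
    case False
    have "F = (\<lambda>_. 0)" if F: "F \<in> U" for F
    proof -
      \<comment> \<open>The orthogonal complement of F. The conjugation is needed for definiteness
        and still leaves a complex subspace, because scaling H multiplies the sum by a
        constant.\<close>
      define W where "W = {H. (\<Sum>x\<in>?X. F x * cnj (H x)) = 0}"
      have "submodule W complex_field (fun_space UNIV)"
      proof -
        have "(\<Sum>x\<in>?X. F x * cnj (u x + v x)) = (\<Sum>x\<in>?X. F x * cnj (u x)) + (\<Sum>x\<in>?X. F x * cnj (v x))"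
          "(\<Sum>x\<in>?X. F x * cnj (c * u x)) = cnj c * (\<Sum>x\<in>?X. F x * cnj (u x))" for u v c
          by (simp_all add: distrib_left sum.distrib sum_distrib_left mult_ac)
        then show ?thesis unfolding submodule_fun_space_iff W_def by simp
      qed
      moreover have "?e t \<in> W" if t: "\<And>i. i \<in> {1..l} \<Longrightarrow> t i \<in> tableaux (lam i) (p i)" for t
      proof -
        have "tensor_antisym l lam p t F = (\<lambda>_. 0)" using False F t by blast
        then have "(\<Sum>x\<in>?X. F x * ?e t x) = 0" using tensor_antisym_at_tabloid[of l t lam p F, OF t] by simp
        moreover have "cnj (?e t x) = ?e t x" for x by (simp add: pure_tensor_def cnj_polytabloid)
        ultimately show ?thesis by (simp add: W_def)
      qed
      ultimately have "carrier (specht_tensor l lam p) \<subseteq> W" by (rule specht_tensor_subset)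
      then have "(\<Sum>x\<in>?X. F x * cnj (F x)) = 0" using F sub by (auto simp: W_def)
      then have "of_real (\<Sum>x\<in>?X. (cmod (F x))\<^sup>2) = (0::complex)" by (simp add: complex_norm_square[symmetric])
      then have "(\<Sum>x\<in>?X. (cmod (F x))\<^sup>2) = 0" by (simp only: of_real_eq_0_iff)
      then have "F x = 0" if "x \<in> ?X" for x
        using that finite_tabloid_tuples by (simp add: sum_nonneg_eq_0_iff)
      then show ?thesis using specht_tensor_support F sub by blast
    qed
    moreover have "(\<lambda>_. 0) \<in> U" using U by (simp add: submodule_fun_space_iff)
    ultimately show ?thesis by blast
  qed
qed

lemma specht_tensor_nonzero:
  assumes "p \<in> multipartitions l lam"
  shows "\<exists>F\<in>carrier (specht_tensor l lam p). F \<noteq> (\<lambda>_. 0)"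
proof -
  have "\<forall>i\<in>{1..l}. \<exists>t. t \<in> tableaux (lam i) (p i)"
    using assms tableaux_nonempty by (fastforce simp: multipartitions_def PiE_iff)
  then obtain t where t: "\<And>i. i \<in> {1..l} \<Longrightarrow> t i \<in> tableaux (lam i) (p i)"
    by (metis bchoice)
  let ?e = "pure_tensor {1..l} (\<lambda>i. tabloids (lam i) (p i)) (\<lambda>i. polytabloid (lam i) (p i) (t i))"
  have "?e (\<lambda>i\<in>{1..l}. tabloid_of (lam i) (p i) (t i)) = 1"
    using t by (auto simp: pure_tensor_def tabloids_def polytabloid_tabloid_of)
  then have "?e \<noteq> (\<lambda>_. 0)" by (auto simp: fun_eq_iff intro: exI[of _ "\<lambda>i\<in>{1..l}. tabloid_of (lam i) (p i) (t i)"])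
  then show ?thesis using polytabloid_tensor_in_specht_tensor t by blast
qed

section \<open>Standard morphisms and the functor\<close>

text \<open>The position of a in its fibre, counted from 0. Value and rank together are coordinates
  that standard morphisms preserve.\<close>

definition fiber_rank :: "nat \<Rightarrow> (nat \<Rightarrow> nat) \<Rightarrow> nat \<Rightarrow> nat" where
  "fiber_rank d f a = card {b \<in> {1..d}. b < a \<and> f b = f a}"

lemma fiber_rank_less:
  assumes "a \<in> {1..d}" "a < b" "f a = f b"
  shows "fiber_rank d f a < fiber_rank d f b"
  unfolding fiber_rank_def by (rule psubset_card_mono) (use assms in auto)

text \<open>Ranks increase strictly along a fibre, so the map is injective, and both sides have d
  elements. The target depends on f only through its fibre sizes, which is what allows two objects
  of one type to be matched.\<close>

lemma bij_fiber_rank: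
  "bij_betw (\<lambda>a. (f a, fiber_rank d f a)) {1..d} {(i, k). k < card {j \<in> {1..d}. f j = i}}"
proof -
  let ?T = "{(i, k). k < card {j \<in> {1..d}. f j = i}}" and ?E = "\<lambda>a. (f a, fiber_rank d f a)"
  have T: "?T = (SIGMA i:f ` {1..d}. {..<card {j \<in> {1..d}. f j = i}})"
  proof -
    have "i \<in> f ` {1..d}" if "k < card {j \<in> {1..d}. f j = i}" for i k
    proof -
      have "{j \<in> {1..d}. f j = i} \<noteq> {}" using that by (metis card.empty not_less_zero)
      then show ?thesis by blast
    qed
    then show ?thesis by auto
  qed
  have finT: "finite ?T" unfolding T by blast
  have "card ?T = (\<Sum>i\<in>f ` {1..d}. card {j \<in> {1..d}. f j = i})"
    unfolding T by (subst card_SigmaI) auto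
  also have "\<dots> = card {1..d}"
    using sum.image_gen[of "{1..d}" "\<lambda>_. 1 :: nat" f] by simp
  finally have cardT: "card ?T = card {1..d}" .
  have inj: "inj_on ?E {1..d}"
  proof (rule linorder_inj_onI')
    fix a b assume "a \<in> {1..d}" "a < b"
    then show "?E a \<noteq> ?E b" using fiber_rank_less[of a d b f] by auto
  qed
  have "fiber_rank d f a < card {j \<in> {1..d}. f j = f a}" if "a \<in> {1..d}" for a
    unfolding fiber_rank_def by (rule psubset_card_mono) (use that in auto)
  then have sub: "?E ` {1..d} \<subseteq> ?T" by auto
  have "?E ` {1..d} = ?T"
    by (rule card_subset_eq[OF finT sub]) (simp only: card_image[OF inj] cardT)
  with inj show ?thesis by (simp add: bij_betw_def)
qed

text \<open>The property under the \<open>THE\<close> of \<open>std_mor\<close>, split off so that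
  composites and inverses can be recognized by uniqueness.\<close>

definition is_std_mor :: "nat \<Rightarrow> (nat \<Rightarrow> nat) \<Rightarrow> (nat \<Rightarrow> nat) \<Rightarrow> (nat \<Rightarrow> nat) \<Rightarrow> bool" where
  "is_std_mor d f g \<sigma> \<longleftrightarrow> \<sigma> permutes {1..d} \<and> g \<circ> \<sigma> = f \<and>
     (\<forall>i\<in>{1..d}. \<forall>j\<in>{1..d}. i < j \<and> f i = f j \<longrightarrow> \<sigma> i < \<sigma> j)"

text \<open>Being monotone on fibres, \<sigma> maps the smaller members of the fibre of a onto those
  of the fibre of \<open>\<sigma> a\<close>; linearity of the order gives surjectivity.\<close>

lemma fiber_rank_std_mor:
  assumes \<sigma>: "is_std_mor d f g \<sigma>" and a: "a \<in> {1..d}"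
  shows "fiber_rank d g (\<sigma> a) = fiber_rank d f a"
proof -
  have p: "\<sigma> permutes {1..d}" and g: "\<And>x. g (\<sigma> x) = f x"
    and less: "\<And>i j. i \<in> {1..d} \<Longrightarrow> j \<in> {1..d} \<Longrightarrow> i < j \<Longrightarrow> f i = f j \<Longrightarrow> \<sigma> i < \<sigma> j"
    using \<sigma> by (auto simp: is_std_mor_def)
  have img: "\<sigma> ` {b \<in> {1..d}. b < a \<and> f b = f a} = {c \<in> {1..d}. c < \<sigma> a \<and> g c = g (\<sigma> a)}"
  proof (intro subset_antisym subsetI)
    fix c assume "c \<in> \<sigma> ` {b \<in> {1..d}. b < a \<and> f b = f a}"
    then obtain b where "b \<in> {1..d}" "b < a" "f b = f a" "c = \<sigma> b" by blast
    then show "c \<in> {c \<in> {1..d}. c < \<sigma> a \<and> g c = g (\<sigma> a)}"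
      using less[of b a] a g permutes_in_image[OF p, of b] by simp
  next
    fix c assume c: "c \<in> {c \<in> {1..d}. c < \<sigma> a \<and> g c = g (\<sigma> a)}"
    then obtain b where b: "b \<in> {1..d}" "c = \<sigma> b"
      using permutes_image[OF p] by blast
    then have "f b = f a" "\<sigma> b < \<sigma> a" using c g by auto
    then have "b < a" using less[of a b] a b by (metis linorder_less_linear order_less_asym)
    then show "c \<in> \<sigma> ` {b \<in> {1..d}. b < a \<and> f b = f a}" using b \<open>f b = f a\<close> by blast
  qed
  show ?thesis unfolding fiber_rank_def img[symmetric] by (rule card_image[OF permutes_inj_on[OF p]])
qed

lemma is_std_mor_unique:
  assumes "is_std_mor d f g \<sigma>" "is_std_mor d f g \<tau>"
  shows "\<sigma> = \<tau>"
proof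
  have p: "\<sigma> permutes {1..d}" "\<tau> permutes {1..d}" using assms by (auto simp: is_std_mor_def)
  have c: "g (\<sigma> x) = f x" "g (\<tau> x) = f x" for x
    using assms unfolding is_std_mor_def by (metis comp_apply)+
  fix a
  show "\<sigma> a = \<tau> a"
  proof (cases "a \<in> {1..d}")
    case True
    then have "\<sigma> a \<in> {1..d}" "\<tau> a \<in> {1..d}" using permutes_in_image p by metis+
    moreover have "(g (\<sigma> a), fiber_rank d g (\<sigma> a)) = (g (\<tau> a), fiber_rank d g (\<tau> a))"
      using fiber_rank_std_mor[OF assms(1) True] fiber_rank_std_mor[OF assms(2) True] c by simp
    ultimately show ?thesis by (metis (no_types, lifting) bij_betw_imp_inj_on[OF bij_fiber_rank] inj_onD)
  next
    case False
    then show ?thesis using permutes_not_in p by metis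
  qed
qed

lemma std_mor_eqI: "is_std_mor d f g \<sigma> \<Longrightarrow> std_mor d f g = \<sigma>"
  unfolding std_mor_def is_std_mor_def[symmetric] using is_std_mor_unique by blast

lemma fiber_cards_eq:
  assumes "f \<in> gpd_obj l d" "g \<in> gpd_obj l d" "obj_type l d f = obj_type l d g"
  shows "card {j \<in> {1..d}. f j = i} = card {j \<in> {1..d}. g j = i}"
proof (cases "i \<in> {1..l}")
  case True
  then show ?thesis using fun_cong[OF assms(3), of i] by (simp add: obj_type_def)
next
  case False
  then have "{j \<in> {1..d}. f j = i} = {}" "{j \<in> {1..d}. g j = i} = {}"
    using assms(1,2) by (auto simp: gpd_obj_def PiE_iff)
  then show ?thesis by (simp only:)
qed

lemma std_mor:
  assumes f: "f \<in> gpd_obj l d" and g: "g \<in> gpd_obj l d" and type: "obj_type l d f = obj_type l d g"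
  shows "is_std_mor d f g (std_mor d f g)"
proof -
  let ?E = "\<lambda>f a. (f a, fiber_rank d f a)"
  have bf: "bij_betw (?E f) {1..d} {(i, k). k < card {j \<in> {1..d}. f j = i}}" by (rule bij_fiber_rank)
  have bg: "bij_betw (?E g) {1..d} {(i, k). k < card {j \<in> {1..d}. f j = i}}"
    unfolding fiber_cards_eq[OF assms] by (rule bij_fiber_rank)
  \<comment> \<open>Each a goes to the element with the same value and rank for g. Such an element
    exists because equal types give equal coordinate sets.\<close>
  define \<sigma> where "\<sigma> a = (if a \<in> {1..d} then inv_into {1..d} (?E g) (?E f a) else a)" for a
  have "bij_betw (inv_into {1..d} (?E g) \<circ> ?E f) {1..d} {1..d}"
    using bf bij_betw_inv_into[OF bg] by (rule bij_betw_trans)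
  then have "bij_betw \<sigma> {1..d} {1..d}"
    by (subst bij_betw_cong[of _ \<sigma> "inv_into {1..d} (?E g) \<circ> ?E f"]) (auto simp: \<sigma>_def)
  then have p: "\<sigma> permutes {1..d}" by (rule bij_imp_permutes) (simp add: \<sigma>_def del: atLeastAtMost_iff)
  have E: "g (\<sigma> a) = f a" "fiber_rank d g (\<sigma> a) = fiber_rank d f a" if a: "a \<in> {1..d}" for a
  proof -
    have "?E f a \<in> {(i, k). k < card {j \<in> {1..d}. f j = i}}" using bij_betwE[OF bf] a by blast
    from bij_betw_inv_into_right[OF bg this] have "?E g (\<sigma> a) = ?E f a" using a by (simp add: \<sigma>_def)
    then show "g (\<sigma> a) = f a" "fiber_rank d g (\<sigma> a) = fiber_rank d f a" by simp_all
  qed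
  have "g \<circ> \<sigma> = f"
  proof
    fix a show "(g \<circ> \<sigma>) a = f a"
      using E(1)[of a] f g by (cases "a \<in> {1..d}") (auto simp: \<sigma>_def gpd_obj_def PiE_iff extensional_def)
  qed
  moreover have "\<sigma> i < \<sigma> j" if ij: "i \<in> {1..d}" "j \<in> {1..d}" "i < j" "f i = f j" for i j
  proof (rule ccontr)
    assume "\<not> \<sigma> i < \<sigma> j"
    moreover have "\<sigma> i \<noteq> \<sigma> j" using permutes_inj[OF p] ij by (metis injD less_irrefl)
    ultimately have "\<sigma> j < \<sigma> i" by simp
    moreover have "\<sigma> j \<in> {1..d}" using permutes_in_image[OF p] ij by simp
    ultimately have "fiber_rank d g (\<sigma> j) < fiber_rank d g (\<sigma> i)"
      using E ij by (intro fiber_rank_less) auto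
    then show False using E ij fiber_rank_less[of i d j f] by simp
  qed
  ultimately have "is_std_mor d f g \<sigma>" using p by (simp add: is_std_mor_def)
  then show ?thesis using std_mor_eqI by simp
qed

lemma is_std_mor_comp:
  assumes \<sigma>: "is_std_mor d f g \<sigma>" and \<tau>: "is_std_mor d g h \<tau>"
  shows "is_std_mor d f h (\<tau> \<circ> \<sigma>)"
proof -
  have p: "\<sigma> permutes {1..d}" "\<tau> permutes {1..d}" and c: "g \<circ> \<sigma> = f" "h \<circ> \<tau> = g"
    using assms by (auto simp: is_std_mor_def)
  have "\<tau> (\<sigma> i) < \<tau> (\<sigma> j)" if "i \<in> {1..d}" "j \<in> {1..d}" "i < j" "f i = f j" for i j
    using that \<sigma> \<tau> permutes_in_image[OF p(1)] fun_cong[OF c(1)] unfolding is_std_mor_def comp_def by metis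
  moreover have "h \<circ> (\<tau> \<circ> \<sigma>) = f" using c by (simp add: o_assoc)
  ultimately show ?thesis using permutes_compose[OF p] by (simp add: is_std_mor_def)
qed

text \<open>Composites of standard morphisms are standard, and so is the identity, hence uniqueness
  applies. This cancellation underlies functoriality of \<open>L_mor\<close>.\<close>

lemma std_mor_inverse:
  assumes "f \<in> gpd_obj l d" "g \<in> gpd_obj l d" "obj_type l d f = obj_type l d g"
  shows "std_mor d g f \<circ> std_mor d f g = id"
proof (rule is_std_mor_unique)
  show "is_std_mor d f f (std_mor d g f \<circ> std_mor d f g)"
    by (rule is_std_mor_comp[OF std_mor[OF assms] std_mor[OF assms(2,1) assms(3)[symmetric]]])
  show "is_std_mor d f f id" by (simp add: is_std_mor_def permutes_id)
qed

section \<open>The blocks of the weakly increasing object and its endomorphisms\<close>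

definition block_start :: "(nat \<Rightarrow> nat) \<Rightarrow> nat \<Rightarrow> nat" where
  "block_start lam i = (\<Sum>j\<in>{1..<i}. lam j)"

lemma block_start_Suc: "1 \<le> i \<Longrightarrow> block_start lam (Suc i) = block_start lam i + lam i"
  by (simp add: block_start_def)

lemma block_start_mono: "i \<le> j \<Longrightarrow> block_start lam i \<le> block_start lam j"
  unfolding block_start_def by (rule sum_mono2) auto

lemma downset_eq_atLeastAtMost:
  fixes S :: "nat set"
  assumes "S \<subseteq> {1..d}" "\<And>k k'. k \<in> S \<Longrightarrow> 1 \<le> k' \<Longrightarrow> k' \<le> k \<Longrightarrow> k' \<in> S"
  shows "S = {1..card S}"
proof (cases "S = {}")
  case False
  have fin: "finite S" using assms(1) finite_subset by blast
  have "S = {1..Max S}"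
  proof (intro subset_antisym subsetI)
    fix k assume "k \<in> S" then show "k \<in> {1..Max S}" using assms(1) fin by auto
  next
    fix k assume "k \<in> {1..Max S}" then show "k \<in> S" using assms(2)[of "Max S" k] fin False by simp
  qed
  then show ?thesis by (metis card_atLeastAtMost diff_Suc_1)
qed simp

text \<open>Sublevel sets of a weakly increasing object are initial segments, and the type gives
  their lengths as partial sums. This determines the object, hence the uniqueness behind
  \<open>std_obj\<close>.\<close>

lemma mono_obj_le_iff:
  assumes f: "f \<in> gpd_obj l d" "obj_type l d f = lam" "mono_on {1..d} f" and i: "i \<le> l" and k: "k \<in> {1..d}"
  shows "f k \<le> i \<longleftrightarrow> k \<le> block_start lam (Suc i)"
proof -
  let ?S = "{k \<in> {1..d}. f k \<le> i}"
  have "(k \<in> ?S) = (k \<in> {1..card ?S})"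
  proof (rule arg_cong[of _ _ "\<lambda>A. k \<in> A"])
    show "?S = {1..card ?S}"
  proof (rule downset_eq_atLeastAtMost)
    fix a b assume *: "a \<in> ?S" "1 \<le> b" "b \<le> a"
    then have "f b \<le> f a" by (intro mono_onD[OF f(3)]) auto
    then show "b \<in> ?S" using * by auto
  qed auto
  qed
  moreover have "card ?S = block_start lam (Suc i)"
  proof -
    have "?S = (\<Union>j\<in>{1..i}. {k \<in> {1..d}. f k = j})"
      using f(1) by (auto simp: gpd_obj_def PiE_iff)
    then have "card ?S = (\<Sum>j\<in>{1..i}. card {k \<in> {1..d}. f k = j})"
      by (simp only: , subst card_UN_disjoint) auto
    also have "\<dots> = (\<Sum>j\<in>{1..i}. lam j)"
      using i f(2) by (intro sum.cong) (auto simp: obj_type_def)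
    finally show ?thesis by (simp add: block_start_def atLeastLessThanSuc_atLeastAtMost)
  qed
  ultimately show ?thesis using k by simp
qed

lemma std_obj:
  assumes lam: "lam \<in> compositions l d"
  shows "std_obj l d lam \<in> gpd_obj l d" "obj_type l d (std_obj l d lam) = lam"
    "mono_on {1..d} (std_obj l d lam)"
proof -
  have top: "block_start lam (Suc l) = d"
    using lam by (simp add: compositions_def block_start_def atLeastLessThanSuc_atLeastAtMost)
  \<comment> \<open>\<open>block_start lam (Suc i)\<close> is the end of block i, so this is the
    index of the block that contains k.\<close>
  define f where "f = (\<lambda>k\<in>{1..d}. LEAST i. k \<le> block_start lam (Suc i))"
  have le_iff: "f k \<le> i \<longleftrightarrow> k \<le> block_start lam (Suc i)" if k: "k \<in> {1..d}" for k i
  proof -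
    have "k \<le> block_start lam (Suc l)" using k top by simp
    then have "k \<le> block_start lam (Suc (f k))"
      using k unfolding f_def by (simp only: restrict_apply if_True) (rule LeastI)
    moreover have "f k \<le> i" if "k \<le> block_start lam (Suc i)"
      using k that by (simp add: f_def Least_le)
    moreover have "block_start lam (Suc (f k)) \<le> block_start lam (Suc i)" if "f k \<le> i"
      using that by (intro block_start_mono) simp
    ultimately show ?thesis by linarith
  qed
  have in_obj: "f \<in> gpd_obj l d"
  proof -
    \<comment> \<open>\<open>LEAST\<close> starts at 0, but \<open>block_start lam (Suc 0)\<close>
      is an empty sum and k is positive, so the value 0 does not occur.\<close>
    have "f k \<in> {1..l}" if k: "k \<in> {1..d}" for k
      using le_iff[OF k, of l] le_iff[OF k, of 0] k top by (auto simp: block_start_def)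
    moreover have "f k = undefined" if "k \<notin> {1..d}" for k
      unfolding f_def restrict_apply using that by (rule if_not_P)
    ultimately show ?thesis unfolding gpd_obj_def by (rule PiE_I)
  qed
  have type: "obj_type l d f = lam"
  proof
    fix i
    show "obj_type l d f i = lam i"
    proof (cases "i \<in> {1..l}")
      case True
      have i: "1 \<le> i" "Suc (i - 1) = i" using True by auto
      have le_d: "block_start lam (Suc i) \<le> d"
        using True block_start_mono[of "Suc i" "Suc l" lam] top by simp
      have "k \<in> {1..d} \<and> f k = i \<longleftrightarrow> block_start lam i < k \<and> k \<le> block_start lam (Suc i)" for k
      proof (cases "k \<in> {1..d}")
        case k: True
        have "f k = i \<longleftrightarrow> f k \<le> i \<and> \<not> f k \<le> i - 1" using i(1) by linarith
        also have "\<dots> \<longleftrightarrow> k \<le> block_start lam (Suc i) \<and> \<not> k \<le> block_start lam i"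
          unfolding le_iff[OF k] i(2) ..
        finally show ?thesis using k unfolding not_le by blast
      next
        case k: False
        then have "\<not> (block_start lam i < k \<and> k \<le> block_start lam (Suc i))"
          using le_d by auto
        with k show ?thesis by blast
      qed
      then have "{k \<in> {1..d}. f k = i} = {block_start lam i<..block_start lam (Suc i)}"
        unfolding set_eq_iff mem_Collect_eq greaterThanAtMost_iff by blast
      then show ?thesis using True i by (simp add: obj_type_def block_start_Suc)
    next
      case False
      then show ?thesis using lam by (auto simp: obj_type_def compositions_def PiE_iff extensional_def)
    qed
  qed
  have mono: "mono_on {1..d} f"
  proof (rule mono_onI)
    fix a b assume ab: "a \<in> {1..d}" "b \<in> {1..d}" "a \<le> b"
    have "b \<le> block_start lam (Suc (f b))" using le_iff[OF ab(2), of "f b"] by simp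
    then show "f a \<le> f b" using le_iff[OF ab(1), of "f b"] ab(3) by simp
  qed
  have uniq: "g = f" if g: "g \<in> gpd_obj l d \<and> obj_type l d g = lam \<and> mono_on {1..d} g" for g
  proof -
    have "g k = f k" if k: "k \<in> {1..d}" for k
    proof -
      have "g k \<le> l" "f k \<le> l" using g in_obj k by (auto simp: gpd_obj_def PiE_iff)
      moreover have "g k \<le> i \<longleftrightarrow> f k \<le> i" if "i \<le> l" for i
        using mono_obj_le_iff[of g l d lam i k] le_iff[OF k] g that k by simp
      ultimately show ?thesis by (metis order_antisym order_refl)
    qed
    then show ?thesis using g in_obj unfolding gpd_obj_def by (blast intro: PiE_ext)
  qed
  have "std_obj l d lam = f"
    unfolding std_obj_def by (rule the_equality) (use in_obj type mono uniq in blast)+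
  then show "std_obj l d lam \<in> gpd_obj l d" "obj_type l d (std_obj l d lam) = lam"
    "mono_on {1..d} (std_obj l d lam)" using in_obj type mono by simp_all
qed

lemma std_obj_eq_iff:
  assumes lam: "lam \<in> compositions l d" and i: "i \<in> {1..l}"
  shows "k \<in> {1..d} \<and> std_obj l d lam k = i \<longleftrightarrow> block_start lam i < k \<and> k \<le> block_start lam i + lam i"
proof -
  note le = mono_obj_le_iff[OF std_obj[OF lam]]
  have i': "1 \<le> i" "i \<le> l" "i - 1 \<le> l" "Suc (i - 1) = i" using i by auto
  have "block_start lam (Suc l) = d"
    using lam by (simp add: compositions_def block_start_def atLeastLessThanSuc_atLeastAtMost)
  then have "block_start lam i + lam i \<le> d"
    using i' block_start_mono[of "Suc i" "Suc l" lam] by (simp add: block_start_Suc)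
  then show ?thesis
    using le[of i k] le[of "i - 1" k] i' unfolding i'(4) by (auto simp: block_start_Suc)
qed

definition std_endos :: "nat \<Rightarrow> nat \<Rightarrow> (nat \<Rightarrow> nat) \<Rightarrow> (nat \<Rightarrow> nat) set" where
  "std_endos l d lam = {\<sigma>. \<sigma> permutes {1..d} \<and> std_obj l d lam \<circ> \<sigma> = std_obj l d lam}"

text \<open>Endomorphisms preserve every block. This makes the truncated subtraction of the offset
  in \<open>block_perms\<close> exact.\<close>

lemma std_endos_block:
  assumes lam: "lam \<in> compositions l d" and \<sigma>: "\<sigma> \<in> std_endos l d lam"
    and i: "i \<in> {1..l}" and k: "k \<in> {1..lam i}"
  shows "block_start lam i < \<sigma> (block_start lam i + k)"
    "\<sigma> (block_start lam i + k) \<le> block_start lam i + lam i"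
proof -
  have p: "\<sigma> permutes {1..d}" and c: "\<And>x. std_obj l d lam (\<sigma> x) = std_obj l d lam x"
    using \<sigma> by (auto simp: std_endos_def fun_eq_iff)
  have "block_start lam i + k \<in> {1..d} \<and> std_obj l d lam (block_start lam i + k) = i"
    using std_obj_eq_iff[OF lam i, of "block_start lam i + k"] k by simp
  then have "\<sigma> (block_start lam i + k) \<in> {1..d} \<and> std_obj l d lam (\<sigma> (block_start lam i + k)) = i"
    using c permutes_in_image[OF p] by simp
  then show "block_start lam i < \<sigma> (block_start lam i + k)"
    "\<sigma> (block_start lam i + k) \<le> block_start lam i + lam i"
    using std_obj_eq_iff[OF lam i] by blast+
qed

lemma block_perms_apply:
  assumes "i \<in> {1..l}"
  shows "block_perms l lam \<sigma> i =
    (\<lambda>k. if k \<in> {1..lam i} then \<sigma> (block_start lam i + k) - block_start lam i else k)"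
  using assms unfolding block_perms_def block_start_def Let_def by (simp del: One_nat_def)

lemma block_perms_in_young_group:
  assumes lam: "lam \<in> compositions l d" and \<sigma>: "\<sigma> \<in> std_endos l d lam"
  shows "block_perms l lam \<sigma> \<in> carrier (young_group l lam)"
  unfolding carrier_young_group
proof (rule PiE_I)
  fix i assume i: "i \<in> {1..l}"
  let ?b = "block_perms l lam \<sigma> i"
  have into: "?b k \<in> {1..lam i}" if k: "k \<in> {1..lam i}" for k
    using std_endos_block[OF lam \<sigma> i k] k unfolding block_perms_apply[OF i] by auto
  have "inj \<sigma>" using \<sigma> permutes_inj by (auto simp: std_endos_def)
  have "inj_on ?b {1..lam i}"
  proof (rule inj_onI)
    fix a b assume ab: "a \<in> {1..lam i}" "b \<in> {1..lam i}" "?b a = ?b b"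
    then have "\<sigma> (block_start lam i + a) = \<sigma> (block_start lam i + b)"
      using std_endos_block(1)[OF lam \<sigma> i ab(1)] std_endos_block(1)[OF lam \<sigma> i ab(2)]
      unfolding block_perms_apply[OF i] by simp
    then show "a = b" using \<open>inj \<sigma>\<close> by (simp add: inj_eq)
  qed
  then have "bij_betw ?b {1..lam i} {1..lam i}"
    using endo_inj_surj[of "{1..lam i}" ?b] into unfolding bij_betw_def by blast
  then have "?b permutes {1..lam i}"
    by (rule bij_imp_permutes) (simp add: block_perms_apply[OF i] del: atLeastAtMost_iff)
  then show "?b \<in> {\<pi>. \<pi> permutes {1..lam i}}" by simp
qed (auto simp: block_perms_def)

lemma block_perms_comp:
  assumes lam: "lam \<in> compositions l d" and \<tau>: "\<tau> \<in> std_endos l d lam"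
  shows "block_perms l lam (\<sigma> \<circ> \<tau>) = (\<lambda>i\<in>{1..l}. block_perms l lam \<sigma> i \<circ> block_perms l lam \<tau> i)"
proof
  fix i
  show "block_perms l lam (\<sigma> \<circ> \<tau>) i = (\<lambda>i\<in>{1..l}. block_perms l lam \<sigma> i \<circ> block_perms l lam \<tau> i) i"
  proof (cases "i \<in> {1..l}")
    case True
    have "block_perms l lam (\<sigma> \<circ> \<tau>) i k = (block_perms l lam \<sigma> i \<circ> block_perms l lam \<tau> i) k" for k
    proof (cases "k \<in> {1..lam i}")
      case k: True
      have "\<tau> (block_start lam i + k) - block_start lam i \<in> {1..lam i}"
        "block_start lam i + (\<tau> (block_start lam i + k) - block_start lam i) = \<tau> (block_start lam i + k)"
        using std_endos_block[OF lam \<tau> True k] by auto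
      then show ?thesis unfolding block_perms_apply[OF True] comp_def using k by simp
    next
      case False
      then show ?thesis unfolding block_perms_apply[OF True] comp_def by (simp del: atLeastAtMost_iff)
    qed
    then show ?thesis using True by auto
  next
    case False
    then show ?thesis by (simp add: block_perms_def del: atLeastAtMost_iff)
  qed
qed

lemma block_perms_id: "block_perms l lam id = (\<lambda>i\<in>{1..l}. id)"
proof
  fix i show "block_perms l lam id i = (\<lambda>i\<in>{1..l}. id) i"
  proof (cases "i \<in> {1..l}")
    case True
    then show ?thesis unfolding block_perms_apply[OF True] by auto
  next
    case False
    then show ?thesis by (simp add: block_perms_def del: atLeastAtMost_iff)
  qed
qed

text \<open>Block permutations can be glued. Surjectivity is needed later to turn stability under
  matrices into stability under the whole Young group.\<close>

lemma block_perms_surj: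
  assumes lam: "lam \<in> compositions l d" and \<pi>: "\<pi> \<in> carrier (young_group l lam)"
  obtains \<sigma> where "\<sigma> \<in> std_endos l d lam" "block_perms l lam \<sigma> = \<pi>"
proof -
  let ?f = "std_obj l d lam" and ?b = "block_start lam"
  have f: "?f k \<in> {1..l}" if "k \<in> {1..d}" for k
    using std_obj(1)[OF lam] that by (auto simp: gpd_obj_def PiE_iff)
  have \<pi>i: "\<pi> i permutes {1..lam i}" if "i \<in> {1..l}" for i
    using \<pi> that by (auto simp: carrier_young_group PiE_iff)
  \<comment> \<open>\<open>?f k\<close> is the block of k: the offset is removed, the permutation of
    this block applied, and the offset restored.\<close>
  define \<sigma> where "\<sigma> k = (if k \<in> {1..d} then ?b (?f k) + \<pi> (?f k) (k - ?b (?f k)) else k)" for k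
  have loc: "k - ?b (?f k) \<in> {1..lam (?f k)}" "?b (?f k) + (k - ?b (?f k)) = k" if k: "k \<in> {1..d}" for k
    using std_obj_eq_iff[OF lam f[OF k], of k] k by auto
  have img: "\<sigma> k \<in> {1..d} \<and> ?f (\<sigma> k) = ?f k" if k: "k \<in> {1..d}" for k
  proof -
    have "\<pi> (?f k) (k - ?b (?f k)) \<in> {1..lam (?f k)}"
      using loc(1)[OF k] permutes_in_image[OF \<pi>i[OF f[OF k]]] by simp
    then show ?thesis
      unfolding std_obj_eq_iff[OF lam f[OF k]] using k by (simp add: \<sigma>_def)
  qed
  have "inj_on \<sigma> {1..d}"
  proof (rule inj_onI)
    fix a b assume ab: "a \<in> {1..d}" "b \<in> {1..d}" "\<sigma> a = \<sigma> b"
    then have fab: "?f a = ?f b" using img by metis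
    have "\<pi> (?f a) (a - ?b (?f a)) = \<pi> (?f a) (b - ?b (?f a))" using ab fab by (simp add: \<sigma>_def)
    then have "a - ?b (?f a) = b - ?b (?f a)" using permutes_inj[OF \<pi>i[OF f[OF ab(1)]]] by (simp add: inj_eq)
    then show "a = b" using loc(2)[OF ab(1)] loc(2)[OF ab(2)] fab by metis
  qed
  then have "bij_betw \<sigma> {1..d} {1..d}"
    using endo_inj_surj[of "{1..d}" \<sigma>] img unfolding bij_betw_def by blast
  then have p: "\<sigma> permutes {1..d}" by (rule bij_imp_permutes) (simp add: \<sigma>_def del: atLeastAtMost_iff)
  have "?f (\<sigma> k) = ?f k" for k using img[of k] by (cases "k \<in> {1..d}") (simp_all add: \<sigma>_def del: atLeastAtMost_iff)
  then have "\<sigma> \<in> std_endos l d lam" using p by (auto simp: std_endos_def)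
  moreover have "block_perms l lam \<sigma> = \<pi>"
  proof
    fix i
    show "block_perms l lam \<sigma> i = \<pi> i"
    proof (cases "i \<in> {1..l}")
      case i: True
      have "block_perms l lam \<sigma> i k = \<pi> i k" for k
      proof (cases "k \<in> {1..lam i}")
        case True
        then have "?b i + k \<in> {1..d} \<and> ?f (?b i + k) = i"
          unfolding std_obj_eq_iff[OF lam i] by simp
        then show ?thesis using True unfolding block_perms_apply[OF i] by (simp add: \<sigma>_def)
      next
        case False
        then show ?thesis
          using permutes_not_in[OF \<pi>i[OF i]] unfolding block_perms_apply[OF i] by (simp del: atLeastAtMost_iff)
      qed
      then show ?thesis by blast
    next
      case False
      then show ?thesis using \<pi>
        by (simp add: block_perms_def carrier_young_group PiE_iff extensional_def del: atLeastAtMost_iff)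
    qed
  qed
  ultimately show ?thesis by (rule that)
qed

section \<open>Functoriality, and the image of the endomorphisms\<close>

lemma gpd_mor_obj_type:
  assumes "(f, \<pi>, g) \<in> gpd_mor l d"
  shows "obj_type l d f = obj_type l d g"
proof -
  have p: "\<pi> permutes {1..d}" and f: "f = g \<circ> \<pi>" using assms by (auto simp: gpd_mor_def)
  have "card {j \<in> {1..d}. f j = i} = card {j \<in> {1..d}. g j = i}" for i
  proof -
    have img: "\<pi> ` {j \<in> {1..d}. f j = i} = {j \<in> {1..d}. g j = i}"
    proof (intro subset_antisym subsetI)
      fix k assume k: "k \<in> {j \<in> {1..d}. g j = i}"
      then obtain j where "j \<in> {1..d}" "k = \<pi> j" using permutes_image[OF p] by blast
      then show "k \<in> \<pi> ` {j \<in> {1..d}. f j = i}" using k by (auto simp: f)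
    qed (use permutes_in_image[OF p] in \<open>auto simp: f\<close>)
    show ?thesis unfolding img[symmetric] by (rule card_image[OF permutes_inj_on[OF p], symmetric])
  qed
  then show ?thesis unfolding obj_type_def by simp
qed

definition std_conj :: "nat \<Rightarrow> nat \<Rightarrow> (nat \<Rightarrow> nat) \<Rightarrow> mor \<Rightarrow> (nat \<Rightarrow> nat)" where
  "std_conj l d lam = (\<lambda>(f, \<pi>, g). std_mor d g (std_obj l d lam) \<circ> \<pi> \<circ> std_mor d (std_obj l d lam) f)"

lemma std_conj_in_std_endos:
  assumes lam: "lam \<in> compositions l d" and m: "(f, \<pi>, g) \<in> gpd_mor l d" and g: "obj_type l d g = lam"
  shows "std_conj l d lam (f, \<pi>, g) \<in> std_endos l d lam"
proof -
  note s = std_obj[OF lam]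
  have fg: "f \<in> gpd_obj l d" "g \<in> gpd_obj l d" and p: "\<pi> permutes {1..d}" and c: "g \<circ> \<pi> = f"
    using m by (auto simp: gpd_mor_def)
  have f: "obj_type l d f = lam" using gpd_mor_obj_type[OF m] g by simp
  have 1: "is_std_mor d g (std_obj l d lam) (std_mor d g (std_obj l d lam))"
    by (rule std_mor) (use fg s g in auto)
  have 2: "is_std_mor d (std_obj l d lam) f (std_mor d (std_obj l d lam) f)"
    by (rule std_mor) (use fg s f in auto)
  have "std_obj l d lam \<circ> (std_mor d g (std_obj l d lam) \<circ> \<pi> \<circ> std_mor d (std_obj l d lam) f) = std_obj l d lam"
    using 1 2 c by (simp add: is_std_mor_def o_assoc)
  then show ?thesis
    using 1 2 p by (simp add: std_conj_def std_endos_def is_std_mor_def permutes_compose)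
qed

text \<open>The two standard morphisms meeting at g are mutually inverse and cancel.\<close>

lemma std_conj_comp:
  assumes lam: "lam \<in> compositions l d" and g: "g \<in> gpd_obj l d" "obj_type l d g = lam"
  shows "std_conj l d lam (g, \<tau>, h) \<circ> std_conj l d lam (f, \<pi>, g) = std_conj l d lam (f, \<tau> \<circ> \<pi>, h)"
proof -
  have "std_mor d (std_obj l d lam) g \<circ> std_mor d g (std_obj l d lam) = id"
    by (rule std_mor_inverse[OF g(1) std_obj(1)[OF lam]]) (use g std_obj[OF lam] in simp)
  then show ?thesis
    by (simp add: std_conj_def fun_eq_iff)
qed

lemma L_mor_eq:
  "obj_type l d f = lam \<Longrightarrow> obj_type l d g = lam \<Longrightarrow> L_mor l d lam p (f, \<pi>, g) =
    specht_tensor_action l lam p (block_perms l lam (std_conj l d lam (f, \<pi>, g)))"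
  by (auto simp: std_conj_def)

lemma L_mor_closed:
  assumes lam: "lam \<in> compositions l d" and m: "(f, \<pi>, g) \<in> gpd_mor l d" and g: "obj_type l d g = lam"
    and F: "F \<in> carrier (specht_tensor l lam p)"
  shows "L_mor l d lam p (f, \<pi>, g) F \<in> carrier (specht_tensor l lam p)"
proof -
  have f: "obj_type l d f = lam" using gpd_mor_obj_type[OF m] g by simp
  show ?thesis
    unfolding L_mor_eq[OF f g]
    by (rule specht_tensor_action_closed[OF block_perms_in_young_group[OF lam std_conj_in_std_endos[OF lam m g]] F])
qed

lemma L_mor_comp:
  assumes lam: "lam \<in> compositions l d" and m: "(f, \<pi>, g) \<in> gpd_mor l d" and m': "(g, \<tau>, h) \<in> gpd_mor l d"
  shows "L_mor l d lam p (g, \<tau>, h) (L_mor l d lam p (f, \<pi>, g) F) = L_mor l d lam p (f, \<tau> \<circ> \<pi>, h) F"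
proof (cases "obj_type l d g = lam")
  case g: True
  have f: "obj_type l d f = lam" and h: "obj_type l d h = lam"
    using gpd_mor_obj_type[OF m] gpd_mor_obj_type[OF m'] g by auto
  have g': "g \<in> gpd_obj l d" using m by (auto simp: gpd_mor_def)
  show ?thesis
    unfolding L_mor_eq[OF f g] L_mor_eq[OF g h] L_mor_eq[OF f h]
      specht_tensor_action_comp[OF block_perms_in_young_group[OF lam std_conj_in_std_endos[OF lam m' h]]]
      block_perms_comp[OF lam std_conj_in_std_endos[OF lam m g], symmetric]
      std_conj_comp[OF lam g' g] ..
qed (use gpd_mor_obj_type[OF m] gpd_mor_obj_type[OF m'] in auto)

lemma L_mor_id:
  assumes lam: "lam \<in> compositions l d" and f: "f \<in> gpd_obj l d" "obj_type l d f = lam"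
    and F: "F \<in> carrier (specht_tensor l lam p)"
  shows "L_mor l d lam p (f, id, f) F = F"
proof -
  have "std_mor d f (std_obj l d lam) \<circ> std_mor d (std_obj l d lam) f = id"
    by (rule std_mor_inverse[OF std_obj(1)[OF lam] f(1)]) (use f std_obj[OF lam] in simp)
  then have "std_conj l d lam (f, id, f) = id" by (simp add: std_conj_def)
  then show ?thesis
    unfolding L_mor_eq[OF f(2) f(2)] using specht_tensor_action_id[OF F] by (simp add: block_perms_id)
qed

text \<open>Conjugation with the standard morphisms identifies the endomorphisms of f with those of
  the weakly increasing object, where \<open>block_perms_surj\<close> applies.\<close>

lemma L_mor_endo_surj:
  assumes lam: "lam \<in> compositions l d" and f: "f \<in> gpd_obj l d" "obj_type l d f = lam"
    and \<pi>: "\<pi> \<in> carrier (young_group l lam)"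
  obtains \<sigma> where "(f, \<sigma>, f) \<in> gpd_mor l d" "L_mor l d lam p (f, \<sigma>, f) = specht_tensor_action l lam p \<pi>"
proof -
  let ?s = "std_obj l d lam"
  note s = std_obj[OF lam]
  obtain \<sigma> where \<sigma>: "\<sigma> \<in> std_endos l d lam" "block_perms l lam \<sigma> = \<pi>"
    using block_perms_surj[OF lam \<pi>] .
  have 1: "is_std_mor d f ?s (std_mor d f ?s)" by (rule std_mor) (use f s in auto)
  have 2: "is_std_mor d ?s f (std_mor d ?s f)" by (rule std_mor) (use f s in auto)
  have 3: "std_mor d f ?s \<circ> std_mor d ?s f = id" by (rule std_mor_inverse) (use f s in auto)
  define \<tau> where "\<tau> = std_mor d ?s f \<circ> \<sigma> \<circ> std_mor d f ?s"
  have "f \<circ> \<tau> = f" using 1 2 \<sigma> by (simp add: \<tau>_def is_std_mor_def std_endos_def o_assoc)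
  moreover have "\<tau> permutes {1..d}"
    using 1 2 \<sigma> by (simp add: \<tau>_def is_std_mor_def std_endos_def permutes_compose)
  ultimately have m: "(f, \<tau>, f) \<in> gpd_mor l d" using f by (simp add: gpd_mor_def)
  have "std_conj l d lam (f, \<tau>, f) = \<sigma>"
    using 3 by (simp add: std_conj_def \<tau>_def fun_eq_iff)
  then show ?thesis using that[OF m] L_mor_eq[OF f(2) f(2)] \<sigma>(2) by simp
qed

lemma L_mor_linear:
  "L_mor l d lam p m (\<lambda>r. F r + H r) = (\<lambda>r. L_mor l d lam p m F r + L_mor l d lam p m H r)"
  "L_mor l d lam p m (\<lambda>r. c * F r) = (\<lambda>r. c * L_mor l d lam p m F r)"
  by (cases m; auto simp: specht_tensor_action_def)+

section \<open>Monomial matrices\<close>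

lemma monomial_mat_cong:
  "(\<And>j. j \<in> {1..d} \<Longrightarrow> c j = c' j) \<Longrightarrow> monomial_mat d \<pi> c = monomial_mat d \<pi> c'"
  unfolding monomial_mat_def by (intro eq_matI) auto

lemma monomial_mat_left_inverse:
  assumes "\<pi> permutes {1..d}" "l > 0" "\<And>j. j \<in> {1..d} \<Longrightarrow> c j ^ l = 1"
  shows "monomial_mat d (inv' \<pi>) (\<lambda>j. inverse (c (inv' \<pi> j))) * monomial_mat d \<pi> c = 1\<^sub>m d"
proof -
  have "c j \<noteq> 0" if "j \<in> {1..d}" for j using assms(2) assms(3)[OF that] by (auto simp: power_0_left)
  then show ?thesis
    unfolding monomial_mat_mult[OF assms(1)] one_mat_monomial permutes_inv_o[OF assms(1)]
    by (intro monomial_mat_cong) (simp add: permutes_inverses[OF assms(1)])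
qed

lemma group_gen_sym_group:
  assumes l: "l > 0"
  shows "group (gen_sym_group l d)"
proof (rule groupI)
  let ?G = "gen_sym_group l d"
  show "x \<otimes>\<^bsub>?G\<^esub> y \<in> carrier ?G"
    if "x \<in> carrier ?G" "y \<in> carrier ?G" for x y
    unfolding gen_sym_group_simps using gen_sym_group_mult_closed[OF l that] .
  have mat: "x \<in> carrier_mat d d" if "x \<in> carrier ?G" for x
    using that by (simp add: gen_sym_group_def)
  show "\<one>\<^bsub>?G\<^esub> \<in> carrier ?G"
    unfolding gen_sym_group_simps one_mat_monomial by (rule monomial_mat_carrier[OF permutes_id l]) simp
  show "x \<otimes>\<^bsub>?G\<^esub> y \<otimes>\<^bsub>?G\<^esub> z =
      x \<otimes>\<^bsub>?G\<^esub> (y \<otimes>\<^bsub>?G\<^esub> z)"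
    if "x \<in> carrier ?G" "y \<in> carrier ?G" "z \<in> carrier ?G" for x y z
    unfolding gen_sym_group_simps using mat[OF that(1)] mat[OF that(2)] mat[OF that(3)] by (rule assoc_mult_mat)
  show "\<one>\<^bsub>?G\<^esub> \<otimes>\<^bsub>?G\<^esub> x = x" if "x \<in> carrier ?G" for x
    unfolding gen_sym_group_simps using left_mult_one_mat[OF mat[OF that]] .
  show "\<exists>y\<in>carrier ?G. y \<otimes>\<^bsub>?G\<^esub> x = \<one>\<^bsub>?G\<^esub>"
    if "x \<in> carrier ?G" for x
    using that
  proof (rule gen_sym_group_cases)
    fix \<pi> c assume \<pi>: "\<pi> permutes {1..d}" and c: "c \<in> {1..d} \<rightarrow>\<^sub>E {z. z ^ l = 1}" and x: "x = monomial_mat d \<pi> c"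
    have c1: "c j ^ l = 1" if "j \<in> {1..d}" for j using c that by blast
    have "monomial_mat d (inv' \<pi>) (\<lambda>j. inverse (c (inv' \<pi> j))) \<in> carrier ?G"
    proof (rule monomial_mat_carrier[OF permutes_inv[OF \<pi>] l])
      fix j assume "j \<in> {1..d}"
      then have "inv' \<pi> j \<in> {1..d}" using permutes_in_image[OF permutes_inv[OF \<pi>]] by simp
      then show "inverse (c (inv' \<pi> j)) ^ l = 1" using c1 by (simp add: power_inverse)
    qed
    then show ?thesis
      using monomial_mat_left_inverse[of \<pi> d l c, OF \<pi> l c1] unfolding gen_sym_group_simps x by blast
  qed
qed

text \<open>An induction principle for the monomial matrices supported on J: such a matrix is a
  permutation matrix times a diagonal one, whose entries are powers of \<xi> and are introduced one
  position at a time. It serves for J the full range, to determine \<open>\<Phi>\<close>, and for J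
  a fibre, to describe \<open>fiber_subgroup\<close>.\<close>

lemma monomial_mat_generated:
  assumes l: "l > 0" and roots: "{z. z ^ l = 1} = range (\<lambda>k::nat. \<xi> ^ k)" and J: "J \<subseteq> {1..d}"
    and mult: "\<And>v w. v \<in> carrier (gen_sym_group l d) \<Longrightarrow> w \<in> carrier (gen_sym_group l d) \<Longrightarrow> P v \<Longrightarrow> P w \<Longrightarrow> P (v * w)"
    and perm: "\<And>\<sigma>. \<sigma> permutes J \<Longrightarrow> P (perm_mat d \<sigma>)"
    and s0: "\<And>j. j \<in> J \<Longrightarrow> P (s0 d \<xi> j)"
    and \<pi>: "\<pi> permutes J" and c: "\<And>j. j \<in> {1..d} \<Longrightarrow> c j ^ l = 1" "\<And>j. j \<in> {1..d} - J \<Longrightarrow> c j = 1"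
  shows "P (monomial_mat d \<pi> c)"
proof -
  note id = permutes_id[of "{1..d}"]
  have \<xi>: "\<xi> ^ l = 1"
  proof -
    have "\<xi> ^ 1 \<in> {z. z ^ l = 1}" unfolding roots by blast
    then show ?thesis by simp
  qed
  have car: "monomial_mat d id a \<in> carrier (gen_sym_group l d)" if "\<And>j. j \<in> {1..d} \<Longrightarrow> a j ^ l = 1" for a
    by (rule monomial_mat_carrier[OF id l that])
  \<comment> \<open>The identity is itself a permutation matrix; it starts both inductions that
    follow.\<close>
  have one: "P (monomial_mat d id (\<lambda>_. 1))" using perm[OF permutes_id] by (simp add: perm_mat_monomial)
  have pow: "P (monomial_mat d id (\<lambda>i. if i = j then \<xi> ^ k else 1))" if j: "j \<in> J" for j k
  proof (induction k)
    case (Suc k)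
    have "P (monomial_mat d id (\<lambda>i. if i = j then \<xi> else 1) * monomial_mat d id (\<lambda>i. if i = j then \<xi> ^ k else 1))"
    proof (intro mult car)
      have "(\<xi> ^ k) ^ l = 1" using \<xi> by (metis mult.commute power_mult power_one)
      then show "(if i = j then \<xi> ^ k else 1) ^ l = 1" for i by simp
      show "(if i = j then \<xi> else 1) ^ l = 1" for i using \<xi> by simp
      show "P (monomial_mat d id (\<lambda>i. if i = j then \<xi> else 1))" using s0[OF j] by (simp only: s0_monomial)
    qed (rule Suc)
    also have "monomial_mat d id (\<lambda>i. if i = j then \<xi> else 1) * monomial_mat d id (\<lambda>i. if i = j then \<xi> ^ k else 1)
        = monomial_mat d id (\<lambda>i. if i = j then \<xi> ^ Suc k else 1)"
      unfolding monomial_mat_mult[OF id] comp_id by (rule monomial_mat_cong) simp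
    finally show ?case .
  qed (use one in \<open>simp only: power_0 if_cancel\<close>)
  have diag: "P (monomial_mat d id (\<lambda>i. if i \<in> A then c i else 1))" if "finite A" "A \<subseteq> J" for A
    using that
  proof (induction A)
    case (insert a A)
    have a: "a \<in> J" "a \<in> {1..d}" using insert.prems J by auto
    obtain k where k: "c a = \<xi> ^ k" using c(1)[OF a(2)] roots by blast
    have "P (monomial_mat d id (\<lambda>i. if i = a then \<xi> ^ k else 1) * monomial_mat d id (\<lambda>i. if i \<in> A then c i else 1))"
    proof (intro mult car)
      show "(if i = a then \<xi> ^ k else 1) ^ l = 1" for i using c(1)[OF a(2)] by (simp add: k)
      show "(if i \<in> A then c i else 1) ^ l = 1" if "i \<in> {1..d}" for i using c(1)[OF that] by simp
      show "P (monomial_mat d id (\<lambda>i. if i \<in> A then c i else 1))" using insert.IH insert.prems by blast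
    qed (rule pow[OF a(1)])
    also have "monomial_mat d id (\<lambda>i. if i = a then \<xi> ^ k else 1) * monomial_mat d id (\<lambda>i. if i \<in> A then c i else 1)
        = monomial_mat d id (\<lambda>i. if i \<in> insert a A then c i else 1)"
      unfolding monomial_mat_mult[OF id] comp_id
      by (rule monomial_mat_cong) (use insert.hyps k in auto)
    finally show ?case .
  qed (use one in simp)
  have finJ: "finite J" using J finite_subset by blast
  have \<pi>': "\<pi> permutes {1..d}" using \<pi> J by (rule permutes_subset)
  have "P (perm_mat d \<pi> * monomial_mat d id (\<lambda>i. if i \<in> J then c i else 1))"
  proof (intro mult perm diag finJ \<pi>)
    show "perm_mat d \<pi> \<in> carrier (gen_sym_group l d)"
      unfolding perm_mat_monomial by (rule monomial_mat_carrier[OF \<pi>' l]) simp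
    show "monomial_mat d id (\<lambda>i. if i \<in> J then c i else 1) \<in> carrier (gen_sym_group l d)"
      using c(1) by (intro car) simp
  qed simp
  also have "perm_mat d \<pi> * monomial_mat d id (\<lambda>i. if i \<in> J then c i else 1) = monomial_mat d \<pi> c"
    unfolding perm_mat_monomial monomial_mat_mult[OF id] comp_id
    by (rule monomial_mat_cong) (use c(2) in auto)
  finally show ?thesis .
qed

section \<open>The isomorphism of algebras on group elements\<close>

text \<open>The explicit coefficients satisfy the prescription of \<open>Phi_isos\<close> for
  permutation matrices; this and its analogue for \<open>s0\<close> are the base cases for
  identifying \<open>\<Phi>\<close>.\<close>

lemma Phi_coeff_perm_mat:
  assumes \<sigma>: "\<sigma> permutes {1..d}"
  shows "Phi_coeff l d (perm_mat d \<sigma>) =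
    (\<lambda>m. \<Sum>f\<in>gpd_obj l d. \<Sum>g\<in>gpd_obj l d. if g \<circ> \<sigma> = f then basis_elem (f, \<sigma>, g) m else 0)"
proof
  fix m :: mor
  obtain f' \<sigma>' g' where m: "m = (f', \<sigma>', g')" by (cases m)
  have "Phi_coeff l d (perm_mat d \<sigma>) m = (if m \<in> gpd_mor l d \<and> \<sigma>' = \<sigma> then 1 else 0)"
    using Phi_coeff_monomial_mat[OF \<sigma>, of f' \<sigma>' g' l "\<lambda>_. 1"] Phi_coeff_not_mor[of m l d]
    by (cases "m \<in> gpd_mor l d") (simp_all add: m perm_mat_monomial)
  also have "\<dots> = (if f' \<in> gpd_obj l d then if g' \<in> gpd_obj l d then
      if \<sigma>' = \<sigma> \<and> g' \<circ> \<sigma> = f' then 1 else 0 else 0 else 0)"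
    using \<sigma> by (auto simp: m gpd_mor_def)
  also have "\<dots> = (\<Sum>f\<in>gpd_obj l d. \<Sum>g\<in>gpd_obj l d. if g = g' then
      if f = f' then if \<sigma>' = \<sigma> \<and> g' \<circ> \<sigma> = f' then 1 else 0 else 0 else 0)"
    using finite_gpd_obj by simp
  also have "\<dots> = (\<Sum>f\<in>gpd_obj l d. \<Sum>g\<in>gpd_obj l d. if g \<circ> \<sigma> = f then basis_elem (f, \<sigma>, g) m else 0)"
    by (intro sum.cong refl) (auto simp: basis_elem_def m)
  finally show "Phi_coeff l d (perm_mat d \<sigma>) m =
    (\<Sum>f\<in>gpd_obj l d. \<Sum>g\<in>gpd_obj l d. if g \<circ> \<sigma> = f then basis_elem (f, \<sigma>, g) m else 0)" .
qed

lemma Phi_coeff_s0: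
  assumes k: "k \<in> {1..d}"
  shows "Phi_coeff l d (s0 d \<xi> k) = (\<lambda>m. \<Sum>f\<in>gpd_obj l d. \<xi> ^ f k * basis_elem (mor_id f) m)"
proof
  fix m :: mor
  obtain f' \<sigma>' g' where m: "m = (f', \<sigma>', g')" by (cases m)
  have pr: "(\<Prod>j\<in>{1..d}. (if j = k then \<xi> else 1) ^ f' j) = \<xi> ^ f' k"
  proof -
    have "(\<Prod>j\<in>{1..d}. (if j = k then \<xi> else 1) ^ f' j) = (\<Prod>j\<in>{1..d}. if j = k then \<xi> ^ f' j else 1)"
      by (intro prod.cong) auto
    then show ?thesis using k by simp
  qed
  have "Phi_coeff l d (s0 d \<xi> k) m = (if m \<in> gpd_mor l d \<and> \<sigma>' = id then \<xi> ^ f' k else 0)"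
    using Phi_coeff_monomial_mat[OF permutes_id, of f' \<sigma>' g' l d "\<lambda>j. if j = k then \<xi> else 1", unfolded pr]
      Phi_coeff_not_mor[of m l d]
    by (cases "m \<in> gpd_mor l d") (simp_all add: m s0_monomial)
  also have "\<dots> = (if f' \<in> gpd_obj l d then if g' = f' \<and> \<sigma>' = id then \<xi> ^ f' k else 0 else 0)"
    by (auto simp: m gpd_mor_def permutes_id)
  also have "\<dots> = (\<Sum>f\<in>gpd_obj l d. if f = f' then if g' = f' \<and> \<sigma>' = id then \<xi> ^ f' k else 0 else 0)"
    using finite_gpd_obj by simp
  also have "\<dots> = (\<Sum>f\<in>gpd_obj l d. \<xi> ^ f k * basis_elem (mor_id f) m)"
    by (intro sum.cong refl) (auto simp: basis_elem_def mor_id_def m)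
  finally show "Phi_coeff l d (s0 d \<xi> k) m = (\<Sum>f\<in>gpd_obj l d. \<xi> ^ f k * basis_elem (mor_id f) m)" .
qed

text \<open>\<open>\<Phi>\<close> is prescribed only on the first of these diagonal matrices;
  conjugation reaches the others.\<close>

lemma s0_conj_transpose:
  assumes "j \<in> {1..d}"
  shows "s0 d \<xi> j = perm_mat d (transpose 1 j) * (s0 d \<xi> 1 * perm_mat d (transpose 1 j))"
proof -
  have p: "transpose 1 j permutes {1..d}" using assms by (intro permutes_swap_id) auto
  show ?thesis
    unfolding perm_mat_monomial s0_monomial monomial_mat_mult[OF p] id_comp transpose_comp_involutory
    by (intro monomial_mat_cong) (auto simp: transpose_def)
qed

text \<open>Both sides are multiplicative in w and agree on permutation matrices and on the first
  \<open>s0\<close>, hence on every monomial matrix.\<close>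

lemma Phi_isos_basis_elem:
  assumes l: "l > 0" and roots: "{z. z ^ l = 1} = range (\<lambda>k::nat. \<xi> ^ k)"
    and \<Phi>: "\<Phi> \<in> Phi_isos l d \<xi>" and w: "w \<in> carrier (gen_sym_group l d)"
  shows "\<Phi> (basis_elem w) = Phi_coeff l d w"
proof -
  let ?G = "gen_sym_group l d"
  define P where "P w \<longleftrightarrow> \<Phi> (basis_elem w) = Phi_coeff l d w" for w
  have hom: "\<Phi> (a \<otimes>\<^bsub>group_algebra ?G\<^esub> b) = \<Phi> a \<otimes>\<^bsub>groupoid_algebra l d\<^esub> \<Phi> b"
    if "a \<in> carrier (group_algebra ?G)" "b \<in> carrier (group_algebra ?G)" for a b
    using \<Phi> that by (auto simp: Phi_isos_def algebra_isos_def ring_iso_def Ring.ring_hom_def)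
  have bas: "basis_elem v \<in> carrier (group_algebra ?G)" if "v \<in> carrier ?G" for v
    using that by (auto simp: group_algebra_def partial_algebra_def basis_elem_def)
  have mult: "P (v * w)" if vw: "v \<in> carrier ?G" "w \<in> carrier ?G" and P: "P v" "P w" for v w
  proof -
    have "basis_elem (v * w) = basis_elem v \<otimes>\<^bsub>group_algebra ?G\<^esub> basis_elem w"
    proof
      fix z
      have "(basis_elem v \<otimes>\<^bsub>group_algebra ?G\<^esub> basis_elem w) z =
          (\<Sum>x\<in>carrier ?G. \<Sum>y\<in>carrier ?G. if x * y = z then basis_elem v x * basis_elem w y else 0)"
        by (simp add: group_algebra_def partial_algebra_def gen_sym_group_simps)
      also have "\<dots> =
          (\<Sum>x\<in>carrier ?G. \<Sum>y\<in>carrier ?G. if y = w then if x = v then if v * w = z then 1 else 0 else 0 else 0)"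
        by (intro sum.cong refl) (auto simp: basis_elem_def)
      also have "\<dots> = basis_elem (v * w) z"
        using vw finite_gen_sym_group[OF l] by (auto simp: basis_elem_def)
      finally show "basis_elem (v * w) z = (basis_elem v \<otimes>\<^bsub>group_algebra ?G\<^esub> basis_elem w) z" ..
    qed
    then have "\<Phi> (basis_elem (v * w)) = Phi_coeff l d v \<otimes>\<^bsub>groupoid_algebra l d\<^esub> Phi_coeff l d w"
      using hom[OF bas bas] vw P by (simp add: P_def)
    also have "\<dots> = Phi_coeff l d (v * w)"
      by (rule ext) (simp add: groupoid_algebra_def partial_algebra_def Phi_coeff_mult[OF l vw])
    finally show ?thesis by (simp add: P_def)
  qed
  have perm: "P (perm_mat d \<sigma>)" if "\<sigma> permutes {1..d}" for \<sigma>
    using \<Phi> that by (simp add: P_def Phi_coeff_perm_mat Phi_isos_def)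
  have s0: "P (s0 d \<xi> j)" if j: "j \<in> {1..d}" for j
  proof -
    have p: "transpose 1 j permutes {1..d}" using j by (intro permutes_swap_id) auto
    have "P (s0 d \<xi> 1)" using \<Phi> j by (simp add: P_def Phi_coeff_s0 Phi_isos_def)
    moreover have "\<xi> ^ 1 \<in> {z. z ^ l = 1}" unfolding roots by blast
    then have "s0 d \<xi> 1 \<in> carrier ?G"
      unfolding s0_monomial by (intro monomial_mat_carrier[OF permutes_id l]) simp
    moreover have "perm_mat d (transpose 1 j) \<in> carrier ?G"
      unfolding perm_mat_monomial by (rule monomial_mat_carrier[OF p l]) simp
    ultimately show ?thesis
      unfolding s0_conj_transpose[OF j] by (intro mult gen_sym_group_mult_closed[OF l] perm[OF p])
  qed
  from w show ?thesis
  proof (rule gen_sym_group_cases)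
    fix \<pi> c assume \<pi>: "\<pi> permutes {1..d}" and c: "c \<in> {1..d} \<rightarrow>\<^sub>E {z. z ^ l = 1}" and w: "w = monomial_mat d \<pi> c"
    have "P (monomial_mat d \<pi> c)"
      by (rule monomial_mat_generated[OF l roots order_refl mult perm s0 \<pi>]) (use c in \<open>auto simp: PiE_iff\<close>)
    then show ?thesis by (simp add: P_def w)
  qed
qed

section \<open>The generalized Young subgroup as a stabilizer\<close>

text \<open>The group elements that carry the summand at f to the summand at g; for g = f this is
  the stabilizer.\<close>

definition transport_mats :: "nat \<Rightarrow> nat \<Rightarrow> (nat \<Rightarrow> nat) \<Rightarrow> (nat \<Rightarrow> nat) \<Rightarrow> complex mat set" where
  "transport_mats l d f g = {monomial_mat d \<pi> c | \<pi> c.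
     \<pi> permutes {1..d} \<and> g \<circ> \<pi> = f \<and> (\<forall>j\<in>{1..d}. c j ^ l = 1)}"

lemma transport_mats_carrier: "l > 0 \<Longrightarrow> transport_mats l d f g \<subseteq> carrier (gen_sym_group l d)"
  unfolding transport_mats_def using monomial_mat_carrier by blast

text \<open>Roots of unity are nonzero, so the matrix determines its permutation, and membership
  does not depend on the chosen presentation.\<close>

lemma monomial_mat_in_transport_mats:
  assumes "l > 0" "\<pi> permutes {1..d}" "\<forall>j\<in>{1..d}. c j ^ l = 1"
  shows "monomial_mat d \<pi> c \<in> transport_mats l d f g \<longleftrightarrow> g \<circ> \<pi> = f"
proof
  assume "monomial_mat d \<pi> c \<in> transport_mats l d f g"
  then obtain \<pi>' c' where *: "monomial_mat d \<pi> c = monomial_mat d \<pi>' c'" "\<pi>' permutes {1..d}" "g \<circ> \<pi>' = f"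
    "\<And>j. j \<in> {1..d} \<Longrightarrow> c' j ^ l = 1" by (auto simp: transport_mats_def)
  have nz: "c j \<noteq> 0" "c' j \<noteq> 0" if "j \<in> {1..d}" for j
    using assms(1) bspec[OF assms(3) that] *(4)[OF that] by (auto simp: power_0_left)
  have "\<pi> = \<pi>'" using monomial_mat_eq_iff[of \<pi> d \<pi>' c c', OF assms(2) *(2) nz] *(1) by blast
  with * show "g \<circ> \<pi> = f" by simp
qed (use assms in \<open>unfold transport_mats_def, blast\<close>)

lemma transport_mats_mult:
  assumes "v \<in> transport_mats l d g h" "w \<in> transport_mats l d f g"
  shows "v * w \<in> transport_mats l d f h"
proof -
  obtain \<pi> c where v: "v = monomial_mat d \<pi> c" "\<pi> permutes {1..d}" "h \<circ> \<pi> = g" "\<forall>j\<in>{1..d}. c j ^ l = 1"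
    using assms(1) by (auto simp: transport_mats_def)
  obtain \<pi>' c' where w: "w = monomial_mat d \<pi>' c'" "\<pi>' permutes {1..d}" "g \<circ> \<pi>' = f" "\<forall>j\<in>{1..d}. c' j ^ l = 1"
    using assms(2) by (auto simp: transport_mats_def)
  have "(c (\<pi>' j) * c' j) ^ l = 1" if "j \<in> {1..d}" for j
    using that v(4) w(4) permutes_in_image[OF w(2)] by (simp add: power_mult_distrib)
  moreover have "h \<circ> (\<pi> \<circ> \<pi>') = f" using v w by (simp add: o_assoc)
  ultimately show ?thesis
    unfolding v(1) w(1) monomial_mat_mult[OF w(2)] transport_mats_def
    using permutes_compose[OF w(2) v(2)] by blast
qed

lemma transport_mats_inv:
  assumes l: "l > 0" and w: "w \<in> transport_mats l d f g"
  shows "inv\<^bsub>gen_sym_group l d\<^esub> w \<in> transport_mats l d g f"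
proof -
  obtain \<pi> c where w': "w = monomial_mat d \<pi> c" "\<pi> permutes {1..d}" "g \<circ> \<pi> = f" "\<And>j. j \<in> {1..d} \<Longrightarrow> c j ^ l = 1"
    using w by (auto simp: transport_mats_def)
  define y where "y = monomial_mat d (inv' \<pi>) (\<lambda>j. inverse (c (inv' \<pi> j)))"
  have "f \<circ> inv' \<pi> = g" using w'(3) permutes_inv_o[OF w'(2)] by (metis comp_assoc comp_id)
  moreover have "inverse (c (inv' \<pi> j)) ^ l = 1" if "j \<in> {1..d}" for j
    using that w'(4)[of "inv' \<pi> j"] permutes_in_image[OF permutes_inv[OF w'(2)]] by (simp add: power_inverse)
  ultimately have y: "y \<in> transport_mats l d g f"
    unfolding y_def transport_mats_def using permutes_inv[OF w'(2)] by blast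
  have "y \<otimes>\<^bsub>gen_sym_group l d\<^esub> w = \<one>\<^bsub>gen_sym_group l d\<^esub>"
    unfolding gen_sym_group_simps y_def w'(1) by (rule monomial_mat_left_inverse[OF w'(2) l w'(4)])
  then have "inv\<^bsub>gen_sym_group l d\<^esub> w = y"
    using group.inv_equality[OF group_gen_sym_group[OF l]] y w transport_mats_carrier[OF l] by blast
  with y show ?thesis by simp
qed

lemma one_in_transport_mats: "1\<^sub>m d \<in> transport_mats l d f f"
  unfolding one_mat_monomial transport_mats_def using permutes_id by fastforce

lemma subgroup_transport_mats:
  assumes l: "l > 0"
  shows "subgroup (transport_mats l d f f) (gen_sym_group l d)"
proof (rule group.subgroupI[OF group_gen_sym_group[OF l] transport_mats_carrier[OF l]])
  show "transport_mats l d f f \<noteq> {}" using one_in_transport_mats by blast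
qed (use transport_mats_inv[OF l] transport_mats_mult in \<open>simp_all add: gen_sym_group_simps\<close>)

lemma permutes_restrict_invariant:
  assumes "\<pi> permutes S" "finite A" "\<And>x. x \<in> A \<Longrightarrow> \<pi> x \<in> A"
  shows "(\<lambda>x. if x \<in> A then \<pi> x else x) permutes A"
proof (rule bij_imp_permutes)
  have inj: "inj_on \<pi> A" using permutes_inj_on[OF assms(1)] .
  then have "bij_betw \<pi> A A"
    unfolding bij_betw_def using endo_inj_surj[OF assms(2) _ inj] assms(3) by blast
  then show "bij_betw (\<lambda>x. if x \<in> A then \<pi> x else x) A A" by (subst bij_betw_cong[of _ _ \<pi>]) auto
qed simp

lemma fiber_subgroup_subset:
  assumes l: "l > 0" and \<xi>: "\<xi> ^ l = 1" and f: "f \<in> gpd_obj l d"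
  shows "fiber_subgroup l d \<xi> f i \<subseteq> transport_mats l d f f"
  unfolding fiber_subgroup_def
proof (rule group.generate_subgroup_incl[OF group_gen_sym_group[OF l] _ subgroup_transport_mats[OF l]], intro Un_least subsetI)
  fix w assume "w \<in> s0 d \<xi> ` {j \<in> {1..d}. f j = i}"
  then show "w \<in> transport_mats l d f f"
    using permutes_id \<xi> unfolding s0_monomial transport_mats_def by fastforce
next
  fix w assume "w \<in> perm_mat d ` {\<sigma>. \<sigma> permutes {j \<in> {1..d}. f j = i}}"
  then obtain \<sigma> where \<sigma>: "\<sigma> permutes {j \<in> {1..d}. f j = i}" and w: "w = perm_mat d \<sigma>" by blast
  have "f (\<sigma> x) = f x" for x
    using permutes_in_image[OF \<sigma>, of x] permutes_not_in[OF \<sigma>, of x]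
    by (cases "x \<in> {j \<in> {1..d}. f j = i}") auto
  then have "f \<circ> \<sigma> = f" by auto
  moreover have "\<sigma> permutes {1..d}" by (rule permutes_subset[OF \<sigma>]) auto
  ultimately show "w \<in> transport_mats l d f f"
    unfolding w perm_mat_monomial transport_mats_def by fastforce
qed

text \<open>Every fibre subgroup stabilizes f, and conversely a stabilizing matrix is split fibre by
  fibre, following the \<open>foldr\<close> in the definition.\<close>

lemma gen_young_subgroup_eq:
  assumes l: "l > 0" and roots: "{z. z ^ l = 1} = range (\<lambda>k::nat. \<xi> ^ k)" and f: "f \<in> gpd_obj l d"
  shows "gen_young_subgroup l d \<xi> f = transport_mats l d f f"
proof -
  let ?G = "gen_sym_group l d"
  define K where "K is = foldr (\<lambda>i K. fiber_subgroup l d \<xi> f i <#>\<^bsub>?G\<^esub> K) is {\<one>\<^bsub>?G\<^esub>}" for "is"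
  have "\<xi> ^ 1 \<in> {z. z ^ l = 1}" unfolding roots by blast
  then have \<xi>: "\<xi> ^ l = 1" by simp
  have sub: "K is \<subseteq> transport_mats l d f f" for "is"
  proof (induction "is")
    case Nil
    then show ?case by (simp add: K_def gen_sym_group_simps one_in_transport_mats)
  next
    case (Cons i "is")
    then show ?case
      using fiber_subgroup_subset[OF l \<xi> f, of i] transport_mats_mult
      by (fastforce simp: K_def set_mult_def gen_sym_group_simps)
  qed
  \<comment> \<open>Generalized to partial products: a matrix that is trivial outside the fibres
    over \<open>is\<close> lies in the product of their subgroups.\<close>
  have "monomial_mat d \<pi> c \<in> K is"
    if "\<pi> permutes {1..d}" "f \<circ> \<pi> = f" "\<And>j. j \<in> {1..d} \<Longrightarrow> c j ^ l = 1"
      "\<And>j. j \<in> {1..d} \<Longrightarrow> f j \<notin> set is \<Longrightarrow> \<pi> j = j \<and> c j = 1" for "is" \<pi> c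
    using that
  proof (induction "is" arbitrary: \<pi> c)
    case Nil
    have "\<pi> = id"
    proof
      fix j show "\<pi> j = id j"
        using Nil.prems(4)[of j] permutes_not_in[OF Nil.prems(1), of j] by (cases "j \<in> {1..d}") auto
    qed
    then have "monomial_mat d \<pi> c = 1\<^sub>m d"
      unfolding one_mat_monomial using Nil.prems(4) by (auto intro: monomial_mat_cong)
    then show ?case by (simp add: K_def gen_sym_group_simps)
  next
    case (Cons i "is")
    note p = Cons.prems(1)
    have f\<pi>: "f (\<pi> x) = f x" for x using fun_cong[OF Cons.prems(2), of x] by simp
    define A where "A = {j \<in> {1..d}. f j = i}"
    have A: "A \<subseteq> {1..d}" "finite A" by (auto simp: A_def)
    \<comment> \<open>The matrix is cut into its part on the fibre A over i and its part elsewhere;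
      both make sense because \<pi> preserves A.\<close>
    define \<pi>1 where "\<pi>1 x = (if x \<in> A then \<pi> x else x)" for x
    define c1 where "c1 x = (if x \<in> A then c x else 1)" for x
    define c2 where "c2 x = (if x \<in> A then 1 else c x)" for x
    have \<pi>A: "\<pi> x \<in> A \<longleftrightarrow> x \<in> A" for x
      using f\<pi>[of x] permutes_in_image[OF p, of x] by (auto simp: A_def)
    have p1: "\<pi>1 permutes A"
      unfolding \<pi>1_def using permutes_restrict_invariant[OF p A(2)] \<pi>A by blast
    have p1': "\<pi>1 permutes {1..d}" using p1 A(1) by (rule permutes_subset)
    \<comment> \<open>As a quotient of permutations it is a permutation at once; the next claim
      shows that it is \<pi> outside A and the identity on A.\<close>
    define \<pi>2 where "\<pi>2 = inv' \<pi>1 \<circ> \<pi>"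
    have \<pi>2: "\<pi>2 x = (if x \<in> A then x else \<pi> x)" for x
    proof -
      have "\<pi>1 (if x \<in> A then x else \<pi> x) = \<pi> x" using \<pi>A[of x] by (simp add: \<pi>1_def)
      then show ?thesis using permutes_inv_eq[OF p1', of "\<pi> x"] by (simp add: \<pi>2_def)
    qed
    have p2: "\<pi>2 permutes {1..d}" unfolding \<pi>2_def using permutes_compose[OF p permutes_inv[OF p1']] .
    have eq: "monomial_mat d \<pi> c = monomial_mat d \<pi>1 c1 * monomial_mat d \<pi>2 c2"
    proof -
      have "\<pi>1 \<circ> \<pi>2 = \<pi>" unfolding \<pi>2_def o_assoc permutes_inv_o[OF p1'] by simp
      moreover have "c1 (\<pi>2 j) * c2 j = c j" for j using \<pi>A[of j] by (simp add: c1_def c2_def \<pi>2)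
      ultimately show ?thesis unfolding monomial_mat_mult[OF p2] by simp
    qed
    have "monomial_mat d \<pi>1 c1 \<in> fiber_subgroup l d \<xi> f i"
    proof (rule monomial_mat_generated[OF l roots A(1) _ _ _ p1])
      show "v * w \<in> fiber_subgroup l d \<xi> f i"
        if "v \<in> fiber_subgroup l d \<xi> f i" "w \<in> fiber_subgroup l d \<xi> f i" for v w
        using generate.eng[OF that[unfolded fiber_subgroup_def]]
        by (simp add: fiber_subgroup_def gen_sym_group_simps)
      show "perm_mat d \<sigma> \<in> fiber_subgroup l d \<xi> f i" if "\<sigma> permutes A" for \<sigma>
        unfolding fiber_subgroup_def using that by (intro generate.incl) (auto simp: A_def)
      show "s0 d \<xi> j \<in> fiber_subgroup l d \<xi> f i" if "j \<in> A" for j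
        unfolding fiber_subgroup_def using that by (intro generate.incl) (auto simp: A_def)
    qed (use Cons.prems(3) in \<open>auto simp: c1_def\<close>)
    moreover have "monomial_mat d \<pi>2 c2 \<in> K is"
    proof (rule Cons.IH[OF p2])
      show "f \<circ> \<pi>2 = f" using f\<pi> by (auto simp: \<pi>2)
      show "c2 j ^ l = 1" if "j \<in> {1..d}" for j using Cons.prems(3)[OF that] by (simp add: c2_def)
      show "\<pi>2 j = j \<and> c2 j = 1" if "j \<in> {1..d}" "f j \<notin> set is" for j
        using Cons.prems(4)[of j] that by (auto simp: \<pi>2 c2_def A_def)
    qed
    ultimately show ?case
      unfolding eq by (auto simp: K_def set_mult_def gen_sym_group_simps)
  qed
  moreover have "f j \<in> set [1..<Suc l]" if "j \<in> {1..d}" for j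
  proof -
    have "f j \<in> {1..l}" using f that unfolding gpd_obj_def by blast
    then show ?thesis by (simp add: less_Suc_eq_le del: upt_Suc)
  qed
  ultimately have "monomial_mat d \<pi> c \<in> K [1..<Suc l]"
    if "\<pi> permutes {1..d}" "f \<circ> \<pi> = f" "\<forall>j\<in>{1..d}. c j ^ l = 1" for \<pi> c
    using that by blast
  then have "transport_mats l d f f \<subseteq> K [1..<Suc l]" unfolding transport_mats_def by blast
  with sub show ?thesis unfolding gen_young_subgroup_def K_def by blast
qed

text \<open>Left translation by x maps the stabilizer bijectively onto this set. Its size,
  independent of g, becomes the constant in the averaging hypothesis for the induced module.\<close>

lemma card_transport_mats:
  assumes l: "l > 0" and x: "x \<in> transport_mats l d f g"
  shows "card (transport_mats l d f g) = card (transport_mats l d f f)"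
proof -
  let ?G = "gen_sym_group l d"
  interpret group "gen_sym_group l d" by (rule group_gen_sym_group[OF l])
  have xc: "x \<in> carrier (gen_sym_group l d)" using x transport_mats_carrier[OF l] by blast
  have "transport_mats l d f g = (\<lambda>y. x \<otimes>\<^bsub>?G\<^esub> y) ` transport_mats l d f f"
  proof (intro subset_antisym subsetI)
    fix w assume w: "w \<in> transport_mats l d f g"
    then have "inv\<^bsub>?G\<^esub> x \<otimes>\<^bsub>?G\<^esub> w \<in> transport_mats l d f f"
      using transport_mats_mult transport_mats_inv[OF l x] by (simp add: gen_sym_group_simps)
    moreover have "w = x \<otimes>\<^bsub>?G\<^esub> (inv\<^bsub>?G\<^esub> x \<otimes>\<^bsub>?G\<^esub> w)"
      using w xc transport_mats_carrier[OF l] by (simp add: m_assoc[symmetric] subset_iff)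
    ultimately show "w \<in> (\<lambda>y. x \<otimes>\<^bsub>?G\<^esub> y) ` transport_mats l d f f" by blast
  qed (use transport_mats_mult x in \<open>auto simp: gen_sym_group_simps\<close>)
  moreover have "inj_on (\<lambda>y. x \<otimes>\<^bsub>?G\<^esub> y) (transport_mats l d f f)"
    by (rule inj_on_subset[OF inj_on_cmult[OF xc] transport_mats_carrier[OF l]])
  ultimately show ?thesis by (simp add: card_image)
qed

section \<open>Induced representations\<close>

lemma linear_mapsD:
  assumes "T \<in> linear_maps V W"
  shows "v \<in> carrier V \<Longrightarrow> T v \<in> carrier W"
    and "u \<in> carrier V \<Longrightarrow> v \<in> carrier V \<Longrightarrow> T (u \<oplus>\<^bsub>V\<^esub> v) = T u \<oplus>\<^bsub>W\<^esub> T v"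
    and "v \<in> carrier V \<Longrightarrow> T (c \<odot>\<^bsub>V\<^esub> v) = c \<odot>\<^bsub>W\<^esub> T v"
  using assms by (auto simp: linear_maps_def)

lemma linear_maps_zero:
  assumes "module complex_field V" "module complex_field W" "T \<in> linear_maps V W"
  shows "T \<zero>\<^bsub>V\<^esub> = \<zero>\<^bsub>W\<^esub>"
proof -
  interpret V: module complex_field V by fact
  interpret W: module complex_field W by fact
  have "T (0 \<odot>\<^bsub>V\<^esub> \<zero>\<^bsub>V\<^esub>) = 0 \<odot>\<^bsub>W\<^esub> T \<zero>\<^bsub>V\<^esub>" by (rule linear_mapsD(3)[OF assms(3)]) simp
  then show ?thesis
    using V.smult_l_null[of "\<zero>\<^bsub>V\<^esub>"] W.smult_l_null[of "T \<zero>\<^bsub>V\<^esub>"] linear_mapsD(1)[OF assms(3)] by simp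
qed

lemma linear_maps_finsum:
  assumes V: "module complex_field V" and W: "module complex_field W" and T: "T \<in> linear_maps V W"
    and A: "finite A" and F: "F \<in> A \<rightarrow> carrier V"
  shows "T (finsum V F A) = finsum W (\<lambda>a. T (F a)) A"
proof -
  interpret V: module complex_field V by fact
  interpret W: module complex_field W by fact
  show ?thesis using A F
  proof (induction A)
    case empty
    then show ?case by (simp add: linear_maps_zero[OF V W T])
  next
    case (insert a A)
    then have "F \<in> A \<rightarrow> carrier V" "F a \<in> carrier V" by auto
    moreover from this have "(\<lambda>a. T (F a)) \<in> A \<rightarrow> carrier W" "T (F a) \<in> carrier W"
      using linear_mapsD(1)[OF T] by auto
    ultimately show ?case
      using insert linear_mapsD(2)[OF T, of "F a" "finsum V F A"] V.finsum_closed[of F A] by simp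
  qed
qed

lemma finsum_const_complex:
  assumes V: "module complex_field V" and "finite A" "v \<in> carrier V"
  shows "finsum V (\<lambda>_. v) A = of_nat (card A) \<odot>\<^bsub>V\<^esub> v"
proof -
  interpret module complex_field V by fact
  show ?thesis using assms(2)
  proof (induction A)
    case empty
    then show ?case using smult_l_null[OF assms(3)] by simp
  next
    case (insert a A)
    have "(1 + of_nat (card A)) \<odot>\<^bsub>V\<^esub> v = (1 \<odot>\<^bsub>V\<^esub> v) \<oplus>\<^bsub>V\<^esub> (of_nat (card A) \<odot>\<^bsub>V\<^esub> v)"
      using smult_l_distr[of 1 "of_nat (card A)" v] assms(3) by simp
    then show ?case using insert assms(3) smult_one[OF assms(3)] by simp
  qed
qed

lemma finsum_direct_sum:
  assumes V: "\<And>i. i \<in> I \<Longrightarrow> module complex_field (V i)" and A: "finite A"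
    and F: "F \<in> A \<rightarrow> carrier (direct_sum I V)" and i: "i \<in> I"
  shows "finsum (direct_sum I V) F A i = finsum (V i) (\<lambda>a. F a i) A"
proof -
  interpret S: module complex_field "direct_sum I V" by (rule module_direct_sum[OF V])
  interpret Vi: module complex_field "V i" by (rule V[OF i])
  show ?thesis using A F
  proof (induction A)
    case (insert a A)
    then have "F \<in> A \<rightarrow> carrier (direct_sum I V)" "F a \<in> carrier (direct_sum I V)" by auto
    moreover from this have "(\<lambda>a. F a i) \<in> A \<rightarrow> carrier (V i)" "F a i \<in> carrier (V i)"
      using i by (auto simp: Pi_iff PiE_iff)
    ultimately show ?case using insert i by (simp del: direct_sum_simps(1))
  qed (use i in simp)
qed

lemma finsum_submodule:
  assumes V: "module complex_field V" and W: "submodule W complex_field V" and A: "finite A"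
    and F: "F \<in> A \<rightarrow> W"
  shows "finsum (V\<lparr>carrier := W\<rparr>) F A = finsum V F A" and "finsum V F A \<in> W"
proof -
  interpret V: module complex_field V by fact
  interpret W: module complex_field "V\<lparr>carrier := W\<rparr>" using submodule.submodule_is_module[OF W V] .
  have sub: "W \<subseteq> carrier V" using W V by (simp add: complex_submodule_iff)
  show eq: "finsum (V\<lparr>carrier := W\<rparr>) F A = finsum V F A" using A F
  proof (induction A)
    case (insert a A)
    then have "F \<in> A \<rightarrow> W" "F a \<in> W" by auto
    then show ?case using insert sub by (simp add: Pi_iff subset_iff)
  qed simp
  show "finsum V F A \<in> W" using W.finsum_closed[of F A] F unfolding eq by simp
qed

text \<open>Transport of structure: the axioms for Q are pulled back along the bijection, so the
  quotient and its action never have to be verified by hand. The condition on zero ties the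
  designated zero of Q to T before Q is known to be a module.\<close>

lemma isomorphic_representations_transport:
  assumes rep: "representation G V \<rho>" and bij: "bij_betw T (carrier V) (carrier Q)"
    and add: "\<And>u v. u \<in> carrier V \<Longrightarrow> v \<in> carrier V \<Longrightarrow> T (u \<oplus>\<^bsub>V\<^esub> v) = T u \<oplus>\<^bsub>Q\<^esub> T v"
    and smult: "\<And>c v. v \<in> carrier V \<Longrightarrow> T (c \<odot>\<^bsub>V\<^esub> v) = c \<odot>\<^bsub>Q\<^esub> T v"
    and zero: "T \<zero>\<^bsub>V\<^esub> = \<zero>\<^bsub>Q\<^esub>"
    and equiv: "\<And>g v. g \<in> carrier G \<Longrightarrow> v \<in> carrier V \<Longrightarrow> T (\<rho> g v) = \<tau> g (T v)"
  shows "isomorphic_representations G V \<rho> Q \<tau>"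
proof -
  have G: "group G" and V: "module complex_field V"
    and lin: "\<And>g. g \<in> carrier G \<Longrightarrow> \<rho> g \<in> linear_maps V V"
    and one: "\<And>v. v \<in> carrier V \<Longrightarrow> \<rho> \<one>\<^bsub>G\<^esub> v = v"
    and mult: "\<And>g h v. g \<in> carrier G \<Longrightarrow> h \<in> carrier G \<Longrightarrow> v \<in> carrier V \<Longrightarrow>
      \<rho> (g \<otimes>\<^bsub>G\<^esub> h) v = \<rho> g (\<rho> h v)"
    using rep by (auto simp: representation_def)
  interpret G: group G by (rule G)
  interpret V: module complex_field V by (rule V)
  have img: "carrier Q = T ` carrier V" using bij by (simp add: bij_betw_def)
  have r: "T v \<in> carrier Q" if "v \<in> carrier V" for v using that img by blast
  have ex: "\<exists>v\<in>carrier V. q = T v" if "q \<in> carrier Q" for q using that img by blast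
  have Q: "module complex_field Q"
  proof (rule complex_moduleI)
    fix a b p q s assume "p \<in> carrier Q"
    then obtain u where u: "u \<in> carrier V" "p = T u" using ex by blast
    show "a \<odot>\<^bsub>Q\<^esub> p \<in> carrier Q" using r u V.smult_closed[of a u] by (simp flip: smult)
    show "\<zero>\<^bsub>Q\<^esub> \<oplus>\<^bsub>Q\<^esub> p = p" using u by (simp flip: add zero)
    show "(a + b) \<odot>\<^bsub>Q\<^esub> p = (a \<odot>\<^bsub>Q\<^esub> p) \<oplus>\<^bsub>Q\<^esub> (b \<odot>\<^bsub>Q\<^esub> p)"
      using u V.smult_l_distr[of a b u] V.smult_closed[of _ u] by (simp flip: add smult)
    show "(a * b) \<odot>\<^bsub>Q\<^esub> p = a \<odot>\<^bsub>Q\<^esub> (b \<odot>\<^bsub>Q\<^esub> p)"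
      using u V.smult_assoc1[of a b u] V.smult_closed[of b u] by (simp flip: smult)
    show "1 \<odot>\<^bsub>Q\<^esub> p = p" using u V.smult_one[of u] by (simp flip: smult)
    show "0 \<odot>\<^bsub>Q\<^esub> p = \<zero>\<^bsub>Q\<^esub>" using u V.smult_l_null[of u] by (simp flip: smult zero)
    assume "q \<in> carrier Q"
    then obtain v where v: "v \<in> carrier V" "q = T v" using ex by blast
    show "p \<oplus>\<^bsub>Q\<^esub> q \<in> carrier Q" using u v r by (simp flip: add)
    show "p \<oplus>\<^bsub>Q\<^esub> q = q \<oplus>\<^bsub>Q\<^esub> p" using u v V.M.a_comm[of u v] by (simp flip: add)
    show "a \<odot>\<^bsub>Q\<^esub> (p \<oplus>\<^bsub>Q\<^esub> q) = (a \<odot>\<^bsub>Q\<^esub> p) \<oplus>\<^bsub>Q\<^esub> (a \<odot>\<^bsub>Q\<^esub> q)"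
      using u v V.smult_r_distr[of a u v] V.smult_closed[of a] by (simp flip: add smult)
    assume "s \<in> carrier Q"
    then obtain w where w: "w \<in> carrier V" "s = T w" using ex by blast
    show "p \<oplus>\<^bsub>Q\<^esub> q \<oplus>\<^bsub>Q\<^esub> s = p \<oplus>\<^bsub>Q\<^esub> (q \<oplus>\<^bsub>Q\<^esub> s)"
      using u v w V.M.a_assoc[of u v w] by (simp flip: add)
  next
    show "\<zero>\<^bsub>Q\<^esub> \<in> carrier Q" unfolding zero[symmetric] by (rule r) simp
  qed
  have "representation G Q \<tau>"
    unfolding representation_def
  proof (intro conjI ballI G Q)
    fix g assume g: "g \<in> carrier G"
    note gv = linear_mapsD[OF lin[OF g]]
    show "\<tau> g \<in> linear_maps Q Q"
      unfolding linear_maps_def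
    proof (intro CollectI conjI ballI allI Pi_I)
      fix c p q assume "p \<in> carrier Q"
      then obtain u where u: "u \<in> carrier V" "p = T u" using ex by blast
      show "\<tau> g p \<in> carrier Q" using u r gv by (simp flip: equiv[OF g])
      show "\<tau> g (c \<odot>\<^bsub>Q\<^esub> p) = c \<odot>\<^bsub>Q\<^esub> \<tau> g p"
        using u gv V.smult_closed[of c u] by (simp flip: equiv[OF g] smult)
      assume "q \<in> carrier Q"
      then obtain v where v: "v \<in> carrier V" "q = T v" using ex by blast
      show "\<tau> g (p \<oplus>\<^bsub>Q\<^esub> q) = \<tau> g p \<oplus>\<^bsub>Q\<^esub> \<tau> g q"
        using u v gv by (simp flip: equiv[OF g] add)
    qed
    fix h q assume h: "h \<in> carrier G" and "q \<in> carrier Q"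
    then obtain v where v: "v \<in> carrier V" "q = T v" using ex by blast
    show "\<tau> (g \<otimes>\<^bsub>G\<^esub> h) q = \<tau> g (\<tau> h q)"
      using v g h mult linear_mapsD(1)[OF lin[OF h]] by (simp flip: equiv)
  next
    fix q assume "q \<in> carrier Q"
    then obtain v where v: "v \<in> carrier V" "q = T v" using ex by blast
    show "\<tau> \<one>\<^bsub>G\<^esub> q = q" using v one by (simp flip: equiv)
  qed
  moreover have "T \<in> linear_maps V Q" using r add smult by (auto simp: linear_maps_def)
  ultimately show ?thesis using rep bij equiv unfolding isomorphic_representations_def by blast
qed

lemma subrepresentation:
  assumes rep: "representation G V \<rho>" and H: "subgroup H G" and W: "submodule W complex_field V"
    and stable: "\<And>h w. h \<in> H \<Longrightarrow> w \<in> W \<Longrightarrow> \<rho> h w \<in> W"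
  shows "representation (G\<lparr>carrier := H\<rparr>) (V\<lparr>carrier := W\<rparr>) \<rho>"
proof -
  have G: "group G" and V: "module complex_field V" using rep by (auto simp: representation_def)
  have sub: "H \<subseteq> carrier G" "W \<subseteq> carrier V"
    using subgroup.subset[OF H] W by (auto simp: complex_submodule_iff[OF V])
  have "group (G\<lparr>carrier := H\<rparr>)" using subgroup.subgroup_is_group[OF H G] .
  moreover have "module complex_field (V\<lparr>carrier := W\<rparr>)" using submodule.submodule_is_module[OF W V] .
  ultimately show ?thesis
    using rep sub stable unfolding representation_def linear_maps_def by (auto simp: subset_iff)
qed

text \<open>
  If \<open>E\<close> is a projection of \<open>V\<close> onto \<open>W\<close> that annihilates the translates of \<open>W\<close> by elements
  outside \<open>H\<close>, and if the conjugates of \<open>E\<close> sum up to multiplication by \<open>|H|\<close>, then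
  \<open>v \<mapsto> \<Sum>\<^sub>x x \<otimes> E (x\<inverse> v)\<close> is, up to the factor \<open>|H|\<close>, inverse to
  \<open>g \<otimes> w \<mapsto> g w\<close>. This avoids choosing coset representatives.
\<close>

theorem isomorphic_induced_module:
  fixes V :: "(complex, 'v) module" and G :: "('g, 'k) monoid_scheme"
  assumes rep: "representation G V \<rho>" and finG: "finite (carrier G)" and H: "subgroup H G"
    and W: "submodule W complex_field V"
    and stable: "\<And>h w. h \<in> H \<Longrightarrow> w \<in> W \<Longrightarrow> \<rho> h w \<in> W"
    and E: "E \<in> linear_maps V V" and E_into: "\<And>v. v \<in> carrier V \<Longrightarrow> E v \<in> W"
    and E_on: "\<And>w. w \<in> W \<Longrightarrow> E w = w"
    and E_off: "\<And>g w. g \<in> carrier G \<Longrightarrow> g \<notin> H \<Longrightarrow> w \<in> W \<Longrightarrow> E (\<rho> g w) = \<zero>\<^bsub>V\<^esub>"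
    and avg: "\<And>v. v \<in> carrier V \<Longrightarrow>
      finsum V (\<lambda>x. \<rho> x (E (\<rho> (inv\<^bsub>G\<^esub> x) v))) (carrier G) = of_nat (card H) \<odot>\<^bsub>V\<^esub> v"
  shows "isomorphic_representations G V \<rho> (induced_module G H (V\<lparr>carrier := W\<rparr>) \<rho>) (induced_action G)"
proof -
  let ?W = "V\<lparr>carrier := W\<rparr>"
  define GT where "GT = group_tensor G ?W"
  have GT_eq: "GT = direct_sum (carrier G) (\<lambda>_. ?W)" by (simp add: GT_def group_tensor_def)
  have grp: "group G" and Vm: "module complex_field V"
    and lin: "\<And>g. g \<in> carrier G \<Longrightarrow> \<rho> g \<in> linear_maps V V"
    and one: "\<And>v. v \<in> carrier V \<Longrightarrow> \<rho> \<one>\<^bsub>G\<^esub> v = v"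
    and mult: "\<And>g h v. g \<in> carrier G \<Longrightarrow> h \<in> carrier G \<Longrightarrow> v \<in> carrier V \<Longrightarrow>
      \<rho> (g \<otimes>\<^bsub>G\<^esub> h) v = \<rho> g (\<rho> h v)"
    using rep by (auto simp: representation_def)
  have Wm: "module complex_field ?W" using submodule.submodule_is_module[OF W Vm] .
  have GTm: "module complex_field GT" unfolding GT_eq by (rule module_direct_sum[OF Wm])
  interpret G: group G by (rule grp)
  interpret V: module complex_field V by (rule Vm)
  interpret GT: module complex_field GT by (rule GTm)
  have W_sub: "W \<subseteq> carrier V" and W_zero: "\<zero>\<^bsub>V\<^esub> \<in> W" and W_add: "\<And>u v. u \<in> W \<Longrightarrow> v \<in> W \<Longrightarrow> u \<oplus>\<^bsub>V\<^esub> v \<in> W"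
    using W by (auto simp: complex_submodule_iff[OF Vm])
  have H_sub: "H \<subseteq> carrier G" using H by (rule subgroup.subset)
  have finH: "finite H" using H_sub finG finite_subset by blast
  define k where "k = (of_nat (card H) :: complex)"
  have "H \<noteq> {}" using subgroup.one_closed[OF H] by blast
  then have k: "k \<noteq> 0" using finH by (simp add: k_def)
  note \<rho>_closed = linear_mapsD(1)[OF lin] and \<rho>_add = linear_mapsD(2)[OF lin]
    and \<rho>_smult = linear_mapsD(3)[OF lin]
  note \<rho>_zero = linear_maps_zero[OF Vm Vm lin]
  have carGT: "u \<in> carrier GT \<longleftrightarrow> u \<in> carrier G \<rightarrow>\<^sub>E W" for u by (simp add: GT_eq)
  have addGT: "u \<oplus>\<^bsub>GT\<^esub> v = (\<lambda>x\<in>carrier G. u x \<oplus>\<^bsub>V\<^esub> v x)" for u v by (simp add: GT_eq)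
  have smultGT: "c \<odot>\<^bsub>GT\<^esub> u = (\<lambda>x\<in>carrier G. c \<odot>\<^bsub>V\<^esub> u x)" for c u by (simp add: GT_eq)
  have zeroGT: "\<zero>\<^bsub>GT\<^esub> = (\<lambda>x\<in>carrier G. \<zero>\<^bsub>V\<^esub>)" by (simp add: GT_eq)
  have uW: "u x \<in> W" "u x \<in> carrier V" if "u \<in> carrier GT" "x \<in> carrier G" for u x
    using that W_sub by (auto simp: carGT PiE_iff)
  have minusGT: "a \<ominus>\<^bsub>GT\<^esub> b = a \<oplus>\<^bsub>GT\<^esub> ((-1) \<odot>\<^bsub>GT\<^esub> b)" if "b \<in> carrier GT" for a b
    using complex_uminus[OF GTm that] by (simp add: a_minus_def)
  have cancelV: "v \<oplus>\<^bsub>V\<^esub> ((-1) \<odot>\<^bsub>V\<^esub> v) = \<zero>\<^bsub>V\<^esub>" if "v \<in> carrier V" for v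
    using V.M.r_neg[OF that] complex_uminus[OF Vm that] by simp
  have cancelGT: "v \<oplus>\<^bsub>GT\<^esub> ((-1) \<odot>\<^bsub>GT\<^esub> v) = \<zero>\<^bsub>GT\<^esub>" if "v \<in> carrier GT" for v
    using GT.M.r_neg[OF that] complex_uminus[OF GTm that] by simp
  have smGT: "c \<odot>\<^bsub>GT\<^esub> u \<in> carrier GT" if "u \<in> carrier GT" for c u
    using GT.smult_closed[of c u] that by simp
  have smV: "c \<odot>\<^bsub>V\<^esub> u \<in> carrier V" if "u \<in> carrier V" for c u
    using V.smult_closed[of c u] that by simp

  \<comment> \<open>The multiplication map, which sends g \<otimes> w to g w. The aim is that its
    kernel is exactly the space of relations.\<close>
  define S where "S u = finsum V (\<lambda>g. \<rho> g (u g)) (carrier G)" for u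
  have S_lin: "S \<in> linear_maps GT V"
    unfolding linear_maps_def
  proof (intro CollectI conjI ballI allI Pi_I)
    fix u c assume u: "u \<in> carrier GT"
    have cl: "(\<lambda>g. \<rho> g (u g)) \<in> carrier G \<rightarrow> carrier V" using u uW \<rho>_closed by blast
    then show "S u \<in> carrier V" unfolding S_def by (rule V.M.finsum_closed)
    have "S (c \<odot>\<^bsub>GT\<^esub> u) = finsum V (\<lambda>g. c \<odot>\<^bsub>V\<^esub> \<rho> g (u g)) (carrier G)"
      unfolding S_def smultGT using u uW \<rho>_closed \<rho>_smult smV by (intro V.M.finsum_cong') auto
    also have "\<dots> = c \<odot>\<^bsub>V\<^esub> S u"
      unfolding S_def using V.finsum_smult_ldistr[OF finG, of c "\<lambda>g. \<rho> g (u g)"] cl by simp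
    finally show "S (c \<odot>\<^bsub>GT\<^esub> u) = c \<odot>\<^bsub>V\<^esub> S u" .
    fix v assume v: "v \<in> carrier GT"
    have cl': "(\<lambda>g. \<rho> g (v g)) \<in> carrier G \<rightarrow> carrier V" using v uW \<rho>_closed by blast
    have "S (u \<oplus>\<^bsub>GT\<^esub> v) = finsum V (\<lambda>g. \<rho> g (u g) \<oplus>\<^bsub>V\<^esub> \<rho> g (v g)) (carrier G)"
      unfolding S_def addGT using u v uW \<rho>_closed \<rho>_add by (intro V.M.finsum_cong') auto
    also have "\<dots> = S u \<oplus>\<^bsub>V\<^esub> S v" unfolding S_def by (rule V.M.finsum_addf[OF cl cl'])
    finally show "S (u \<oplus>\<^bsub>GT\<^esub> v) = S u \<oplus>\<^bsub>V\<^esub> S v" .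
  qed
  note S = linear_mapsD[OF S_lin] and S_zero = linear_maps_zero[OF GTm Vm S_lin]

  define te where "te = tensor_elem G ?W"
  have te: "te g w = (\<lambda>x\<in>carrier G. if x = g then w else \<zero>\<^bsub>V\<^esub>)" for g w
    unfolding te_def tensor_elem_def by (rule restrict_ext) simp
  have te_car: "te g w \<in> carrier GT" if "w \<in> W" for g w
    using that W_zero unfolding carGT te by (intro restrict_PiE_iff[THEN iffD2]) auto
  have S_te: "S (te g w) = \<rho> g w" if g: "g \<in> carrier G" and w: "w \<in> W" for g w
  proof -
    have "S (te g w) = finsum V (\<lambda>x. if g = x then \<rho> x w else \<zero>\<^bsub>V\<^esub>) (carrier G)"
      unfolding S_def using w W_sub \<rho>_closed \<rho>_zero by (intro V.M.finsum_cong') (auto simp: te)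
    also have "\<dots> = \<rho> g w"
      using w W_sub \<rho>_closed by (intro V.M.finsum_singleton[OF g finG]) auto
    finally show ?thesis .
  qed

  define R where "R v = (\<lambda>x\<in>carrier G. E (\<rho> (inv\<^bsub>G\<^esub> x) v))" for v
  have R_car: "R v \<in> carrier GT" if "v \<in> carrier V" for v
    using that \<rho>_closed E_into unfolding carGT R_def by (intro restrict_PiE_iff[THEN iffD2]) auto
  have SR: "S (R v) = k \<odot>\<^bsub>V\<^esub> v" if v: "v \<in> carrier V" for v
  proof -
    have "S (R v) = finsum V (\<lambda>x. \<rho> x (E (\<rho> (inv\<^bsub>G\<^esub> x) v))) (carrier G)"
      unfolding S_def using v \<rho>_closed linear_mapsD(1)[OF E] by (intro V.M.finsum_cong') (auto simp: R_def)
    then show ?thesis using avg[OF v] by (simp add: k_def)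
  qed
  have S_surj: "\<exists>u\<in>carrier GT. S u = v" if v: "v \<in> carrier V" for v
  proof (intro bexI)
    have "S ((1 / k) \<odot>\<^bsub>GT\<^esub> R v) = (1 / k) \<odot>\<^bsub>V\<^esub> (k \<odot>\<^bsub>V\<^esub> v)"
      using S(3)[OF R_car[OF v]] SR[OF v] by simp
    also have "\<dots> = v" using V.smult_assoc1[of "1 / k" k v] V.smult_one[OF v] v k by simp
    finally show "S ((1 / k) \<odot>\<^bsub>GT\<^esub> R v) = v" .
    show "(1 / k) \<odot>\<^bsub>GT\<^esub> R v \<in> carrier GT" using smGT[OF R_car[OF v]] .
  qed

  define N where "N = induced_relations G H ?W \<rho>"
  define B where "B = {te (g \<otimes>\<^bsub>G\<^esub> h) w \<ominus>\<^bsub>GT\<^esub> te g (\<rho> h w) | g h w. g \<in> carrier G \<and> h \<in> H \<and> w \<in> W}"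
  have N_eq: "N = lin_span GT B"
    by (simp add: N_def induced_relations_def B_def GT_def te_def)
  have B_sub: "B \<subseteq> carrier GT" using te_car stable by (auto simp: B_def)
  have N_mod: "submodule N complex_field GT" unfolding N_eq by (rule lin_span_submodule[OF GTm B_sub])
  have N_sub: "N \<subseteq> carrier GT" and N_zero: "\<zero>\<^bsub>GT\<^esub> \<in> N"
    and N_smult: "\<And>c u. u \<in> N \<Longrightarrow> c \<odot>\<^bsub>GT\<^esub> u \<in> N"
    using N_mod unfolding complex_submodule_iff[OF GTm] by blast+
  have rel: "te (g \<otimes>\<^bsub>G\<^esub> h) w \<oplus>\<^bsub>GT\<^esub> ((-1) \<odot>\<^bsub>GT\<^esub> te g (\<rho> h w)) \<in> N"
    if "g \<in> carrier G" "h \<in> H" "w \<in> W" for g h w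
  proof -
    have "te (g \<otimes>\<^bsub>G\<^esub> h) w \<ominus>\<^bsub>GT\<^esub> te g (\<rho> h w) \<in> N"
      unfolding N_eq using that by (intro subsetD[OF lin_span_superset]) (auto simp: B_def)
    then show ?thesis using minusGT[OF te_car[OF stable[OF that(2,3)]]] by simp
  qed

  \<comment> \<open>The kernel is a subspace, so checking the generating relations puts all of N
    into it.\<close>
  have ker_mod: "submodule {u \<in> carrier GT. S u = \<zero>\<^bsub>V\<^esub>} complex_field GT"
    unfolding complex_submodule_iff[OF GTm] using S S_zero smGT V.smult_r_null by auto
  have "B \<subseteq> {u \<in> carrier GT. S u = \<zero>\<^bsub>V\<^esub>}"
  proof
    fix b assume b: "b \<in> B"
    then obtain g h w where ghw: "g \<in> carrier G" "h \<in> H" "w \<in> W"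
      and b_eq: "b = te (g \<otimes>\<^bsub>G\<^esub> h) w \<ominus>\<^bsub>GT\<^esub> te g (\<rho> h w)" by (auto simp: B_def)
    have hG: "h \<in> carrier G" using ghw H_sub by blast
    note hw = stable[OF ghw(2,3)]
    have "S b = S (te (g \<otimes>\<^bsub>G\<^esub> h) w) \<oplus>\<^bsub>V\<^esub> ((-1) \<odot>\<^bsub>V\<^esub> S (te g (\<rho> h w)))"
      unfolding b_eq minusGT[OF te_car[OF hw]] using S te_car[OF hw] te_car[OF ghw(3)] smGT by simp
    also have "\<dots> = \<rho> g (\<rho> h w) \<oplus>\<^bsub>V\<^esub> ((-1) \<odot>\<^bsub>V\<^esub> \<rho> g (\<rho> h w))"
      using ghw hG hw W_sub mult[OF ghw(1) hG] by (simp add: S_te subset_iff)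
    also have "\<dots> = \<zero>\<^bsub>V\<^esub>" using ghw hG W_sub \<rho>_closed by (intro cancelV) blast
    finally show "b \<in> {u \<in> carrier GT. S u = \<zero>\<^bsub>V\<^esub>}" using b B_sub by blast
  qed
  then have N_ker: "S u = \<zero>\<^bsub>V\<^esub>" if "u \<in> N" for u
    using lin_span_least[OF ker_mod] that unfolding N_eq by blast

  \<comment> \<open>The relation between xh \<otimes> w and x \<otimes> h w, applied in every
    coordinate: the value at xh moves to x and is acted on by h.\<close>
  define tr where "tr h u = (\<lambda>x\<in>carrier G. \<rho> h (u (x \<otimes>\<^bsub>G\<^esub> h)))" for h u
  have tr_car: "tr h u \<in> carrier GT" if "h \<in> H" "u \<in> carrier GT" for h u
    unfolding tr_def carGT using that(1) uW(1)[OF that(2)] stable H_sub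
    by (intro restrict_PiE_iff[THEN iffD2]) blast
  have finsum_GT: "finsum GT F A x = finsum V (\<lambda>a. F a x) A"
    if "finite A" "F \<in> A \<rightarrow> carrier GT" "x \<in> carrier G" for A F and x
  proof -
    have "finsum GT F A x = finsum ?W (\<lambda>a. F a x) A"
      using finsum_direct_sum[of "carrier G" "\<lambda>_. ?W" A F x] Wm that unfolding GT_eq by blast
    also have "\<dots> = finsum V (\<lambda>a. F a x) A"
      using that uW(1) by (intro finsum_submodule(1)[OF Vm W]) auto
    finally show ?thesis .
  qed
  have GT_ext: "u = v" if "u \<in> carrier GT" "v \<in> carrier GT" "\<And>x. x \<in> carrier G \<Longrightarrow> u x = v x" for u v
    using that unfolding carGT by (rule PiE_ext)
  have decomp: "finsum GT (\<lambda>x. te x (u x)) (carrier G) = u" if u: "u \<in> carrier GT" for u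
  proof (rule GT_ext)
    have cl: "(\<lambda>x. te x (u x)) \<in> carrier G \<rightarrow> carrier GT" using te_car uW(1)[OF u] by blast
    then show "finsum GT (\<lambda>x. te x (u x)) (carrier G) \<in> carrier GT" by (rule GT.M.finsum_closed)
    fix y assume y: "y \<in> carrier G"
    have "finsum GT (\<lambda>x. te x (u x)) (carrier G) y = finsum V (\<lambda>x. te x (u x) y) (carrier G)"
      by (rule finsum_GT[OF finG cl y])
    also have "\<dots> = finsum V (\<lambda>x. if y = x then u x else \<zero>\<^bsub>V\<^esub>) (carrier G)"
      using y uW(2)[OF u] by (intro V.M.finsum_cong') (auto simp: te)
    also have "\<dots> = u y" using uW(2)[OF u] by (intro V.M.finsum_singleton[OF y finG]) auto
    finally show "finsum GT (\<lambda>x. te x (u x)) (carrier G) y = u y" .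
  qed (rule u)
  \<comment> \<open>Once the decomposition of u is reindexed by right multiplication with h, the
    difference is a sum of relations, one for each x.\<close>
  have diff_N: "u \<oplus>\<^bsub>GT\<^esub> ((-1) \<odot>\<^bsub>GT\<^esub> tr h u) \<in> N" if h: "h \<in> H" and u: "u \<in> carrier GT" for h u
  proof -
    have hG: "h \<in> carrier G" using h H_sub by blast
    have bij: "bij_betw (\<lambda>x. x \<otimes>\<^bsub>G\<^esub> h) (carrier G) (carrier G)"
      by (rule bij_betw_byWitness[where f' = "\<lambda>x. x \<otimes>\<^bsub>G\<^esub> inv\<^bsub>G\<^esub> h"])
        (use hG in \<open>auto simp: G.m_assoc\<close>)
    have cl1: "(\<lambda>x. te (x \<otimes>\<^bsub>G\<^esub> h) (u (x \<otimes>\<^bsub>G\<^esub> h))) \<in> carrier G \<rightarrow> carrier GT"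
      using te_car uW(1)[OF u] hG by blast
    have cl2: "(\<lambda>x. te x (tr h u x)) \<in> carrier G \<rightarrow> carrier GT"
      using te_car uW(1)[OF tr_car[OF h u]] by blast
    have "(\<lambda>x. te x (u x)) \<in> carrier G \<rightarrow> carrier GT" using te_car uW(1)[OF u] by blast
    then have "finsum GT (\<lambda>x. te (x \<otimes>\<^bsub>G\<^esub> h) (u (x \<otimes>\<^bsub>G\<^esub> h))) (carrier G) = finsum GT (\<lambda>x. te x (u x)) (carrier G)"
      using GT.M.finsum_reindex[of "\<lambda>x. te x (u x)" "\<lambda>x. x \<otimes>\<^bsub>G\<^esub> h" "carrier G"] bij
      by (simp add: bij_betw_def)
    then have 1: "finsum GT (\<lambda>x. te (x \<otimes>\<^bsub>G\<^esub> h) (u (x \<otimes>\<^bsub>G\<^esub> h))) (carrier G) = u" using decomp[OF u] by simp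
    have cl3: "(\<lambda>x. (-1) \<odot>\<^bsub>GT\<^esub> te x (tr h u x)) \<in> carrier G \<rightarrow> carrier GT" using cl2 smGT by blast
    have 2: "finsum GT (\<lambda>x. (-1) \<odot>\<^bsub>GT\<^esub> te x (tr h u x)) (carrier G) = (-1) \<odot>\<^bsub>GT\<^esub> tr h u"
      using GT.finsum_smult_ldistr[OF finG _ cl2, of "-1"] decomp[OF tr_car[OF h u]] by simp
    have "u \<oplus>\<^bsub>GT\<^esub> ((-1) \<odot>\<^bsub>GT\<^esub> tr h u) =
        finsum GT (\<lambda>x. te (x \<otimes>\<^bsub>G\<^esub> h) (u (x \<otimes>\<^bsub>G\<^esub> h)) \<oplus>\<^bsub>GT\<^esub> ((-1) \<odot>\<^bsub>GT\<^esub> te x (tr h u x))) (carrier G)"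
      using GT.M.finsum_addf[OF cl1 cl3] 1 2 by simp
    also have "\<dots> \<in> N"
      by (rule finsum_submodule(2)[OF GTm N_mod finG])
        (use rel[OF _ h] uW(1)[OF u] hG in \<open>auto simp: tr_def\<close>)
    finally show ?thesis .
  qed

  \<comment> \<open>In coordinate x the substitution g = xy leaves E applied to y u(xy). This
    vanishes for y outside H by \<open>E_off\<close> and is unchanged by E for y in H, so exactly
    the translates over H survive.\<close>
  have RS: "R (S u) = finsum GT (\<lambda>h. tr h u) H" if u: "u \<in> carrier GT" for u
  proof (rule GT_ext[OF R_car[OF S(1)[OF u]]])
    have cl: "(\<lambda>h. tr h u) \<in> H \<rightarrow> carrier GT" using tr_car u by blast
    then show "finsum GT (\<lambda>h. tr h u) H \<in> carrier GT" by (rule GT.M.finsum_closed)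
    fix x assume x: "x \<in> carrier G"
    let ?x = "inv\<^bsub>G\<^esub> x"
    have c1: "(\<lambda>g. \<rho> g (u g)) \<in> carrier G \<rightarrow> carrier V" using uW[OF u] \<rho>_closed by blast
    have c2: "(\<lambda>g. \<rho> ?x (\<rho> g (u g))) \<in> carrier G \<rightarrow> carrier V" using c1 x \<rho>_closed by blast
    have bij: "bij_betw (\<lambda>y. x \<otimes>\<^bsub>G\<^esub> y) (carrier G) (carrier G)"
      by (rule bij_betw_byWitness[where f' = "\<lambda>y. ?x \<otimes>\<^bsub>G\<^esub> y"])
        (use x in \<open>auto simp: G.m_assoc[symmetric]\<close>)
    let ?F = "\<lambda>g. E (\<rho> ?x (\<rho> g (u g)))"
    have c3: "?F \<in> carrier G \<rightarrow> carrier V" using c2 linear_mapsD(1)[OF E] by blast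
    have "R (S u) x = E (\<rho> ?x (S u))" using x by (simp add: R_def)
    also have "\<dots> = finsum V ?F (carrier G)"
      unfolding S_def linear_maps_finsum[OF Vm Vm lin[OF G.inv_closed[OF x]] finG c1]
      by (rule linear_maps_finsum[OF Vm Vm E finG c2])
    also have "\<dots> = finsum V (\<lambda>y. ?F (x \<otimes>\<^bsub>G\<^esub> y)) (carrier G)"
      using V.M.finsum_reindex[of ?F "\<lambda>y. x \<otimes>\<^bsub>G\<^esub> y" "carrier G"] c3 bij by (simp add: bij_betw_def)
    also have "\<dots> = finsum V (\<lambda>y. tr y u x) H"
    proof (rule V.M.add.finprod_mono_neutral_cong_right[OF finG H_sub])
      have F_eq: "?F (x \<otimes>\<^bsub>G\<^esub> y) = E (\<rho> y (u (x \<otimes>\<^bsub>G\<^esub> y)))" if y: "y \<in> carrier G" for y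
      proof -
        have "\<rho> ?x (\<rho> (x \<otimes>\<^bsub>G\<^esub> y) (u (x \<otimes>\<^bsub>G\<^esub> y))) = \<rho> (?x \<otimes>\<^bsub>G\<^esub> (x \<otimes>\<^bsub>G\<^esub> y)) (u (x \<otimes>\<^bsub>G\<^esub> y))"
          using x y uW(2)[OF u] by (simp add: mult)
        also have "?x \<otimes>\<^bsub>G\<^esub> (x \<otimes>\<^bsub>G\<^esub> y) = y" using x y by (simp add: G.m_assoc[symmetric])
        finally show ?thesis by simp
      qed
      show "?F (x \<otimes>\<^bsub>G\<^esub> y) = \<zero>\<^bsub>V\<^esub>" if "y \<in> carrier G - H" for y
        using that F_eq[of y] E_off[of y] uW(1)[OF u] x by simp
      show "?F (x \<otimes>\<^bsub>G\<^esub> y) = tr y u x" if "y \<in> H" for y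
        using that F_eq[of y] E_on stable uW(1)[OF u] x H_sub by (auto simp: tr_def)
      show "(\<lambda>y. ?F (x \<otimes>\<^bsub>G\<^esub> y)) \<in> carrier G \<rightarrow> carrier V" using c3 x by auto
    qed
    also have "\<dots> = finsum GT (\<lambda>h. tr h u) H x" by (rule finsum_GT[OF finH cl x, symmetric])
    finally show "R (S u) x = finsum GT (\<lambda>h. tr h u) H x" .
  qed

  \<comment> \<open>If S kills u, the translates of u sum to zero by \<open>RS\<close>. Then |H|
    times u is the sum of the differences from \<open>diff_N\<close>, and |H| is invertible.\<close>
  have ker_N: "u \<in> N" if u: "u \<in> carrier GT" and Su: "S u = \<zero>\<^bsub>V\<^esub>" for u
  proof -
    have "R \<zero>\<^bsub>V\<^esub> = \<zero>\<^bsub>GT\<^esub>"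
      unfolding R_def zeroGT using \<rho>_zero linear_maps_zero[OF Vm Vm E] by (auto intro!: restrict_ext)
    then have tr0: "finsum GT (\<lambda>h. tr h u) H = \<zero>\<^bsub>GT\<^esub>" using RS[OF u] Su by simp
    have cl: "(\<lambda>h. tr h u) \<in> H \<rightarrow> carrier GT" using tr_car u by blast
    have cl': "(\<lambda>h. (-1) \<odot>\<^bsub>GT\<^esub> tr h u) \<in> H \<rightarrow> carrier GT" using cl smGT by blast
    have "finsum GT (\<lambda>h. u \<oplus>\<^bsub>GT\<^esub> ((-1) \<odot>\<^bsub>GT\<^esub> tr h u)) H =
        finsum GT (\<lambda>_. u) H \<oplus>\<^bsub>GT\<^esub> finsum GT (\<lambda>h. (-1) \<odot>\<^bsub>GT\<^esub> tr h u) H"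
      using u cl' by (intro GT.M.finsum_addf) auto
    also have "finsum GT (\<lambda>_. u) H = k \<odot>\<^bsub>GT\<^esub> u"
      unfolding k_def by (rule finsum_const_complex[OF GTm finH u])
    also have "finsum GT (\<lambda>h. (-1) \<odot>\<^bsub>GT\<^esub> tr h u) H = \<zero>\<^bsub>GT\<^esub>"
      using GT.finsum_smult_ldistr[OF finH _ cl, of "-1"] tr0 GT.smult_r_null[of "-1"] by simp
    finally have "k \<odot>\<^bsub>GT\<^esub> u = finsum GT (\<lambda>h. u \<oplus>\<^bsub>GT\<^esub> ((-1) \<odot>\<^bsub>GT\<^esub> tr h u)) H"
      using smGT[OF u, of k] by simp
    also have "\<dots> \<in> N" by (rule finsum_submodule(2)[OF GTm N_mod finH]) (use diff_N u in blast)
    finally have "(1 / k) \<odot>\<^bsub>GT\<^esub> (k \<odot>\<^bsub>GT\<^esub> u) \<in> N" by (rule N_smult)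
    then show ?thesis using GT.smult_assoc1[of "1 / k" k u] GT.smult_one[OF u] u k by simp
  qed

  \<comment> \<open>Cosets of the kernel are the fibres of S, so sending v to its fibre is the
    inverse of the map that S induces on the quotient.\<close>
  define T where "T v = {u \<in> carrier GT. S u = v}" for v
  have coset: "N +>\<^bsub>GT\<^esub> u = T (S u)" if u: "u \<in> carrier GT" for u
  proof -
    have "\<exists>n\<in>N. v = n \<oplus>\<^bsub>GT\<^esub> u" if v: "v \<in> carrier GT" "S v = S u" for v
    proof
      show "v = (v \<ominus>\<^bsub>GT\<^esub> u) \<oplus>\<^bsub>GT\<^esub> u"
        using u v by (simp add: a_minus_def GT.M.a_assoc GT.M.l_neg)
      have "S (v \<ominus>\<^bsub>GT\<^esub> u) = S u \<oplus>\<^bsub>V\<^esub> ((-1) \<odot>\<^bsub>V\<^esub> S u)"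
        unfolding minusGT[OF u] using S u v smGT[OF u] by simp
      then show "v \<ominus>\<^bsub>GT\<^esub> u \<in> N" using cancelV[OF S(1)[OF u]] u v by (intro ker_N) auto
    qed
    moreover have "n \<oplus>\<^bsub>GT\<^esub> u \<in> carrier GT \<and> S (n \<oplus>\<^bsub>GT\<^esub> u) = S u" if "n \<in> N" for n
      using that N_sub u S N_ker by (auto simp: subset_iff)
    ultimately show ?thesis unfolding a_r_coset_def' T_def by blast
  qed
  let ?Q = "induced_module G H ?W \<rho>"
  have Q_eq: "?Q = quotient_space GT N" by (simp add: induced_module_def GT_def N_def)
  have Q_car: "carrier ?Q = T ` carrier V"
  proof -
    have "carrier ?Q = (\<lambda>u. T (S u)) ` carrier GT"
      unfolding Q_eq quotient_space_def A_RCOSETS_def' using coset by auto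
    also have "\<dots> = T ` S ` carrier GT" by (rule image_image[symmetric])
    also have "S ` carrier GT = carrier V"
      by (intro subset_antisym subsetI) (use S(1) S_surj in blast)+
    finally show ?thesis .
  qed
  show ?thesis
  proof (rule isomorphic_representations_transport[OF rep, where T = T])
    show "bij_betw T (carrier V) (carrier ?Q)"
      unfolding bij_betw_def Q_car using S_surj by (auto simp: T_def inj_on_def set_eq_iff)
    show "T (u \<oplus>\<^bsub>V\<^esub> v) = T u \<oplus>\<^bsub>?Q\<^esub> T v" if uv: "u \<in> carrier V" "v \<in> carrier V" for u v
    proof -
      obtain a where a: "a \<in> carrier GT" "S a = u" using S_surj[OF uv(1)] by blast
      \<comment> \<open>Subtracting one fixed preimage a of u from x leaves an element of the fibre
        over v, so the sum of two fibres is a whole fibre.\<close>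
      have "\<exists>c\<in>T u. \<exists>b\<in>T v. x = c \<oplus>\<^bsub>GT\<^esub> b" if x: "x \<in> T (u \<oplus>\<^bsub>V\<^esub> v)" for x
      proof (intro bexI)
        have xc: "x \<in> carrier GT" "S x = u \<oplus>\<^bsub>V\<^esub> v" using x by (auto simp: T_def)
        show "x = a \<oplus>\<^bsub>GT\<^esub> (\<ominus>\<^bsub>GT\<^esub> a \<oplus>\<^bsub>GT\<^esub> x)" using a xc by (simp add: GT.M.r_neg2)
        have "S (\<ominus>\<^bsub>GT\<^esub> a \<oplus>\<^bsub>GT\<^esub> x) = ((-1) \<odot>\<^bsub>V\<^esub> u) \<oplus>\<^bsub>V\<^esub> (u \<oplus>\<^bsub>V\<^esub> v)"
          unfolding complex_uminus[OF GTm a(1)] using S a xc smGT[OF a(1)] by simp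
        also have "\<dots> = v" using complex_uminus[OF Vm uv(1)] uv V.M.r_neg1[of u v] by simp
        finally show "\<ominus>\<^bsub>GT\<^esub> a \<oplus>\<^bsub>GT\<^esub> x \<in> T v" using a xc by (simp add: T_def)
        show "a \<in> T u" using a by (simp add: T_def)
      qed
      then show ?thesis
        using S(2) unfolding Q_eq quotient_space_def set_add_def' by (auto simp: T_def)
    qed
    show "T (c \<odot>\<^bsub>V\<^esub> v) = c \<odot>\<^bsub>?Q\<^esub> T v" if v: "v \<in> carrier V" for c v
    proof -
      have "N +>\<^bsub>GT\<^esub> (c \<odot>\<^bsub>GT\<^esub> u) = T (c \<odot>\<^bsub>V\<^esub> v)" if "u \<in> T v" for u
        using that coset[of "c \<odot>\<^bsub>GT\<^esub> u"] S(3)[of u c] smGT[of u c] by (auto simp: T_def)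
      moreover have "T v \<noteq> {}" using S_surj[OF v] by (auto simp: T_def)
      ultimately show ?thesis unfolding Q_eq quotient_space_def by auto
    qed
    show "T \<zero>\<^bsub>V\<^esub> = \<zero>\<^bsub>?Q\<^esub>"
      unfolding Q_eq quotient_space_def using ker_N N_ker N_sub by (auto simp: T_def)
    \<comment> \<open>The translation underlying \<open>induced_action\<close>. S intertwines it
      with \<rho>, hence it carries the fibre over v onto the fibre over x v.\<close>
    define sh where "sh x u = (\<lambda>g\<in>carrier G. u (inv\<^bsub>G\<^esub> x \<otimes>\<^bsub>G\<^esub> g))" for x and u :: "'g \<Rightarrow> 'v"
    have sh_car: "sh x u \<in> carrier GT" if "x \<in> carrier G" "u \<in> carrier GT" for x u
      unfolding sh_def carGT using that(1) uW(1)[OF that(2)]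
      by (intro restrict_PiE_iff[THEN iffD2]) auto
    have S_sh: "S (sh x u) = \<rho> x (S u)" if x: "x \<in> carrier G" and u: "u \<in> carrier GT" for x u
    proof -
      have bij: "bij_betw (\<lambda>y. x \<otimes>\<^bsub>G\<^esub> y) (carrier G) (carrier G)"
        by (rule bij_betw_byWitness[where f' = "\<lambda>y. inv\<^bsub>G\<^esub> x \<otimes>\<^bsub>G\<^esub> y"])
          (use x in \<open>auto simp: G.m_assoc[symmetric]\<close>)
      have c1: "(\<lambda>g. \<rho> g (u g)) \<in> carrier G \<rightarrow> carrier V" using uW[OF u] \<rho>_closed by blast
      have c2: "(\<lambda>g. \<rho> g (sh x u g)) \<in> carrier G \<rightarrow> carrier V" using uW[OF sh_car[OF x u]] \<rho>_closed by blast
      have "S (sh x u) = finsum V (\<lambda>y. \<rho> (x \<otimes>\<^bsub>G\<^esub> y) (sh x u (x \<otimes>\<^bsub>G\<^esub> y))) (carrier G)"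
        unfolding S_def
        using V.M.finsum_reindex[of "\<lambda>g. \<rho> g (sh x u g)" "\<lambda>y. x \<otimes>\<^bsub>G\<^esub> y" "carrier G"] c2 bij
        by (simp add: bij_betw_def)
      also have "\<dots> = finsum V (\<lambda>y. \<rho> x (\<rho> y (u y))) (carrier G)"
        using x c1 uW(2)[OF u] \<rho>_closed
        by (intro V.M.finsum_cong') (auto simp: sh_def mult G.m_assoc[symmetric])
      also have "\<dots> = \<rho> x (S u)"
        unfolding S_def by (rule linear_maps_finsum[OF Vm Vm lin[OF x] finG c1, symmetric])
      finally show ?thesis .
    qed
    show "T (\<rho> x v) = induced_action G x (T v)" if x: "x \<in> carrier G" and v: "v \<in> carrier V" for x v
    proof -
      have "u \<in> sh x ` T v" if u: "u \<in> T (\<rho> x v)" for u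
      proof
        have uc: "u \<in> carrier GT" "S u = \<rho> x v" using u by (auto simp: T_def)
        have xi: "inv\<^bsub>G\<^esub> x \<in> carrier G" using x by simp
        have "S (sh (inv\<^bsub>G\<^esub> x) u) = v"
          using S_sh[OF xi uc(1)] uc x v mult[of "inv\<^bsub>G\<^esub> x" x v] one by simp
        then show "sh (inv\<^bsub>G\<^esub> x) u \<in> T v" using sh_car[OF xi uc(1)] by (simp add: T_def)
        show "u = sh x (sh (inv\<^bsub>G\<^esub> x) u)"
          using x by (intro GT_ext uc sh_car xi) (auto simp: sh_def G.m_assoc[symmetric])
      qed
      then have "T (\<rho> x v) = sh x ` T v" using S_sh[OF x] sh_car[OF x] by (auto simp: T_def)
      then show ?thesis unfolding induced_action_def sh_def .
    qed
  qed
qed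

section \<open>The module attached to a multipartition\<close>

lemma L_obj_simps [simp]:
  "\<zero>\<^bsub>L_obj l d lam p f\<^esub> = (\<lambda>_. 0)" "u \<oplus>\<^bsub>L_obj l d lam p f\<^esub> v = (\<lambda>x. u x + v x)"
  "c \<odot>\<^bsub>L_obj l d lam p f\<^esub> v = (\<lambda>x. c * v x)"
  by (simp_all add: L_obj_def specht_tensor_def)

lemma L_obj_eq: "obj_type l d f = lam \<Longrightarrow> L_obj l d lam p f = specht_tensor l lam p"
  and L_obj_zero: "obj_type l d f \<noteq> lam \<Longrightarrow> carrier (L_obj l d lam p f) = {\<lambda>_. 0}"
  by (simp_all add: L_obj_def)

lemma module_L_obj: "module complex_field (L_obj l d lam p f)"
proof (cases "obj_type l d f = lam")
  case True
  have "module complex_field (specht_tensor l lam p)"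
    using module_fun_space[OF submodule_specht_tensor[of l lam p]] by (simp add: specht_tensor_def)
  then show ?thesis by (simp add: L_obj_eq True)
next
  case False
  have "submodule {\<lambda>_. 0} complex_field (fun_space UNIV)" by (simp add: submodule_fun_space_iff)
  then have "module complex_field (fun_space {\<lambda>_::nat \<Rightarrow> nat \<Rightarrow> nat. 0})" by (rule module_fun_space)
  then show ?thesis using False by (simp add: L_obj_def)
qed

lemma L_module_simps [simp]:
  "carrier (L_module l d lam p) = (\<Pi>\<^sub>E h\<in>gpd_obj l d. carrier (L_obj l d lam p h))"
  "\<zero>\<^bsub>L_module l d lam p\<^esub> = (\<lambda>h\<in>gpd_obj l d. \<lambda>_. 0)"
  "u \<oplus>\<^bsub>L_module l d lam p\<^esub> v = (\<lambda>h\<in>gpd_obj l d. \<lambda>r. u h r + v h r)"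
  "c \<odot>\<^bsub>L_module l d lam p\<^esub> v = (\<lambda>h\<in>gpd_obj l d. \<lambda>r. c * v h r)"
  by (simp_all add: L_module_def)

lemma module_L_module: "module complex_field (L_module l d lam p)"
  unfolding L_module_def by (rule module_direct_sum[OF module_L_obj])

lemma comp_permutes_gpd_obj:
  assumes "h \<in> gpd_obj l d" "\<pi> permutes {1..d}"
  shows "h \<circ> \<pi> \<in> gpd_obj l d" "(h \<circ> \<pi>, \<pi>, h) \<in> gpd_mor l d"
proof -
  show "h \<circ> \<pi> \<in> gpd_obj l d"
    unfolding gpd_obj_def
  proof (rule PiE_I)
    fix k
    show "(h \<circ> \<pi>) k \<in> {1..l}" if "k \<in> {1..d}"
      using assms(1) permutes_in_image[OF assms(2), of k] that by (auto simp: gpd_obj_def)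
    show "(h \<circ> \<pi>) k = undefined" if "k \<notin> {1..d}"
      using assms(1) permutes_not_in[OF assms(2), of k] that by (auto simp: gpd_obj_def)
  qed
  then show "(h \<circ> \<pi>, \<pi>, h) \<in> gpd_mor l d" using assms by (simp add: gpd_mor_def)
qed

lemma zero_in_L_obj: "(\<lambda>_. 0) \<in> carrier (L_obj l d lam p h)"
  using abelian_monoid.zero_closed[OF abelian_group.axioms(1)[OF module.axioms(2)[OF module_L_obj]]]
  by simp

lemma L_mor_zero: "L_mor l d lam p m (\<lambda>_. 0) = (\<lambda>_. 0)"
  using L_mor_linear(2)[of l d lam p m 0 "\<lambda>_. 0"] by simp

context
  fixes l d :: nat and \<xi> :: complex and \<Phi> and lam :: "nat \<Rightarrow> nat" and p :: "nat \<Rightarrow> nat list"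
  assumes l: "l > 0" and roots: "{z. z ^ l = 1} = range (\<lambda>k::nat. \<xi> ^ k)"
    and \<Phi>: "\<Phi> \<in> Phi_isos l d \<xi>" and lam: "lam \<in> compositions l d"
begin

text \<open>Among the morphisms ending at h only the one with permutation \<pi> has a nonzero
  coefficient. There c j carries the exponent given by the source object, which is
  \<open>h (\<pi> j)\<close>.\<close>

lemma Phi_bar_action_monomial_mat:
  assumes \<pi>: "\<pi> permutes {1..d}" and c: "\<forall>j\<in>{1..d}. c j ^ l = 1"
  shows "Phi_bar_action l d lam p \<Phi> (monomial_mat d \<pi> c) u =
    (\<lambda>h\<in>gpd_obj l d. \<lambda>r. (\<Prod>j\<in>{1..d}. c j ^ h (\<pi> j)) * L_mor l d lam p (h \<circ> \<pi>, \<pi>, h) (u (h \<circ> \<pi>)) r)"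
proof -
  have "monomial_mat d \<pi> c \<in> carrier (gen_sym_group l d)"
    using c by (intro monomial_mat_carrier[OF \<pi> l]) blast
  note coeff = Phi_isos_basis_elem[OF l roots \<Phi> this]
  show ?thesis
    unfolding Phi_bar_action_def groupoid_algebra_action_def coeff
  proof (rule restrict_ext, rule ext)
    fix h r assume h: "h \<in> gpd_obj l d"
    let ?M = "{(f, \<pi>, g) \<in> gpd_mor l d. g = h}"
    let ?X = "(\<Prod>j\<in>{1..d}. c j ^ h (\<pi> j)) * L_mor l d lam p (h \<circ> \<pi>, \<pi>, h) (u (h \<circ> \<pi>)) r"
    have fin: "finite ?M" by (rule finite_subset[OF _ finite_gpd_mor[of l d]]) blast
    have "(\<Sum>(f, \<sigma>, g)\<in>?M. Phi_coeff l d (monomial_mat d \<pi> c) (f, \<sigma>, g) * L_mor l d lam p (f, \<sigma>, g) (u f) r) =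
      (\<Sum>m\<in>?M. if m = (h \<circ> \<pi>, \<pi>, h) then ?X else 0)"
    proof (rule sum.cong[OF refl], clarify)
      fix f \<sigma> assume m: "(f, \<sigma>, h) \<in> gpd_mor l d"
      have "f = h \<circ> \<sigma>" using m by (auto simp: gpd_mor_def)
      then show "Phi_coeff l d (monomial_mat d \<pi> c) (f, \<sigma>, h) * L_mor l d lam p (f, \<sigma>, h) (u f) r =
          (if (f, \<sigma>, h) = (h \<circ> \<pi>, \<pi>, h) then ?X else 0)"
        unfolding Phi_coeff_monomial_mat[OF \<pi> m] by (simp del: L_mor.simps)
    qed
    also have "\<dots> = ?X"
      using comp_permutes_gpd_obj(2)[OF h \<pi>] by (simp add: sum.delta[OF fin] del: L_mor.simps)
    finally show "(\<Sum>(f, \<sigma>, g)\<in>?M. Phi_coeff l d (monomial_mat d \<pi> c) (f, \<sigma>, g) *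
        L_mor l d lam p (f, \<sigma>, g) (u f) r) = ?X" .
  qed
qed

lemma gen_sym_group_monomialE:
  assumes "w \<in> carrier (gen_sym_group l d)"
  obtains \<pi> c where "\<pi> permutes {1..d}" "\<forall>j\<in>{1..d}. c j ^ l = 1" "w = monomial_mat d \<pi> c"
  using assms
proof (rule gen_sym_group_cases)
  fix \<pi> c assume "\<pi> permutes {1..d}" "c \<in> {1..d} \<rightarrow>\<^sub>E {z. z ^ l = 1}" "w = monomial_mat d \<pi> c"
  then show ?thesis using that[of \<pi> c] by blast
qed

lemma L_mor_L_obj_closed:
  assumes m: "(f, \<pi>, g) \<in> gpd_mor l d" and F: "F \<in> carrier (L_obj l d lam p f)"
  shows "(\<lambda>r. c * L_mor l d lam p (f, \<pi>, g) F r) \<in> carrier (L_obj l d lam p g)"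
proof (cases "obj_type l d g = lam")
  case True
  then have "L_mor l d lam p (f, \<pi>, g) F \<in> carrier (specht_tensor l lam p)"
    using L_mor_closed[OF lam m True] F gpd_mor_obj_type[OF m] by (simp add: L_obj_eq del: L_mor.simps)
  then show ?thesis
    using submodule_specht_tensor[of l lam p] unfolding L_obj_eq[OF True] submodule_fun_space_iff by blast
next
  case False
  then show ?thesis by (simp add: L_obj_zero)
qed

text \<open>Multiplicativity combines functoriality of \<open>L_mor\<close> with a cocycle identity
  for the scalars. At objects of other types the spaces are zero.\<close>

lemma representation_L_module:
  "representation (gen_sym_group l d) (L_module l d lam p) (Phi_bar_action l d lam p \<Phi>)"
proof -
  let ?V = "L_module l d lam p" and ?\<rho> = "Phi_bar_action l d lam p \<Phi>"
  have u_obj: "u h \<in> carrier (L_obj l d lam p h)" if "u \<in> carrier ?V" "h \<in> gpd_obj l d" for u h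
    using that by auto
  have "?\<rho> w \<in> linear_maps ?V ?V" if "w \<in> carrier (gen_sym_group l d)" for w
    using that
  proof (rule gen_sym_group_monomialE)
    fix \<pi> c assume \<pi>: "\<pi> permutes {1..d}" and c: "\<forall>j\<in>{1..d}. c j ^ l = 1" and w: "w = monomial_mat d \<pi> c"
    note obj = comp_permutes_gpd_obj[OF _ \<pi>]
    note act = Phi_bar_action_monomial_mat[OF \<pi> c]
    show ?thesis
      unfolding linear_maps_def w
    proof (intro CollectI conjI ballI allI Pi_I)
      fix u v a assume u: "u \<in> carrier ?V"
      show "?\<rho> (monomial_mat d \<pi> c) u \<in> carrier ?V"
        unfolding act L_module_simps(1)
        using L_mor_L_obj_closed[OF obj(2)] u_obj[OF u] obj(1) by (intro restrict_PiE_iff[THEN iffD2]) blast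
      show "?\<rho> (monomial_mat d \<pi> c) (a \<odot>\<^bsub>?V\<^esub> u) = a \<odot>\<^bsub>?V\<^esub> ?\<rho> (monomial_mat d \<pi> c) u"
        unfolding act using obj(1)
        by (auto simp: L_mor_linear mult.left_commute simp del: L_mor.simps intro!: restrict_ext)
      show "?\<rho> (monomial_mat d \<pi> c) (u \<oplus>\<^bsub>?V\<^esub> v) =
          ?\<rho> (monomial_mat d \<pi> c) u \<oplus>\<^bsub>?V\<^esub> ?\<rho> (monomial_mat d \<pi> c) v"
        unfolding act using obj(1)
        by (auto simp: L_mor_linear distrib_left simp del: L_mor.simps intro!: restrict_ext)
    qed
  qed
  moreover have "?\<rho> \<one>\<^bsub>gen_sym_group l d\<^esub> u = u" if u: "u \<in> carrier ?V" for u
  proof -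
    have "L_mor l d lam p (h, id, h) (u h) = u h" if h: "h \<in> gpd_obj l d" for h
    proof (cases "obj_type l d h = lam")
      case True
      then show ?thesis using L_mor_id[OF lam h True] u_obj[OF u h] by (simp add: L_obj_eq del: L_mor.simps)
    next
      case False
      then show ?thesis using u_obj[OF u h] by (simp add: L_obj_zero)
    qed
    then have "?\<rho> \<one>\<^bsub>gen_sym_group l d\<^esub> u = (\<lambda>h\<in>gpd_obj l d. u h)"
      unfolding gen_sym_group_simps one_mat_monomial
      by (subst Phi_bar_action_monomial_mat[OF permutes_id]) (auto simp del: L_mor.simps intro!: restrict_ext)
    then show ?thesis using u by auto
  qed
  moreover have "?\<rho> (v \<otimes>\<^bsub>gen_sym_group l d\<^esub> w) u = ?\<rho> v (?\<rho> w u)"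
    if "v \<in> carrier (gen_sym_group l d)" "w \<in> carrier (gen_sym_group l d)" for v w u
    using that(1)
  proof (rule gen_sym_group_monomialE)
    fix \<pi> c assume \<pi>: "\<pi> permutes {1..d}" and c: "\<forall>j\<in>{1..d}. c j ^ l = 1" and v: "v = monomial_mat d \<pi> c"
    from that(2) show ?thesis
    proof (rule gen_sym_group_monomialE)
      fix \<tau> e assume \<tau>: "\<tau> permutes {1..d}" and e: "\<forall>j\<in>{1..d}. e j ^ l = 1" and w: "w = monomial_mat d \<tau> e"
      have pe: "\<forall>j\<in>{1..d}. (c (\<tau> j) * e j) ^ l = 1"
        using c e permutes_in_image[OF \<tau>] by (simp add: power_mult_distrib)
      show ?thesis
        unfolding gen_sym_group_simps v w monomial_mat_mult[OF \<tau>]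
          Phi_bar_action_monomial_mat[OF permutes_compose[OF \<tau> \<pi>] pe]
          Phi_bar_action_monomial_mat[OF \<pi> c] Phi_bar_action_monomial_mat[OF \<tau> e]
      proof (rule restrict_ext, rule ext)
        fix h r assume h: "h \<in> gpd_obj l d"
        note obj = comp_permutes_gpd_obj[OF h \<pi>]
        \<comment> \<open>In the product matrix the entries c are read at \<open>\<tau> j\<close>;
          reindexing along \<tau> recovers the scalar of the left factor.\<close>
        have "(\<Prod>j\<in>{1..d}. c (\<tau> j) ^ h (\<pi> (\<tau> j))) = (\<Prod>j\<in>{1..d}. c j ^ h (\<pi> j))"
          by (rule prod.reindex_bij_betw[OF permutes_imp_bij[OF \<tau>]])
        then have "(\<Prod>j\<in>{1..d}. (c (\<tau> j) * e j) ^ h ((\<pi> \<circ> \<tau>) j)) =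
            (\<Prod>j\<in>{1..d}. c j ^ h (\<pi> j)) * (\<Prod>j\<in>{1..d}. e j ^ (h \<circ> \<pi>) (\<tau> j))"
          by (simp add: power_mult_distrib prod.distrib)
        moreover have "L_mor l d lam p (h \<circ> \<pi>, \<pi>, h) (L_mor l d lam p (h \<circ> \<pi> \<circ> \<tau>, \<tau>, h \<circ> \<pi>) (u (h \<circ> \<pi> \<circ> \<tau>))) =
            L_mor l d lam p (h \<circ> \<pi> \<circ> \<tau>, \<pi> \<circ> \<tau>, h) (u (h \<circ> \<pi> \<circ> \<tau>))"
          by (rule L_mor_comp[OF lam comp_permutes_gpd_obj(2)[OF obj(1) \<tau>] obj(2)])
        ultimately show "(\<Prod>j\<in>{1..d}. (c (\<tau> j) * e j) ^ h ((\<pi> \<circ> \<tau>) j)) *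
            L_mor l d lam p (h \<circ> (\<pi> \<circ> \<tau>), \<pi> \<circ> \<tau>, h) (u (h \<circ> (\<pi> \<circ> \<tau>))) r =
          (\<Prod>j\<in>{1..d}. c j ^ h (\<pi> j)) * L_mor l d lam p (h \<circ> \<pi>, \<pi>, h)
            ((\<lambda>h\<in>gpd_obj l d. \<lambda>r. (\<Prod>j\<in>{1..d}. e j ^ h (\<tau> j)) *
              L_mor l d lam p (h \<circ> \<tau>, \<tau>, h) (u (h \<circ> \<tau>)) r) (h \<circ> \<pi>)) r"
          using obj(1) by (simp only: restrict_apply' L_mor_linear(2) o_assoc mult.assoc)
      qed
    qed
  qed
  ultimately show ?thesis
    unfolding representation_def using group_gen_sym_group[OF l] module_L_module by blast
qed

section \<open>The summand at an object of type \<open>lam\<close>\<close>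

context
  fixes f
  assumes f: "f \<in> gpd_obj l d" and type: "obj_type l d f = lam"
begin

lemma L_summand_eq: "L_summand l d lam p f = (L_module l d lam p)\<lparr>carrier := carrier (L_summand l d lam p f)\<rparr>"
  by (simp add: L_summand_def)

lemma carrier_L_summand: "u \<in> carrier (L_summand l d lam p f) \<longleftrightarrow>
    u \<in> carrier (L_module l d lam p) \<and> (\<forall>g\<in>gpd_obj l d. g \<noteq> f \<longrightarrow> u g = (\<lambda>_. 0))"
  by (simp add: L_summand_def)

lemma submodule_L_summand: "submodule (carrier (L_summand l d lam p f)) complex_field (L_module l d lam p)"
proof -
  interpret V: module complex_field "L_module l d lam p" by (rule module_L_module)
  show ?thesis
    unfolding complex_submodule_iff[OF module_L_module]
    using V.M.a_closed V.smult_closed V.M.zero_closed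
    by (auto simp: carrier_L_summand simp del: L_module_simps(1))
qed

lemma Phi_bar_action_L_summand_stable:
  assumes w: "w \<in> transport_mats l d f f" and u: "u \<in> carrier (L_summand l d lam p f)"
  shows "Phi_bar_action l d lam p \<Phi> w u \<in> carrier (L_summand l d lam p f)"
proof -
  obtain \<pi> c where \<pi>: "\<pi> permutes {1..d}" "f \<circ> \<pi> = f" and c: "\<forall>j\<in>{1..d}. c j ^ l = 1"
    and w_eq: "w = monomial_mat d \<pi> c" using w unfolding transport_mats_def by blast
  have "w \<in> carrier (gen_sym_group l d)" using w transport_mats_carrier[OF l] by blast
  then have "Phi_bar_action l d lam p \<Phi> w u \<in> carrier (L_module l d lam p)"
    using representation_L_module u unfolding representation_def linear_maps_def carrier_L_summand by blast
  moreover have "Phi_bar_action l d lam p \<Phi> w u g = (\<lambda>_. 0)" if g: "g \<in> gpd_obj l d" "g \<noteq> f" for g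
  proof -
    have "g \<circ> \<pi> \<noteq> f" using comp_permutes_eq_iff[OF \<pi>(1), of g f] \<pi>(2) g(2) by simp
    then have "u (g \<circ> \<pi>) = (\<lambda>_. 0)"
      using u comp_permutes_gpd_obj(1)[OF g(1) \<pi>(1)] unfolding carrier_L_summand by blast
    then show ?thesis
      unfolding w_eq Phi_bar_action_monomial_mat[OF \<pi>(1) c] using g(1)
      by (simp add: L_mor_zero del: L_mor.simps)
  qed
  ultimately show ?thesis unfolding carrier_L_summand by blast
qed

definition summand_proj :: "((nat \<Rightarrow> nat) \<Rightarrow> (nat \<Rightarrow> nat \<Rightarrow> nat) \<Rightarrow> complex) \<Rightarrow>
    ((nat \<Rightarrow> nat) \<Rightarrow> (nat \<Rightarrow> nat \<Rightarrow> nat) \<Rightarrow> complex)" where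
  "summand_proj v = (\<lambda>h\<in>gpd_obj l d. if h = f then v h else (\<lambda>_. 0))"

lemma summand_proj_into:
  assumes "v \<in> carrier (L_module l d lam p)"
  shows "summand_proj v \<in> carrier (L_summand l d lam p f)"
  using assms zero_in_L_obj unfolding carrier_L_summand by (auto simp: summand_proj_def)

lemma summand_proj_on:
  assumes u: "u \<in> carrier (L_summand l d lam p f)"
  shows "summand_proj u = u"
proof -
  have "summand_proj u = restrict u (gpd_obj l d)"
    unfolding summand_proj_def using u by (intro restrict_ext) (auto simp: carrier_L_summand)
  then show ?thesis using u by (auto simp: carrier_L_summand)
qed

text \<open>The component at h is computed from the component at \<open>h \<circ> \<pi>\<close>
  alone, so the projection either keeps it or kills it, depending on whether that object is
  f.\<close>

lemma Phi_bar_action_summand_proj: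
  assumes x: "x \<in> carrier (gen_sym_group l d)" and h: "h \<in> gpd_obj l d"
  shows "Phi_bar_action l d lam p \<Phi> x (summand_proj y) h =
    (if x \<in> transport_mats l d f h then Phi_bar_action l d lam p \<Phi> x y h else (\<lambda>_. 0))"
  using x
proof (rule gen_sym_group_monomialE)
  fix \<pi> c assume \<pi>: "\<pi> permutes {1..d}" and c: "\<forall>j\<in>{1..d}. c j ^ l = 1" and x: "x = monomial_mat d \<pi> c"
  show ?thesis
    unfolding x monomial_mat_in_transport_mats[OF l \<pi> c] Phi_bar_action_monomial_mat[OF \<pi> c]
    using h comp_permutes_gpd_obj(1)[OF h \<pi>]
    by (auto simp: summand_proj_def L_mor_zero simp del: L_mor.simps)
qed

text \<open>Transitivity on objects of one type: the standard morphism, taken with entries 1,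
  provides an element.\<close>

lemma transport_mats_nonempty:
  assumes "h \<in> gpd_obj l d" "obj_type l d h = lam"
  shows "transport_mats l d f h \<noteq> {}"
proof -
  have "is_std_mor d f h (std_mor d f h)" using std_mor[OF f assms(1)] type assms(2) by simp
  then have "monomial_mat d (std_mor d f h) (\<lambda>_. 1) \<in> transport_mats l d f h"
    unfolding is_std_mor_def transport_mats_def by fastforce
  then show ?thesis by blast
qed

text \<open>The conjugate by x projects onto the summand to which x takes the one at f. The
  component at h is thus counted once for every x in \<open>transport_mats l d f h\<close>.\<close>

lemma sum_conjugates_summand_proj:
  assumes v: "v \<in> carrier (L_module l d lam p)"
  shows "finsum (L_module l d lam p) (\<lambda>x. Phi_bar_action l d lam p \<Phi> x
      (summand_proj (Phi_bar_action l d lam p \<Phi> (inv\<^bsub>gen_sym_group l d\<^esub> x) v))) (carrier (gen_sym_group l d)) =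
    of_nat (card (transport_mats l d f f)) \<odot>\<^bsub>L_module l d lam p\<^esub> v"
proof -
  let ?G = "gen_sym_group l d" and ?V = "L_module l d lam p" and ?\<rho> = "Phi_bar_action l d lam p \<Phi>"
  interpret G: group ?G by (rule group_gen_sym_group[OF l])
  interpret V: module complex_field ?V by (rule module_L_module)
  let ?F = "\<lambda>x. ?\<rho> x (summand_proj (?\<rho> (inv\<^bsub>?G\<^esub> x) v))"
  have finG: "finite (carrier ?G)" by (rule finite_gen_sym_group[OF l])
  note rep = representation_L_module[unfolded representation_def]
  have lin: "?\<rho> x \<in> linear_maps ?V ?V" if "x \<in> carrier ?G" for x using rep that by blast
  have F: "?F \<in> carrier ?G \<rightarrow> carrier ?V"
  proof
    fix x assume x: "x \<in> carrier ?G"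
    have "?\<rho> (inv\<^bsub>?G\<^esub> x) v \<in> carrier ?V" by (rule linear_mapsD(1)[OF lin[OF G.inv_closed[OF x]] v])
    then have "summand_proj (?\<rho> (inv\<^bsub>?G\<^esub> x) v) \<in> carrier ?V"
      using summand_proj_into unfolding carrier_L_summand by blast
    then show "?F x \<in> carrier ?V" using linear_mapsD(1)[OF lin[OF x]] by blast
  qed
  have Fh: "?F x h = (if x \<in> transport_mats l d f h then v h else (\<lambda>_. 0))"
    if x: "x \<in> carrier ?G" and h: "h \<in> gpd_obj l d" for x h
  proof -
    have "?\<rho> x (?\<rho> (inv\<^bsub>?G\<^esub> x) v) = ?\<rho> (x \<otimes>\<^bsub>?G\<^esub> inv\<^bsub>?G\<^esub> x) v"
      using rep x v G.inv_closed[OF x] by metis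
    also have "\<dots> = v" using rep x v by simp
    finally show ?thesis unfolding Phi_bar_action_summand_proj[OF x h] by simp
  qed
  show ?thesis
  proof (rule PiE_ext)
    show "finsum ?V ?F (carrier ?G) \<in> (\<Pi>\<^sub>E h\<in>gpd_obj l d. carrier (L_obj l d lam p h))"
      using V.M.finsum_closed[OF F] unfolding L_module_simps(1) .
    show "of_nat (card (transport_mats l d f f)) \<odot>\<^bsub>?V\<^esub> v \<in> (\<Pi>\<^sub>E h\<in>gpd_obj l d. carrier (L_obj l d lam p h))"
      using V.smult_closed[OF _ v, of "of_nat (card (transport_mats l d f f))"] unfolding L_module_simps(1) by simp
    fix h assume h: "h \<in> gpd_obj l d"
    let ?L = "L_obj l d lam p h"
    interpret L: module complex_field ?L by (rule module_L_obj)
    have vh: "v h \<in> carrier ?L" using v h by auto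
    have "finsum ?V ?F (carrier ?G) h = finsum ?L (\<lambda>x. ?F x h) (carrier ?G)"
      unfolding L_module_def
      by (rule finsum_direct_sum[OF module_L_obj finG F[unfolded L_module_def] h])
    also have "\<dots> = finsum ?L (\<lambda>_. v h) (transport_mats l d f h)"
      by (rule L.M.add.finprod_mono_neutral_cong_right[OF finG transport_mats_carrier[OF l]])
        (use Fh h vh zero_in_L_obj transport_mats_carrier[OF l] in \<open>auto simp: subset_iff\<close>)
    also have "\<dots> = (\<lambda>r. of_nat (card (transport_mats l d f h)) * v h r)"
      using finsum_const_complex[OF module_L_obj finite_subset[OF transport_mats_carrier[OF l] finG] vh] by simp
    \<comment> \<open>At an object of type \<open>lam\<close> the transporter is a coset of the
      stabilizer; at any other object the component of v is zero and the count is
      irrelevant.\<close>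
    also have "\<dots> = (\<lambda>r. of_nat (card (transport_mats l d f f)) * v h r)"
    proof (cases "obj_type l d h = lam")
      case True
      then show ?thesis using transport_mats_nonempty[OF h] card_transport_mats[OF l] by fastforce
    next
      case False
      then have "v h = (\<lambda>_. 0)" using vh by (simp add: L_obj_zero)
      then show ?thesis by simp
    qed
    also have "\<dots> = (of_nat (card (transport_mats l d f f)) \<odot>\<^bsub>?V\<^esub> v) h" using h by simp
    finally show "finsum ?V ?F (carrier ?G) h = (of_nat (card (transport_mats l d f f)) \<odot>\<^bsub>?V\<^esub> v) h" .
  qed
qed

theorem isomorphic_induced_L_summand:
  "isomorphic_representations (gen_sym_group l d) (L_module l d lam p) (Phi_bar_action l d lam p \<Phi>)
    (induced_module (gen_sym_group l d) (transport_mats l d f f) (L_summand l d lam p f)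
      (Phi_bar_action l d lam p \<Phi>)) (induced_action (gen_sym_group l d))"
proof -
  let ?V = "L_module l d lam p" and ?\<rho> = "Phi_bar_action l d lam p \<Phi>"
  have sub: "carrier (L_summand l d lam p f) \<subseteq> carrier ?V" by (auto simp: L_summand_def)
  show ?thesis
  proof (subst L_summand_eq, rule isomorphic_induced_module[OF representation_L_module finite_gen_sym_group[OF l]
        subgroup_transport_mats[OF l] submodule_L_summand Phi_bar_action_L_summand_stable,
        where E = summand_proj])
    show "summand_proj \<in> linear_maps ?V ?V"
      unfolding linear_maps_def
    proof (intro CollectI conjI ballI allI Pi_I)
      show "summand_proj u \<in> carrier ?V" if "u \<in> carrier ?V" for u
        using summand_proj_into[OF that] sub by blast
    qed (auto simp: summand_proj_def intro!: restrict_ext)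
    show "summand_proj u \<in> carrier (L_summand l d lam p f)" if "u \<in> carrier ?V" for u
      using summand_proj_into[OF that] .
    show "summand_proj u = u" if "u \<in> carrier (L_summand l d lam p f)" for u
      using summand_proj_on[OF that] .
    show "summand_proj (?\<rho> x u) = \<zero>\<^bsub>?V\<^esub>"
      if x: "x \<in> carrier (gen_sym_group l d)" "x \<notin> transport_mats l d f f"
        and u: "u \<in> carrier (L_summand l d lam p f)" for x u
    proof -
      have "?\<rho> x u f = (\<lambda>_. 0)" using Phi_bar_action_summand_proj[OF x(1) f, of u] x(2) summand_proj_on[OF u] by simp
      then show ?thesis unfolding summand_proj_def L_module_simps(2) by (intro restrict_ext) simp
    qed
  qed (assumption | rule sum_conjugates_summand_proj)+
qed

text \<open>Evaluation at f turns stable subspaces of the summand into subspaces of the Specht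
  tensor product that are stable under the Young group, where \<open>specht_tensor_simple\<close>
  decides.\<close>

theorem simple_L_summand:
  assumes p: "p \<in> multipartitions l lam"
  shows "simple_representation ((gen_sym_group l d)\<lparr>carrier := transport_mats l d f f\<rparr>)
    (L_summand l d lam p f) (Phi_bar_action l d lam p \<Phi>)"
proof -
  let ?V = "L_module l d lam p" and ?\<rho> = "Phi_bar_action l d lam p \<Phi>" and ?S = "L_summand l d lam p f"
  let ?T = "carrier (specht_tensor l lam p)"
  have rep: "representation ((gen_sym_group l d)\<lparr>carrier := transport_mats l d f f\<rparr>) ?S ?\<rho>"
    by (subst L_summand_eq, rule subrepresentation[OF representation_L_module subgroup_transport_mats[OF l]
        submodule_L_summand Phi_bar_action_L_summand_stable])
  have Sm: "module complex_field ?S" using rep by (simp add: representation_def)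
  \<comment> \<open>Extension by zero, inverse to evaluation at f on the summand.\<close>
  define emb where "emb F = (\<lambda>h\<in>gpd_obj l d. if h = f then F else (\<lambda>_. 0))"
    for F :: "(nat \<Rightarrow> nat \<Rightarrow> nat) \<Rightarrow> complex"
  have emb: "emb F \<in> carrier ?S" "emb F f = F" if "F \<in> ?T" for F
  proof -
    show "emb F f = F" using f by (simp add: emb_def)
    show "emb F \<in> carrier ?S" using that type zero_in_L_obj unfolding carrier_L_summand by (auto simp: emb_def L_obj_eq)
  qed
  have uf: "u f \<in> ?T" "u = emb (u f)" if u: "u \<in> carrier ?S" for u
  proof -
    show "u f \<in> ?T" using u f type by (auto simp: carrier_L_summand L_obj_eq dest!: PiE_mem)
    have "emb (u f) = restrict u (gpd_obj l d)"
      unfolding emb_def using u by (intro restrict_ext) (auto simp: carrier_L_summand)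
    then show "u = emb (u f)" using u by (auto simp: carrier_L_summand)
  qed
  have ops: "\<zero>\<^bsub>?S\<^esub> = emb (\<lambda>_. 0)" "u \<oplus>\<^bsub>?S\<^esub> v = (\<lambda>h\<in>gpd_obj l d. \<lambda>r. u h r + v h r)"
    "c \<odot>\<^bsub>?S\<^esub> v = (\<lambda>h\<in>gpd_obj l d. \<lambda>r. c * v h r)" for u v c
    by (subst L_summand_eq, simp add: emb_def cong: restrict_cong)+
  have "carrier ?S \<noteq> {\<zero>\<^bsub>?S\<^esub>}"
  proof
    assume *: "carrier ?S = {\<zero>\<^bsub>?S\<^esub>}"
    obtain F where F: "F \<in> ?T" "F \<noteq> (\<lambda>_. 0)" using specht_tensor_nonzero[OF p] by blast
    then have "emb F = emb (\<lambda>_. 0)" using emb(1)[OF F(1)] * ops(1) by auto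
    then have "emb F f = emb (\<lambda>_. 0) f" by simp
    then show False using F f by (simp add: emb_def)
  qed
  moreover have "W = {\<zero>\<^bsub>?S\<^esub>} \<or> W = carrier ?S"
    if W: "submodule W complex_field ?S" and inv: "\<forall>g\<in>transport_mats l d f f. \<forall>w\<in>W. ?\<rho> g w \<in> W" for W
  proof -
    define U where "U = (\<lambda>u. u f) ` W"
    have W': "W \<subseteq> carrier ?S" "\<zero>\<^bsub>?S\<^esub> \<in> W" "\<forall>u\<in>W. \<forall>v\<in>W. u \<oplus>\<^bsub>?S\<^esub> v \<in> W"
      "\<forall>c. \<forall>v\<in>W. c \<odot>\<^bsub>?S\<^esub> v \<in> W"
      using W unfolding complex_submodule_iff[OF Sm] by blast+
    have memU: "F \<in> U \<longleftrightarrow> emb F \<in> W" for F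
      using uf(2) W'(1) f unfolding U_def by (auto simp: image_iff emb_def intro!: bexI[of _ "emb F"])
    have emb_add: "emb (\<lambda>x. F x + H x) = emb F \<oplus>\<^bsub>?S\<^esub> emb H"
      and emb_smult: "emb (\<lambda>x. c * F x) = c \<odot>\<^bsub>?S\<^esub> emb F" for F H c
      unfolding ops by (auto simp: emb_def intro!: restrict_ext)
    have "submodule U complex_field (fun_space UNIV)"
      unfolding submodule_fun_space_iff using W' by (simp add: memU emb_add emb_smult flip: ops(1))
    moreover have "U \<subseteq> ?T" using uf(1) W'(1) by (auto simp: U_def)
    moreover have "specht_tensor_action l lam p \<pi> F \<in> U"
      if \<pi>: "\<pi> \<in> carrier (young_group l lam)" and F: "F \<in> U" for \<pi> F
    proof -
      obtain \<sigma> where \<sigma>: "(f, \<sigma>, f) \<in> gpd_mor l d"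
        and L: "L_mor l d lam p (f, \<sigma>, f) = specht_tensor_action l lam p \<pi>"
        using L_mor_endo_surj[OF lam f type \<pi>] by blast
      have s: "\<sigma> permutes {1..d}" "f \<circ> \<sigma> = f" using \<sigma> by (auto simp: gpd_mor_def)
      obtain u where u: "u \<in> W" "F = u f" using F by (auto simp: U_def)
      \<comment> \<open>With entries 1 the scalar in the action is 1, so this stabilizer element
        acts at f exactly as \<pi> does.\<close>
      have "monomial_mat d \<sigma> (\<lambda>_. 1) \<in> transport_mats l d f f"
        using monomial_mat_in_transport_mats[OF l s(1), of "\<lambda>_. 1" f f] s(2) by simp
      then have mem: "?\<rho> (monomial_mat d \<sigma> (\<lambda>_. 1)) u \<in> W" using inv u(1) by blast
      have eq: "?\<rho> (monomial_mat d \<sigma> (\<lambda>_. 1)) u f = specht_tensor_action l lam p \<pi> F"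
        using Phi_bar_action_monomial_mat[OF s(1), of "\<lambda>_. 1" u] f s(2) L u(2) by (simp del: L_mor.simps)
      show ?thesis unfolding U_def eq[symmetric] using mem by (rule imageI)
    qed
    ultimately have "U = {\<lambda>_. 0} \<or> U = ?T" by (rule specht_tensor_simple)
    then show ?thesis
    proof
      assume U: "U = {\<lambda>_. 0}"
      have "u = \<zero>\<^bsub>?S\<^esub>" if "u \<in> W" for u
      proof -
        have "u f = (\<lambda>_. 0)" using U that by (auto simp: U_def)
        then show ?thesis using uf(2)[of u] W'(1) that ops(1) by auto
      qed
      then show ?thesis using W'(2) by blast
    next
      assume U: "U = ?T"
      have "u \<in> W" if "u \<in> carrier ?S" for u
        using uf[OF that] memU[of "u f"] U by simp
      then show ?thesis using W'(1) by blast
    qed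
  qed
  ultimately show ?thesis using rep unfolding simple_representation_def by simp
qed

end

end

theorem lemma5:
  fixes l d :: nat and \<xi> :: complex
    and \<Phi> :: "(complex mat \<Rightarrow> complex) \<Rightarrow> (mor \<Rightarrow> complex)"
    and lam :: "nat \<Rightarrow> nat" and p :: "nat \<Rightarrow> nat list" and f :: "nat \<Rightarrow> nat"
  assumes "l > 0"
    and "{z. z ^ l = 1} = range (\<lambda>k::nat. \<xi> ^ k)"
    and "\<Phi> \<in> Phi_isos l d \<xi>"
    and "lam \<in> compositions l d"
    and "p \<in> multipartitions l lam"
    and "f \<in> gpd_obj l d"
    and "obj_type l d f = lam"
  shows "simple_representation
           ((gen_sym_group l d)\<lparr>carrier := gen_young_subgroup l d \<xi> f\<rparr>)
           (L_summand l d lam p f) (Phi_bar_action l d lam p \<Phi>)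
       \<and> isomorphic_representations (gen_sym_group l d)
           (L_module l d lam p) (Phi_bar_action l d lam p \<Phi>)
           (induced_module (gen_sym_group l d) (gen_young_subgroup l d \<xi> f)
              (L_summand l d lam p f) (Phi_bar_action l d lam p \<Phi>))
           (induced_action (gen_sym_group l d))"
  unfolding gen_young_subgroup_eq[OF assms(1,2,6)]
  using simple_L_summand[OF assms(1-4,6,7,5)] isomorphic_induced_L_summand[OF assms(1-4,6,7)] by blast

end
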